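(* Let $\mathcal{C}$ be a tensor category over an algebraically closed field $\Bbbk$, let $\Gamma$ be a subgroup of the group $\mathrm{Inv}(\mathcal{C})$ of isomorphism classes of invertible objects of $\mathcal{C}$, and let $A=\bigoplus_{g\in\Gamma}E_g$ be a simple current algebra over $\Gamma$ in $\widehat{\mathcal{C}}$. Then $A$ is a Frobenius algebra with Frobenius form $\lambda:A\to\mathbf 1$ given by the projection to $E_1=\mathbf 1$.
   Context: A tensor category is an essentially small $\Bbbk$-linear abelian category in which every object has finite length and all Hom spaces are finite-dimensional, with a rigid monoidal structure such that $\otimes$ is $\Bbbk$-bilinear and the unit $\mathbf 1$ is simple. $\widehat{\mathcal{C}}$ is its ind-completion with the extended closed monoidal structure; $[M,-]$ denotes the right adjoint of $-\otimes M$ on $\widehat{\mathcal{C}}$. $E_g$ is a chosen object of $\mathcal{C}$ representing $g$, with $E_1=\mathbf 1$. A simple current algebra over $\Gamma$ is an algebra in $\widehat{\mathcal{C}}$ with underlying object $\bigoplus_{g\in\Gamma}E_g$, whose multiplication restricts to an isomorphism $E_x\otimes E_y\to E_{xy}$ for all $x,y\in\Gamma$ and whose unit is the inclusion $\mathbf 1=E_1\to A$. An algebra $A$ in $\widehat{\mathcal{C}}$ with multiplication $\mu$ is a Frobenius algebra with Frobenius form $\lambda:A\to\mathbf 1$ if the morphism $\phi:A\to[A,\mathbf 1]$ corresponding to $\lambda\mu:A\otimes A\to\mathbf 1$ under $\mathrm{Hom}_{\widehat{\mathcal{C}}}(A\otimes A,\mathbf 1)\cong\mathrm{Hom}_{\widehat{\mathcal{C}}}(A,[A,\mathbf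 1])$ is invertible. *)

theory Defs
  imports "HOL-Algebra.Algebraic_Closure" "HOL-Algebra.Module"
begin

text \<open>The notation of \<^theory>\<open>HOL-Algebra.Polynomials\<close> for the indeterminate would capture every variable named \<open>X\<close>.\<close>

no_notation var ("X\<index>")

section \<open>Categories\<close>

text \<open>
  Composition is written in the usual order, \<open>g \<cdot> f\<close> being ``first \<open>f\<close>, then \<open>g\<close>''. As it is not
  indexed by objects, distinct hom-sets are required to be disjoint.
\<close>

record ('o, 'm) cat =
  Ob :: "'o set"
  Hom :: "'o \<Rightarrow> 'o \<Rightarrow> 'm set"
  Idn :: "'o \<Rightarrow> 'm"
  Comp :: "'m \<Rightarrow> 'm \<Rightarrow> 'm" (infixr "\<cdot>\<index>" 70)

locale category =
  fixes C :: "('o, 'm, 'z) cat_scheme" (structure)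
  assumes Hom_disjoint:
      "\<lbrakk>X \<in> Ob C; Y \<in> Ob C; X' \<in> Ob C; Y' \<in> Ob C; f \<in> Hom C X Y; f \<in> Hom C X' Y'\<rbrakk>
        \<Longrightarrow> X = X' \<and> Y = Y'"
    and Idn_closed: "X \<in> Ob C \<Longrightarrow> Idn C X \<in> Hom C X X"
    and Comp_closed:
      "\<lbrakk>X \<in> Ob C; Y \<in> Ob C; Z \<in> Ob C; f \<in> Hom C X Y; g \<in> Hom C Y Z\<rbrakk> \<Longrightarrow> g \<cdot> f \<in> Hom C X Z"
    and Comp_Idn: "\<lbrakk>X \<in> Ob C; Y \<in> Ob C; f \<in> Hom C X Y\<rbrakk> \<Longrightarrow> f \<cdot> Idn C X = f"
    and Idn_Comp: "\<lbrakk>X \<in> Ob C; Y \<in> Ob C; f \<in> Hom C X Y\<rbrakk> \<Longrightarrow> Idn C Y \<cdot> f = f"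
    and Comp_assoc:
      "\<lbrakk>W \<in> Ob C; X \<in> Ob C; Y \<in> Ob C; Z \<in> Ob C;
        f \<in> Hom C W X; g \<in> Hom C X Y; h \<in> Hom C Y Z\<rbrakk> \<Longrightarrow> (h \<cdot> g) \<cdot> f = h \<cdot> (g \<cdot> f)"

definition inverse_mor :: "('o, 'm, 'z) cat_scheme \<Rightarrow> 'o \<Rightarrow> 'o \<Rightarrow> 'm \<Rightarrow> 'm \<Rightarrow> bool" where
  "inverse_mor C X Y f g \<longleftrightarrow> f \<in> Hom C X Y \<and> g \<in> Hom C Y X \<and>
     g \<cdot>\<^bsub>C\<^esub> f = Idn C X \<and> f \<cdot>\<^bsub>C\<^esub> g = Idn C Y"

definition is_iso :: "('o, 'm, 'z) cat_scheme \<Rightarrow> 'o \<Rightarrow> 'o \<Rightarrow> 'm \<Rightarrow> bool" where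
  "is_iso C X Y f \<longleftrightarrow> (\<exists>g. inverse_mor C X Y f g)"

definition the_inverse :: "('o, 'm, 'z) cat_scheme \<Rightarrow> 'o \<Rightarrow> 'o \<Rightarrow> 'm \<Rightarrow> 'm" where
  "the_inverse C X Y f = (THE g. inverse_mor C X Y f g)"

definition isomorphic :: "('o, 'm, 'z) cat_scheme \<Rightarrow> 'o \<Rightarrow> 'o \<Rightarrow> bool" where
  "isomorphic C X Y \<longleftrightarrow> (\<exists>f. is_iso C X Y f)"

definition is_mono :: "('o, 'm, 'z) cat_scheme \<Rightarrow> 'o \<Rightarrow> 'o \<Rightarrow> 'm \<Rightarrow> bool" where
  "is_mono C X Y f \<longleftrightarrow> f \<in> Hom C X Y \<and>
     (\<forall>W\<in>Ob C. \<forall>a\<in>Hom C W X. \<forall>b\<in>Hom C W X. f \<cdot>\<^bsub>C\<^esub> a = f \<cdot>\<^bsub>C\<^esub> b \<longrightarrow> a = b)"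

definition is_epi :: "('o, 'm, 'z) cat_scheme \<Rightarrow> 'o \<Rightarrow> 'o \<Rightarrow> 'm \<Rightarrow> bool" where
  "is_epi C X Y f \<longleftrightarrow> f \<in> Hom C X Y \<and>
     (\<forall>Z\<in>Ob C. \<forall>a\<in>Hom C Y Z. \<forall>b\<in>Hom C Y Z. a \<cdot>\<^bsub>C\<^esub> f = b \<cdot>\<^bsub>C\<^esub> f \<longrightarrow> a = b)"

definition zero_object :: "('o, 'm, 'z) cat_scheme \<Rightarrow> 'o \<Rightarrow> bool" where
  "zero_object C Z \<longleftrightarrow> Z \<in> Ob C \<and>
     (\<forall>X\<in>Ob C. (\<exists>!f. f \<in> Hom C X Z) \<and> (\<exists>!f. f \<in> Hom C Z X))"

definition zero_mor :: "('o, 'm, 'z) cat_scheme \<Rightarrow> 'o \<Rightarrow> 'o \<Rightarrow> 'm \<Rightarrow> bool" where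
  "zero_mor C X Y f \<longleftrightarrow>
     (\<exists>Z a b. zero_object C Z \<and> a \<in> Hom C X Z \<and> b \<in> Hom C Z Y \<and> f = b \<cdot>\<^bsub>C\<^esub> a)"

definition is_kernel :: "('o, 'm, 'z) cat_scheme \<Rightarrow> 'o \<Rightarrow> 'o \<Rightarrow> 'o \<Rightarrow> 'm \<Rightarrow> 'm \<Rightarrow> bool" where
  "is_kernel C N X Y f k \<longleftrightarrow> N \<in> Ob C \<and> k \<in> Hom C N X \<and> zero_mor C N Y (f \<cdot>\<^bsub>C\<^esub> k) \<and>
     (\<forall>W\<in>Ob C. \<forall>a\<in>Hom C W X. zero_mor C W Y (f \<cdot>\<^bsub>C\<^esub> a) \<longrightarrow> (\<exists>!b. b \<in> Hom C W N \<and> k \<cdot>\<^bsub>C\<^esub> b = a))"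

definition is_cokernel :: "('o, 'm, 'z) cat_scheme \<Rightarrow> 'o \<Rightarrow> 'o \<Rightarrow> 'o \<Rightarrow> 'm \<Rightarrow> 'm \<Rightarrow> bool" where
  "is_cokernel C X Y Q f q \<longleftrightarrow> Q \<in> Ob C \<and> q \<in> Hom C Y Q \<and> zero_mor C X Q (q \<cdot>\<^bsub>C\<^esub> f) \<and>
     (\<forall>Z\<in>Ob C. \<forall>a\<in>Hom C Y Z. zero_mor C X Z (a \<cdot>\<^bsub>C\<^esub> f) \<longrightarrow> (\<exists>!b. b \<in> Hom C Q Z \<and> b \<cdot>\<^bsub>C\<^esub> q = a))"

definition is_product :: "('o, 'm, 'z) cat_scheme \<Rightarrow> 'o \<Rightarrow> 'o \<Rightarrow> 'o \<Rightarrow> 'm \<Rightarrow> 'm \<Rightarrow> bool" where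
  "is_product C X Y P p q \<longleftrightarrow> P \<in> Ob C \<and> p \<in> Hom C P X \<and> q \<in> Hom C P Y \<and>
     (\<forall>W\<in>Ob C. \<forall>a\<in>Hom C W X. \<forall>b\<in>Hom C W Y.
        \<exists>!h. h \<in> Hom C W P \<and> p \<cdot>\<^bsub>C\<^esub> h = a \<and> q \<cdot>\<^bsub>C\<^esub> h = b)"

definition is_coproduct ::
    "('o, 'm, 'z) cat_scheme \<Rightarrow> 'i set \<Rightarrow> ('i \<Rightarrow> 'o) \<Rightarrow> 'o \<Rightarrow> ('i \<Rightarrow> 'm) \<Rightarrow> bool" where
  "is_coproduct C I F S \<iota> \<longleftrightarrow> S \<in> Ob C \<and> (\<forall>i\<in>I. \<iota> i \<in> Hom C (F i) S) \<and>
     (\<forall>Y\<in>Ob C. \<forall>f. (\<forall>i\<in>I. f i \<in> Hom C (F i) Y) \<longrightarrow>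
        (\<exists>!h. h \<in> Hom C S Y \<and> (\<forall>i\<in>I. h \<cdot>\<^bsub>C\<^esub> \<iota> i = f i)))"

locale abelian_category = category +
  assumes ex_zero: "\<exists>Z. zero_object C Z"
    and ex_product: "\<lbrakk>X \<in> Ob C; Y \<in> Ob C\<rbrakk> \<Longrightarrow> \<exists>P p q. is_product C X Y P p q"
    and ex_coproduct:
      "\<lbrakk>X \<in> Ob C; Y \<in> Ob C\<rbrakk> \<Longrightarrow> \<exists>S \<iota>. is_coproduct C UNIV (\<lambda>b::bool. if b then X else Y) S \<iota>"
    and ex_kernel: "\<lbrakk>X \<in> Ob C; Y \<in> Ob C; f \<in> Hom C X Y\<rbrakk> \<Longrightarrow> \<exists>N k. is_kernel C N X Y f k"
    and ex_cokernel: "\<lbrakk>X \<in> Ob C; Y \<in> Ob C; f \<in> Hom C X Y\<rbrakk> \<Longrightarrow> \<exists>Q q. is_cokernel C X Y Q f q"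
    and mono_normal:
      "\<lbrakk>X \<in> Ob C; Y \<in> Ob C; is_mono C X Y f\<rbrakk> \<Longrightarrow>
        \<exists>Z\<in>Ob C. \<exists>g\<in>Hom C Y Z. is_kernel C X Y Z g f"
    and epi_normal:
      "\<lbrakk>X \<in> Ob C; Y \<in> Ob C; is_epi C X Y f\<rbrakk> \<Longrightarrow>
        \<exists>W\<in>Ob C. \<exists>g\<in>Hom C W X. is_cokernel C W X Y g f"

definition simple_object :: "('o, 'm, 'z) cat_scheme \<Rightarrow> 'o \<Rightarrow> bool" where
  "simple_object C X \<longleftrightarrow> X \<in> Ob C \<and> \<not> zero_object C X \<and>
     (\<forall>Y\<in>Ob C. \<forall>i. is_mono C Y X i \<longrightarrow> zero_object C Y \<or> is_iso C Y X i)"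

text \<open>Existence of a composition series.\<close>

inductive finite_length :: "('o, 'm, 'z) cat_scheme \<Rightarrow> 'o \<Rightarrow> bool" for C where
  zero: "zero_object C X \<Longrightarrow> finite_length C X"
| step: "\<lbrakk>finite_length C Y; X \<in> Ob C; is_mono C Y X i; is_cokernel C Y X S i q; simple_object C S\<rbrakk>
          \<Longrightarrow> finite_length C X"


section \<open>Monoidal categories\<close>

record ('o, 'm) moncat = "('o, 'm) cat" +
  TensO :: "'o \<Rightarrow> 'o \<Rightarrow> 'o" (infixr "\<boxtimes>\<index>" 75)
  TensM :: "'m \<Rightarrow> 'm \<Rightarrow> 'm" (infixr "\<star>\<index>" 75)
  Unit :: 'o
  Assoc :: "'o \<Rightarrow> 'o \<Rightarrow> 'o \<Rightarrow> 'm"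
  LUnit :: "'o \<Rightarrow> 'm"
  RUnit :: "'o \<Rightarrow> 'm"

locale monoidal_category = category C for C :: "('o, 'm, 'z) moncat_scheme" (structure) +
  assumes TensO_closed: "\<lbrakk>X \<in> Ob C; Y \<in> Ob C\<rbrakk> \<Longrightarrow> X \<boxtimes> Y \<in> Ob C"
    and TensM_closed:
      "\<lbrakk>X \<in> Ob C; X' \<in> Ob C; Y \<in> Ob C; Y' \<in> Ob C; f \<in> Hom C X X'; g \<in> Hom C Y Y'\<rbrakk>
        \<Longrightarrow> f \<star> g \<in> Hom C (X \<boxtimes> Y) (X' \<boxtimes> Y')"
    and TensM_Idn: "\<lbrakk>X \<in> Ob C; Y \<in> Ob C\<rbrakk> \<Longrightarrow> Idn C X \<star> Idn C Y = Idn C (X \<boxtimes> Y)"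
    and TensM_Comp:
      "\<lbrakk>X \<in> Ob C; X' \<in> Ob C; X'' \<in> Ob C; Y \<in> Ob C; Y' \<in> Ob C; Y'' \<in> Ob C;
        f \<in> Hom C X X'; f' \<in> Hom C X' X''; g \<in> Hom C Y Y'; g' \<in> Hom C Y' Y''\<rbrakk>
        \<Longrightarrow> (f' \<cdot> f) \<star> (g' \<cdot> g) = (f' \<star> g') \<cdot> (f \<star> g)"
    and Unit_closed: "Unit C \<in> Ob C"
    and Assoc_iso:
      "\<lbrakk>X \<in> Ob C; Y \<in> Ob C; Z \<in> Ob C\<rbrakk>
        \<Longrightarrow> is_iso C ((X \<boxtimes> Y) \<boxtimes> Z) (X \<boxtimes> (Y \<boxtimes> Z)) (Assoc C X Y Z)"
    and LUnit_iso: "X \<in> Ob C \<Longrightarrow> is_iso C (Unit C \<boxtimes> X) X (LUnit C X)"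
    and RUnit_iso: "X \<in> Ob C \<Longrightarrow> is_iso C (X \<boxtimes> Unit C) X (RUnit C X)"
    and Assoc_natural:
      "\<lbrakk>X \<in> Ob C; X' \<in> Ob C; Y \<in> Ob C; Y' \<in> Ob C; Z \<in> Ob C; Z' \<in> Ob C;
        f \<in> Hom C X X'; g \<in> Hom C Y Y'; h \<in> Hom C Z Z'\<rbrakk>
        \<Longrightarrow> Assoc C X' Y' Z' \<cdot> ((f \<star> g) \<star> h) = (f \<star> (g \<star> h)) \<cdot> Assoc C X Y Z"
    and LUnit_natural:
      "\<lbrakk>X \<in> Ob C; Y \<in> Ob C; f \<in> Hom C X Y\<rbrakk>
        \<Longrightarrow> LUnit C Y \<cdot> (Idn C (Unit C) \<star> f) = f \<cdot> LUnit C X"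
    and RUnit_natural:
      "\<lbrakk>X \<in> Ob C; Y \<in> Ob C; f \<in> Hom C X Y\<rbrakk>
        \<Longrightarrow> RUnit C Y \<cdot> (f \<star> Idn C (Unit C)) = f \<cdot> RUnit C X"
    and pentagon:
      "\<lbrakk>W \<in> Ob C; X \<in> Ob C; Y \<in> Ob C; Z \<in> Ob C\<rbrakk>
        \<Longrightarrow> (Idn C W \<star> Assoc C X Y Z) \<cdot> Assoc C W (X \<boxtimes> Y) Z \<cdot> (Assoc C W X Y \<star> Idn C Z)
          = Assoc C W X (Y \<boxtimes> Z) \<cdot> Assoc C (W \<boxtimes> X) Y Z"
    and triangle:
      "\<lbrakk>X \<in> Ob C; Y \<in> Ob C\<rbrakk>
        \<Longrightarrow> (Idn C X \<star> LUnit C Y) \<cdot> Assoc C X (Unit C) Y = RUnit C X \<star> Idn C Y"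

text \<open>\<open>Y\<close> is a left dual of \<open>X\<close>, equivalently \<open>X\<close> is a right dual of \<open>Y\<close>.\<close>

definition dual_pair :: "('o, 'm, 'z) moncat_scheme \<Rightarrow> 'o \<Rightarrow> 'o \<Rightarrow> 'm \<Rightarrow> 'm \<Rightarrow> bool" where
  "dual_pair C Y X ev coev \<longleftrightarrow>
     ev \<in> Hom C (Y \<boxtimes>\<^bsub>C\<^esub> X) (Unit C) \<and> coev \<in> Hom C (Unit C) (X \<boxtimes>\<^bsub>C\<^esub> Y) \<and>
     RUnit C X \<cdot>\<^bsub>C\<^esub> (Idn C X \<star>\<^bsub>C\<^esub> ev) \<cdot>\<^bsub>C\<^esub> Assoc C X Y X \<cdot>\<^bsub>C\<^esub> (coev \<star>\<^bsub>C\<^esub> Idn C X) = LUnit C X \<and>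
     LUnit C Y \<cdot>\<^bsub>C\<^esub> (ev \<star>\<^bsub>C\<^esub> Idn C Y) \<cdot>\<^bsub>C\<^esub>
       the_inverse C ((Y \<boxtimes>\<^bsub>C\<^esub> X) \<boxtimes>\<^bsub>C\<^esub> Y) (Y \<boxtimes>\<^bsub>C\<^esub> (X \<boxtimes>\<^bsub>C\<^esub> Y)) (Assoc C Y X Y) \<cdot>\<^bsub>C\<^esub>
       (Idn C Y \<star>\<^bsub>C\<^esub> coev) = RUnit C Y"

locale rigid_monoidal_category = monoidal_category +
  assumes ex_left_dual: "X \<in> Ob C \<Longrightarrow> \<exists>Y\<in>Ob C. \<exists>ev coev. dual_pair C Y X ev coev"
    and ex_right_dual: "X \<in> Ob C \<Longrightarrow> \<exists>Y\<in>Ob C. \<exists>ev coev. dual_pair C X Y ev coev"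

definition invertible_object :: "('o, 'm, 'z) moncat_scheme \<Rightarrow> 'o \<Rightarrow> bool" where
  "invertible_object C X \<longleftrightarrow> X \<in> Ob C \<and>
     (\<exists>Y\<in>Ob C. isomorphic C (X \<boxtimes>\<^bsub>C\<^esub> Y) (Unit C) \<and> isomorphic C (Y \<boxtimes>\<^bsub>C\<^esub> X) (Unit C))"

definition iso_class :: "('o, 'm, 'z) cat_scheme \<Rightarrow> 'o \<Rightarrow> 'o set" where
  "iso_class C X = {Y \<in> Ob C. isomorphic C Y X}"

definition Inv :: "('o, 'm, 'z) moncat_scheme \<Rightarrow> 'o set monoid" where
  "Inv C = \<lparr>carrier = {iso_class C X | X. invertible_object C X},
            monoid.mult = (\<lambda>G H. \<Union>X\<in>G. \<Union>Y\<in>H. iso_class C (X \<boxtimes>\<^bsub>C\<^esub> Y)),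
            one = iso_class C (Unit C)\<rparr>"

definition algebra_in :: "('o, 'm, 'z) moncat_scheme \<Rightarrow> 'o \<Rightarrow> 'm \<Rightarrow> 'm \<Rightarrow> bool" where
  "algebra_in D A \<mu> \<eta> \<longleftrightarrow> A \<in> Ob D \<and>
     \<mu> \<in> Hom D (A \<boxtimes>\<^bsub>D\<^esub> A) A \<and> \<eta> \<in> Hom D (Unit D) A \<and>
     \<mu> \<cdot>\<^bsub>D\<^esub> (\<mu> \<star>\<^bsub>D\<^esub> Idn D A) = \<mu> \<cdot>\<^bsub>D\<^esub> (Idn D A \<star>\<^bsub>D\<^esub> \<mu>) \<cdot>\<^bsub>D\<^esub> Assoc D A A A \<and>
     \<mu> \<cdot>\<^bsub>D\<^esub> (\<eta> \<star>\<^bsub>D\<^esub> Idn D A) = LUnit D A \<and>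
     \<mu> \<cdot>\<^bsub>D\<^esub> (Idn D A \<star>\<^bsub>D\<^esub> \<eta>) = RUnit D A"

text \<open>\<open>(H, ev)\<close> is the value at \<open>N\<close>, with its counit, of the right adjoint of \<open>- \<boxtimes> M\<close>.\<close>

definition internal_hom :: "('o, 'm, 'z) moncat_scheme \<Rightarrow> 'o \<Rightarrow> 'o \<Rightarrow> 'o \<Rightarrow> 'm \<Rightarrow> bool" where
  "internal_hom D M N H ev \<longleftrightarrow> H \<in> Ob D \<and> ev \<in> Hom D (H \<boxtimes>\<^bsub>D\<^esub> M) N \<and>
     (\<forall>X\<in>Ob D. \<forall>f\<in>Hom D (X \<boxtimes>\<^bsub>D\<^esub> M) N.
        \<exists>!g. g \<in> Hom D X H \<and> ev \<cdot>\<^bsub>D\<^esub> (g \<star>\<^bsub>D\<^esub> Idn D M) = f)"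

text \<open>
  The object \<open>[A, 1]\<close> is only defined up to isomorphism: it is required to exist, and the transpose
  \<open>\<phi>\<close> of \<open>\<lambda>\<mu>\<close> to be invertible for each choice of it.
\<close>

definition frobenius_algebra ::
    "('o, 'm, 'z) moncat_scheme \<Rightarrow> 'o \<Rightarrow> 'm \<Rightarrow> 'm \<Rightarrow> 'm \<Rightarrow> bool" where
  "frobenius_algebra D A \<mu> \<eta> l \<longleftrightarrow> algebra_in D A \<mu> \<eta> \<and> l \<in> Hom D A (Unit D) \<and>
     (\<exists>H ev. internal_hom D A (Unit D) H ev) \<and>
     (\<forall>H ev \<phi>. internal_hom D A (Unit D) H ev \<and> \<phi> \<in> Hom D A H \<and>
        ev \<cdot>\<^bsub>D\<^esub> (\<phi> \<star>\<^bsub>D\<^esub> Idn D A) = l \<cdot>\<^bsub>D\<^esub> \<mu> \<longrightarrow> is_iso D A H \<phi>)"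


section \<open>Tensor categories\<close>

text \<open>
  The sets of cardinality at most that of the infinite type \<open>'u index\<close>, for an arbitrary type \<open>'u\<close>,
  play the role of the small sets.
\<close>

datatype 'u index = Star | Atom 'u | Pair (left: "'u index") (right: "'u index")

definition essentially_small :: "'u itself \<Rightarrow> ('o, 'm, 'z) cat_scheme \<Rightarrow> bool" where
  "essentially_small U C \<longleftrightarrow>
     (\<exists>S\<subseteq>Ob C. (\<exists>e :: 'o \<Rightarrow> 'u index. inj_on e S) \<and> (\<forall>X\<in>Ob C. \<exists>Y\<in>S. isomorphic C X Y)) \<and>
     (\<forall>X\<in>Ob C. \<forall>Y\<in>Ob C. \<exists>e :: 'm \<Rightarrow> 'u index. inj_on e (Hom C X Y))"

record ('k, 'o, 'm) lin_moncat = "('o, 'm) moncat" +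
  hzero :: "'o \<Rightarrow> 'o \<Rightarrow> 'm"
  hadd :: "'m \<Rightarrow> 'm \<Rightarrow> 'm"
  hsmult :: "'k \<Rightarrow> 'm \<Rightarrow> 'm"

text \<open>The fields \<open>mult\<close> and \<open>one\<close> play no role in \<^locale>\<open>module\<close>.\<close>

definition hom_space :: "('k, 'o, 'm, 'z) lin_moncat_scheme \<Rightarrow> 'o \<Rightarrow> 'o \<Rightarrow> ('k, 'm) module" where
  "hom_space C X Y = \<lparr>carrier = Hom C X Y, monoid.mult = undefined, one = undefined,
     zero = hzero C X Y, add = hadd C, smult = hsmult C\<rparr>"

definition finite_dimensional :: "('k, 'r) ring_scheme \<Rightarrow> ('k, 'm, 's) module_scheme \<Rightarrow> bool" where
  "finite_dimensional K V \<longleftrightarrow> (\<exists>B. finite B \<and> B \<subseteq> carrier V \<and>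
     (\<forall>v\<in>carrier V. \<exists>c\<in>B \<rightarrow> carrier K. v = (\<Oplus>\<^bsub>V\<^esub>b\<in>B. c b \<odot>\<^bsub>V\<^esub> b)))"

locale tensor_category =
  field K + abelian_category C + rigid_monoidal_category C
  for U :: "'u itself" and K :: "('k, 'r) ring_scheme"
    and C :: "('k, 'o, 'm, 'z) lin_moncat_scheme" (structure) +
  assumes essentially_small: "essentially_small U C"
    and hom_module: "\<lbrakk>X \<in> Ob C; Y \<in> Ob C\<rbrakk> \<Longrightarrow> module K (hom_space C X Y)"
    and hom_finite_dimensional:
      "\<lbrakk>X \<in> Ob C; Y \<in> Ob C\<rbrakk> \<Longrightarrow> finite_dimensional K (hom_space C X Y)"
    and Comp_add_left:
      "\<lbrakk>X \<in> Ob C; Y \<in> Ob C; Z \<in> Ob C; f \<in> Hom C X Y; g \<in> Hom C Y Z; g' \<in> Hom C Y Z\<rbrakk>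
        \<Longrightarrow> hadd C g g' \<cdot> f = hadd C (g \<cdot> f) (g' \<cdot> f)"
    and Comp_add_right:
      "\<lbrakk>X \<in> Ob C; Y \<in> Ob C; Z \<in> Ob C; f \<in> Hom C X Y; f' \<in> Hom C X Y; g \<in> Hom C Y Z\<rbrakk>
        \<Longrightarrow> g \<cdot> hadd C f f' = hadd C (g \<cdot> f) (g \<cdot> f')"
    and Comp_smult_left:
      "\<lbrakk>X \<in> Ob C; Y \<in> Ob C; Z \<in> Ob C; c \<in> carrier K; f \<in> Hom C X Y; g \<in> Hom C Y Z\<rbrakk>
        \<Longrightarrow> hsmult C c g \<cdot> f = hsmult C c (g \<cdot> f)"
    and Comp_smult_right:
      "\<lbrakk>X \<in> Ob C; Y \<in> Ob C; Z \<in> Ob C; c \<in> carrier K; f \<in> Hom C X Y; g \<in> Hom C Y Z\<rbrakk>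
        \<Longrightarrow> g \<cdot> hsmult C c f = hsmult C c (g \<cdot> f)"
    and TensM_add_left:
      "\<lbrakk>X \<in> Ob C; X' \<in> Ob C; Y \<in> Ob C; Y' \<in> Ob C;
        f \<in> Hom C X X'; f' \<in> Hom C X X'; g \<in> Hom C Y Y'\<rbrakk>
        \<Longrightarrow> hadd C f f' \<star> g = hadd C (f \<star> g) (f' \<star> g)"
    and TensM_add_right:
      "\<lbrakk>X \<in> Ob C; X' \<in> Ob C; Y \<in> Ob C; Y' \<in> Ob C;
        f \<in> Hom C X X'; g \<in> Hom C Y Y'; g' \<in> Hom C Y Y'\<rbrakk>
        \<Longrightarrow> f \<star> hadd C g g' = hadd C (f \<star> g) (f \<star> g')"
    and TensM_smult_left:
      "\<lbrakk>X \<in> Ob C; X' \<in> Ob C; Y \<in> Ob C; Y' \<in> Ob C; c \<in> carrier K; f \<in> Hom C X X'; g \<in> Hom C Y Y'\<rbrakk>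
        \<Longrightarrow> hsmult C c f \<star> g = hsmult C c (f \<star> g)"
    and TensM_smult_right:
      "\<lbrakk>X \<in> Ob C; X' \<in> Ob C; Y \<in> Ob C; Y' \<in> Ob C; c \<in> carrier K; f \<in> Hom C X X'; g \<in> Hom C Y Y'\<rbrakk>
        \<Longrightarrow> f \<star> hsmult C c g = hsmult C c (f \<star> g)"
    and all_finite_length: "X \<in> Ob C \<Longrightarrow> finite_length C X"
    and Unit_simple: "simple_object C (Unit C)"


section \<open>The ind-completion\<close>

text \<open>
  An ind-object of \<open>C\<close> is a functor from a small filtered category to \<open>C\<close>, and
  \<open>Hom (X, Y) = lim\<^sub>i colim\<^sub>j Hom (X\<^sub>i, Y\<^sub>j)\<close>.
\<close>

definition filtered :: "('i, 'a, 'z) cat_scheme \<Rightarrow> bool" where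
  "filtered J \<longleftrightarrow> Ob J \<noteq> {} \<and>
     (\<forall>i\<in>Ob J. \<forall>j\<in>Ob J. \<exists>k\<in>Ob J. Hom J i k \<noteq> {} \<and> Hom J j k \<noteq> {}) \<and>
     (\<forall>i\<in>Ob J. \<forall>j\<in>Ob J. \<forall>u\<in>Hom J i j. \<forall>v\<in>Hom J i j.
        \<exists>k\<in>Ob J. \<exists>w\<in>Hom J j k. w \<cdot>\<^bsub>J\<^esub> u = w \<cdot>\<^bsub>J\<^esub> v)"

record ('u, 'o, 'm) ind_obj =
  ix :: "('u index, 'u index) cat"
  ob :: "'u index \<Rightarrow> 'o"
  ar :: "'u index \<Rightarrow> 'm"

definition ind_object :: "('o, 'm, 'z) cat_scheme \<Rightarrow> ('u, 'o, 'm) ind_obj \<Rightarrow> bool" where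
  "ind_object C X \<longleftrightarrow> category (ix X) \<and> filtered (ix X) \<and>
     (\<forall>i\<in>Ob (ix X). ob X i \<in> Ob C \<and> ar X (Idn (ix X) i) = Idn C (ob X i)) \<and>
     (\<forall>i\<in>Ob (ix X). \<forall>j\<in>Ob (ix X). \<forall>u\<in>Hom (ix X) i j. ar X u \<in> Hom C (ob X i) (ob X j)) \<and>
     (\<forall>i\<in>Ob (ix X). \<forall>j\<in>Ob (ix X). \<forall>k\<in>Ob (ix X). \<forall>u\<in>Hom (ix X) i j. \<forall>v\<in>Hom (ix X) j k.
        ar X (v \<cdot>\<^bsub>ix X\<^esub> u) = ar X v \<cdot>\<^bsub>C\<^esub> ar X u)"

text \<open>The class of \<open>h : V \<rightarrow> Y\<^sub>j\<close> in the colimit of the sets \<open>Hom (V, Y\<^sub>j)\<close>.\<close>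

definition germ ::
    "('o, 'm, 'z) cat_scheme \<Rightarrow> 'o \<Rightarrow> ('u, 'o, 'm) ind_obj \<Rightarrow> 'u index \<times> 'm \<Rightarrow> ('u index \<times> 'm) set"
  where
  "germ C V Y = (\<lambda>(j, h). {(j', h'). j' \<in> Ob (ix Y) \<and> h' \<in> Hom C V (ob Y j') \<and>
     (\<exists>k\<in>Ob (ix Y). \<exists>u\<in>Hom (ix Y) j k. \<exists>v\<in>Hom (ix Y) j' k. ar Y u \<cdot>\<^bsub>C\<^esub> h = ar Y v \<cdot>\<^bsub>C\<^esub> h')})"

text \<open>
  \<open>cls f i\<close> is the component of \<open>f\<close> at \<open>i\<close>, an element of the colimit of the sets
  \<open>Hom (X\<^sub>i, Y\<^sub>j)\<close>. It is set to be empty where \<open>i\<close> is not an index, so that morphisms are equal as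
  soon as their components are.
\<close>

record ('u, 'o, 'm) ind_mor =
  src :: "('u, 'o, 'm) ind_obj"
  tgt :: "('u, 'o, 'm) ind_obj"
  cls :: "'u index \<Rightarrow> ('u index \<times> 'm) set"

definition ind_Hom ::
    "('o, 'm, 'z) cat_scheme \<Rightarrow> ('u, 'o, 'm) ind_obj \<Rightarrow> ('u, 'o, 'm) ind_obj \<Rightarrow>
     ('u, 'o, 'm) ind_mor set" where
  "ind_Hom C X Y = {f. src f = X \<and> tgt f = Y \<and>
     (\<forall>i\<in>Ob (ix X). \<exists>j\<in>Ob (ix Y). \<exists>h\<in>Hom C (ob X i) (ob Y j). cls f i = germ C (ob X i) Y (j, h)) \<and>
     (\<forall>i\<in>Ob (ix X). \<forall>i'\<in>Ob (ix X). \<forall>u\<in>Hom (ix X) i i'. \<forall>(j, h)\<in>cls f i'.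
        (j, h \<cdot>\<^bsub>C\<^esub> ar X u) \<in> cls f i) \<and>
     (\<forall>i. i \<notin> Ob (ix X) \<longrightarrow> cls f i = {})}"

text \<open>The morphism whose component at \<open>i\<close> is represented by \<open>F i\<close>.\<close>

definition ind_map ::
    "('o, 'm, 'z) cat_scheme \<Rightarrow> ('u, 'o, 'm) ind_obj \<Rightarrow> ('u, 'o, 'm) ind_obj \<Rightarrow>
     ('u index \<Rightarrow> 'u index \<times> 'm) \<Rightarrow> ('u, 'o, 'm) ind_mor" where
  "ind_map C X Y F = \<lparr>src = X, tgt = Y,
     cls = (\<lambda>i. if i \<in> Ob (ix X) then germ C (ob X i) Y (F i) else {})\<rparr>"

definition ind_comp ::
    "('o, 'm, 'z) cat_scheme \<Rightarrow> ('u, 'o, 'm) ind_mor \<Rightarrow> ('u, 'o, 'm) ind_mor \<Rightarrow>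
     ('u, 'o, 'm) ind_mor" where
  "ind_comp C g f = \<lparr>src = src f, tgt = tgt g,
     cls = (\<lambda>i. \<Union>(j, a)\<in>cls f i. \<Union>(k, b)\<in>cls g j.
              germ C (ob (src f) i) (tgt g) (k, b \<cdot>\<^bsub>C\<^esub> a))\<rparr>"

definition prod_cat ::
    "('u index, 'u index) cat \<Rightarrow> ('u index, 'u index) cat \<Rightarrow> ('u index, 'u index) cat" where
  "prod_cat I J = \<lparr>
     Ob = {Pair i j | i j. i \<in> Ob I \<and> j \<in> Ob J},
     Hom = (\<lambda>p q. {Pair u v | u v. u \<in> Hom I (left p) (left q) \<and> v \<in> Hom J (right p) (right q)}),
     Idn = (\<lambda>p. Pair (Idn I (left p)) (Idn J (right p))),
     Comp = (\<lambda>w w'. Pair (left w \<cdot>\<^bsub>I\<^esub> left w') (right w \<cdot>\<^bsub>J\<^esub> right w'))\<rparr>"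

definition ind_tensor ::
    "('o, 'm, 'z) moncat_scheme \<Rightarrow> ('u, 'o, 'm) ind_obj \<Rightarrow> ('u, 'o, 'm) ind_obj \<Rightarrow>
     ('u, 'o, 'm) ind_obj" where
  "ind_tensor C X Y = \<lparr>ix = prod_cat (ix X) (ix Y),
     ob = (\<lambda>p. ob X (left p) \<boxtimes>\<^bsub>C\<^esub> ob Y (right p)),
     ar = (\<lambda>w. ar X (left w) \<star>\<^bsub>C\<^esub> ar Y (right w))\<rparr>"

definition ind_tensor_mor ::
    "('o, 'm, 'z) moncat_scheme \<Rightarrow> ('u, 'o, 'm) ind_mor \<Rightarrow> ('u, 'o, 'm) ind_mor \<Rightarrow>
     ('u, 'o, 'm) ind_mor" where
  "ind_tensor_mor C f g =
     (let X = ind_tensor C (src f) (src g); Y = ind_tensor C (tgt f) (tgt g) in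
      \<lparr>src = X, tgt = Y,
       cls = (\<lambda>p. if p \<in> Ob (ix X)
                then \<Union>(i, a)\<in>cls f (left p). \<Union>(j, b)\<in>cls g (right p).
                       germ C (ob X p) Y (Pair i j, a \<star>\<^bsub>C\<^esub> b)
                else {})\<rparr>)"

text \<open>The embedding of \<open>C\<close> into its ind-completion, on objects.\<close>

definition const_ind :: "('o, 'm, 'z) cat_scheme \<Rightarrow> 'o \<Rightarrow> ('u, 'o, 'm) ind_obj" where
  "const_ind C V =
     \<lparr>ix = \<lparr>Ob = {Star}, Hom = (\<lambda>_ _. {Star}), Idn = (\<lambda>_. Star), Comp = (\<lambda>_ _. Star)\<rparr>,
      ob = (\<lambda>_. V), ar = (\<lambda>_. Idn C V)\<rparr>"

definition Ind ::
    "('o, 'm, 'z) moncat_scheme \<Rightarrow> (('u, 'o, 'm) ind_obj, ('u, 'o, 'm) ind_mor) moncat" where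
  "Ind C = \<lparr>
     Ob = {X. ind_object C X},
     Hom = ind_Hom C,
     Idn = (\<lambda>X. ind_map C X X (\<lambda>i. (i, Idn C (ob X i)))),
     Comp = ind_comp C,
     TensO = ind_tensor C,
     TensM = ind_tensor_mor C,
     Unit = const_ind C (Unit C),
     Assoc = (\<lambda>X Y Z. ind_map C (ind_tensor C (ind_tensor C X Y) Z) (ind_tensor C X (ind_tensor C Y Z))
       (\<lambda>p. let i = left (left p); j = right (left p); k = right p in
            (Pair i (Pair j k), Assoc C (ob X i) (ob Y j) (ob Z k)))),
     LUnit = (\<lambda>X. ind_map C (ind_tensor C (const_ind C (Unit C)) X) X
       (\<lambda>p. (right p, LUnit C (ob X (right p))))),
     RUnit = (\<lambda>X. ind_map C (ind_tensor C X (const_ind C (Unit C))) X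
       (\<lambda>p. (left p, RUnit C (ob X (left p)))))\<rparr>"


section \<open>Simple current algebras\<close>

text \<open>
  \<open>A\<close> is the coproduct of the \<open>E g\<close> in the ind-completion, with inclusions \<open>\<iota> g\<close>.
\<close>

definition simple_current_algebra ::
    "('o, 'm, 'z) moncat_scheme \<Rightarrow> 'o set set \<Rightarrow> ('o set \<Rightarrow> 'o) \<Rightarrow>
     ('u, 'o, 'm) ind_obj \<Rightarrow> ('o set \<Rightarrow> ('u, 'o, 'm) ind_mor) \<Rightarrow>
     ('u, 'o, 'm) ind_mor \<Rightarrow> ('u, 'o, 'm) ind_mor \<Rightarrow> bool" where
  "simple_current_algebra C \<Gamma> E A \<iota> \<mu> \<eta> \<longleftrightarrow>
     algebra_in (Ind C) A \<mu> \<eta> \<and>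
     is_coproduct (Ind C) \<Gamma> (\<lambda>g. const_ind C (E g)) A \<iota> \<and>
     (\<forall>x\<in>\<Gamma>. \<forall>y\<in>\<Gamma>. \<exists>m.
        is_iso (Ind C) (const_ind C (E x) \<boxtimes>\<^bsub>Ind C\<^esub> const_ind C (E y)) (const_ind C (E (x \<otimes>\<^bsub>Inv C\<^esub> y))) m \<and>
        \<mu> \<cdot>\<^bsub>Ind C\<^esub> (\<iota> x \<star>\<^bsub>Ind C\<^esub> \<iota> y) = \<iota> (x \<otimes>\<^bsub>Inv C\<^esub> y) \<cdot>\<^bsub>Ind C\<^esub> m) \<and>
     \<eta> = \<iota> \<one>\<^bsub>Inv C\<^esub>"

definition projection ::
    "('o, 'm, 'z) cat_scheme \<Rightarrow> 'i set \<Rightarrow> ('i \<Rightarrow> 'o) \<Rightarrow> 'o \<Rightarrow> ('i \<Rightarrow> 'm) \<Rightarrow> 'i \<Rightarrow> 'm" where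
  "projection D I F S \<iota> i = (THE p. p \<in> Hom D S (F i) \<and> p \<cdot>\<^bsub>D\<^esub> \<iota> i = Idn D (F i) \<and>
     (\<forall>j\<in>I - {i}. zero_mor D (F j) (F i) (p \<cdot>\<^bsub>D\<^esub> \<iota> j)))"

end

theory Submission
  imports Defs
begin

text \<open>
  Write \<open>\<beta> = \<lambda>\<mu> : A \<otimes> A \<rightarrow> 1\<close>, where \<open>\<lambda>\<close> is the projection to \<open>E\<^sub>1 = 1\<close>. The claim is that
  \<open>(A, \<beta>)\<close> itself has the universal property of \<open>[A, 1]\<close>; the transpose of \<open>\<lambda>\<mu>\<close> into any
  other model of \<open>[A, 1]\<close> is then the comparison between two objects with the same universal
  property (lemma \<open>internal_hom_comparison_iso\<close>).

  On summands, \<open>\<beta>\<close> vanishes on \<open>E\<^sub>x \<otimes> E\<^sub>y\<close> unless \<open>x = y\<inverse>\<close>, where it is an isomorphism onto \<open>1\<close>.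
  As \<open>- \<otimes> E\<^sub>y\<close> is then an equivalence, a morphism \<open>W \<otimes> E\<^sub>y \<rightarrow> 1\<close> is the same as a morphism
  from \<open>W\<close> to the object indexed by \<open>y\<inverse>\<close> (lemma \<open>pairing_invertible_universal\<close>). For an object
  \<open>W\<close> of \<open>C\<close>, a morphism \<open>W \<otimes> A \<rightarrow> 1\<close> is therefore a family of morphisms \<open>W \<rightarrow> E\<^sub>x\<close>, one for
  each \<open>x\<close>, that is, a morphism from \<open>W\<close> to the product of the \<open>E\<^sub>x\<close>. What has to be shown is
  that such families are the same as morphisms from \<open>W\<close> to the coproduct \<open>A\<close>. Two facts give this.

  The objects \<open>E\<^sub>x\<close> are simple and pairwise non-isomorphic, so an object of finite length has
  nonzero morphisms to only finitely many of them (lemma \<open>finite_nonzero_Hom\<close>). All the families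
  in question are thus finitely supported, and come from a finite partial sum.

  Objects of \<open>C\<close> are compact in the ind-completion, so a morphism from \<open>W\<close> to \<open>A\<close> does factor
  through a finite partial sum, and its projections determine it. Since \<open>A\<close> is known only by its
  universal property, this is obtained by comparing \<open>A\<close> with the filtered diagram of all finite
  partial sums (lemma \<open>transition_factors_through_finite_sum\<close>). The same lemma shows that
  morphisms out of \<open>V \<otimes> A\<close> are determined on the \<open>V \<otimes> E\<^sub>x\<close>.

  A general ind-object \<open>X\<close> is treated index by index: by uniqueness, the morphisms obtained for the
  objects \<open>X\<^sub>i\<close> are compatible. This is lemma \<open>internal_hom_A\<close>.
\<close>

section \<open>Morphisms with source and target\<close>

context category
begin

text \<open>
  Hom-sets are disjoint, so a morphism determines its source and target. Stating composability
  as an equation between these lets the simplifier apply associativity and the interchange law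
  without being told the objects involved.
\<close>

definition mor :: "'m \<Rightarrow> bool" where
  "mor f \<longleftrightarrow> (\<exists>X\<in>Ob C. \<exists>Y\<in>Ob C. f \<in> Hom C X Y)"

definition source :: "'m \<Rightarrow> 'o" where
  "source f = (THE X. X \<in> Ob C \<and> (\<exists>Y\<in>Ob C. f \<in> Hom C X Y))"

definition target :: "'m \<Rightarrow> 'o" where
  "target f = (THE Y. Y \<in> Ob C \<and> (\<exists>X\<in>Ob C. f \<in> Hom C X Y))"

lemma source_eq: "\<lbrakk>X \<in> Ob C; Y \<in> Ob C; f \<in> Hom C X Y\<rbrakk> \<Longrightarrow> source f = X"
  unfolding source_def by (rule the_equality) (use Hom_disjoint in blast)+

lemma target_eq: "\<lbrakk>X \<in> Ob C; Y \<in> Ob C; f \<in> Hom C X Y\<rbrakk> \<Longrightarrow> target f = Y"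
  unfolding target_def by (rule the_equality) (use Hom_disjoint in blast)+

lemma Hom_iff [simp]:
  assumes "X \<in> Ob C" "Y \<in> Ob C"
  shows "f \<in> Hom C X Y \<longleftrightarrow> mor f \<and> source f = X \<and> target f = Y"
proof
  assume "f \<in> Hom C X Y"
  with assms show "mor f \<and> source f = X \<and> target f = Y"
    using source_eq target_eq mor_def by blast
next
  assume f: "mor f \<and> source f = X \<and> target f = Y"
  then obtain X' Y' where *: "X' \<in> Ob C" "Y' \<in> Ob C" "f \<in> Hom C X' Y'"
    unfolding mor_def by blast
  then show "f \<in> Hom C X Y"
    using f source_eq target_eq by blast
qed

lemma mor_Hom: "mor f \<Longrightarrow> source f \<in> Ob C \<and> target f \<in> Ob C \<and> f \<in> Hom C (source f) (target f)"
  unfolding mor_def using source_eq target_eq by metis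

lemma source_closed [simp]: "mor f \<Longrightarrow> source f \<in> Ob C"
  and target_closed [simp]: "mor f \<Longrightarrow> target f \<in> Ob C"
  by (simp_all add: mor_Hom)

lemma mor_Idn [simp]:
  assumes "X \<in> Ob C"
  shows "mor (Idn C X)" "source (Idn C X) = X" "target (Idn C X) = X"
  using Idn_closed[OF assms] assms by simp_all

lemma mor_Comp [simp]:
  assumes "mor f" "mor g" "target f = source g"
  shows "mor (g \<cdot> f)" "source (g \<cdot> f) = source f" "target (g \<cdot> f) = target g"
  using Comp_closed[of "source f" "source g" "target g" f g] assms by simp_all

lemma Comp_Idn' [simp]: "\<lbrakk>mor f; source f = X\<rbrakk> \<Longrightarrow> f \<cdot> Idn C X = f"
  using Comp_Idn[of X "target f" f] by auto

lemma Idn_Comp' [simp]: "\<lbrakk>mor f; target f = X\<rbrakk> \<Longrightarrow> Idn C X \<cdot> f = f"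
  using Idn_Comp[of "source f" X f] by auto

lemma Comp_assoc' [simp]:
  "\<lbrakk>mor f; mor g; mor h; target f = source g; target g = source h\<rbrakk>
    \<Longrightarrow> (h \<cdot> g) \<cdot> f = h \<cdot> (g \<cdot> f)"
  using Comp_assoc[of "source f" "source g" "source h" "target h" f g h] by simp

lemma is_iso_obtain:
  assumes "is_iso C X Y f" "X \<in> Ob C" "Y \<in> Ob C"
  obtains g where "mor f" "source f = X" "target f = Y" "mor g" "source g = Y" "target g = X"
    "g \<cdot> f = Idn C X" "f \<cdot> g = Idn C Y"
  using assms unfolding is_iso_def inverse_mor_def by auto

lemma is_isoI:
  assumes "X \<in> Ob C" "Y \<in> Ob C" "f \<in> Hom C X Y" "g \<in> Hom C Y X"
    "g \<cdot> f = Idn C X" "f \<cdot> g = Idn C Y"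
  shows "is_iso C X Y f"
  using assms unfolding is_iso_def inverse_mor_def by blast

lemma iso_cancel_left:
  assumes "is_iso C X Y f" "X \<in> Ob C" "Y \<in> Ob C" "mor a" "mor b" "target a = X" "target b = X"
    "f \<cdot> a = f \<cdot> b"
  shows "a = b"
proof -
  obtain g where g: "mor f" "source f = X" "target f = Y" "mor g" "source g = Y" "target g = X"
    "g \<cdot> f = Idn C X" "f \<cdot> g = Idn C Y"
    using is_iso_obtain assms(1-3) by blast
  have "a = (g \<cdot> f) \<cdot> a" "(g \<cdot> f) \<cdot> b = b"
    unfolding g(7) using assms by simp_all
  moreover have "(g \<cdot> f) \<cdot> a = g \<cdot> (f \<cdot> a)" "g \<cdot> (f \<cdot> b) = (g \<cdot> f) \<cdot> b"
    using assms(4-7) g(1-6) by simp_all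
  ultimately show ?thesis
    using assms(8) by metis
qed

lemma iso_cancel_right:
  assumes "is_iso C X Y f" "X \<in> Ob C" "Y \<in> Ob C" "mor a" "mor b" "source a = Y" "source b = Y"
    "a \<cdot> f = b \<cdot> f"
  shows "a = b"
proof -
  obtain g where g: "mor f" "source f = X" "target f = Y" "mor g" "source g = Y" "target g = X"
    "g \<cdot> f = Idn C X" "f \<cdot> g = Idn C Y"
    using is_iso_obtain assms(1-3) by blast
  have "a = a \<cdot> (f \<cdot> g)" "b \<cdot> (f \<cdot> g) = b"
    unfolding g(8) using assms by simp_all
  moreover have "a \<cdot> (f \<cdot> g) = (a \<cdot> f) \<cdot> g" "(b \<cdot> f) \<cdot> g = b \<cdot> (f \<cdot> g)"
    using assms(4-7) g(1-6) by simp_all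
  ultimately show ?thesis
    using assms(8) by metis
qed

lemma is_iso_Comp:
  assumes "is_iso C X Y f" "is_iso C Y Z g" "X \<in> Ob C" "Y \<in> Ob C" "Z \<in> Ob C"
  shows "is_iso C X Z (g \<cdot> f)"
proof -
  obtain f' where f: "mor f" "source f = X" "target f = Y" "mor f'" "source f' = Y" "target f' = X"
    "f' \<cdot> f = Idn C X" "f \<cdot> f' = Idn C Y"
    using is_iso_obtain assms by blast
  obtain g' where g: "mor g" "source g = Y" "target g = Z" "mor g'" "source g' = Z" "target g' = Y"
    "g' \<cdot> g = Idn C Y" "g \<cdot> g' = Idn C Z"
    using is_iso_obtain assms by blast
  have 1: "g' \<cdot> (g \<cdot> f) = f"
    using Comp_assoc'[of f g g', symmetric] f g by simp
  have 2: "f \<cdot> (f' \<cdot> g') = g'"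
    using Comp_assoc'[of g' f' f, symmetric] f g by simp
  show ?thesis
    using f g assms 1 2 by (intro is_isoI[where g = "f' \<cdot> g'"]) simp_all
qed

lemma isomorphic_refl: "X \<in> Ob C \<Longrightarrow> isomorphic C X X"
  unfolding isomorphic_def by (rule exI, rule is_isoI[where f = "Idn C X"
      and g = "Idn C X"]) simp_all

lemma isomorphic_sym: "isomorphic C X Y \<Longrightarrow> isomorphic C Y X"
  unfolding isomorphic_def is_iso_def inverse_mor_def by blast

lemma isomorphic_trans:
  "\<lbrakk>isomorphic C X Y; isomorphic C Y Z; X \<in> Ob C; Y \<in> Ob C; Z \<in> Ob C\<rbrakk> \<Longrightarrow> isomorphic C X Z"
  unfolding isomorphic_def using is_iso_Comp by blast

lemma iso_class_eq_iff:
  "\<lbrakk>X \<in> Ob C; Y \<in> Ob C\<rbrakk> \<Longrightarrow> iso_class C X = iso_class C Y \<longleftrightarrow> isomorphic C X Y"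
  unfolding iso_class_def
  using isomorphic_refl isomorphic_sym isomorphic_trans by blast

end

section \<open>Invertible objects\<close>

context monoidal_category
begin

lemma Unit_Ob [simp]: "Unit C \<in> Ob C" and TensO_Ob [simp]: "\<lbrakk>X \<in> Ob C; Y \<in> Ob C\<rbrakk> \<Longrightarrow> X \<boxtimes> Y \<in> Ob C"
  by (simp_all add: Unit_closed TensO_closed)

lemma mor_TensM [simp]:
  assumes "mor f" "mor g"
  shows "mor (f \<star> g)" "source (f \<star> g) = source f \<boxtimes> source g" "target (f \<star> g) = target f \<boxtimes> target g"
  using TensM_closed[of "source f" "target f" "source g" "target g" f g] assms by simp_all

lemma TensM_Idn' [simp]: "\<lbrakk>X \<in> Ob C; Y \<in> Ob C\<rbrakk> \<Longrightarrow> Idn C X \<star> Idn C Y = Idn C (X \<boxtimes> Y)"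
  by (rule TensM_Idn)

lemma interchange:
  "\<lbrakk>mor f; mor f'; mor g; mor g'; target f = source f'; target g = source g'\<rbrakk>
    \<Longrightarrow> (f' \<star> g') \<cdot> (f \<star> g) = (f' \<cdot> f) \<star> (g' \<cdot> g)"
  using TensM_Comp[of "source f" "source f'" "target f'" "source g" "source g'"
      "target g'" f f' g g']
  by simp

lemma is_iso_TensM:
  assumes "is_iso C X X' f" "is_iso C Y Y' g" "X \<in> Ob C" "X' \<in> Ob C" "Y \<in> Ob C" "Y' \<in> Ob C"
  shows "is_iso C (X \<boxtimes> Y) (X' \<boxtimes> Y') (f \<star> g)"
proof -
  obtain f' where f: "mor f" "source f = X" "target f = X'" "mor f'" "source f' = X'" "target f'
      = X"
    "f' \<cdot> f = Idn C X" "f \<cdot> f' = Idn C X'"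
    using is_iso_obtain assms by blast
  obtain g' where g: "mor g" "source g = Y" "target g = Y'" "mor g'" "source g' = Y'" "target g'
      = Y"
    "g' \<cdot> g = Idn C Y" "g \<cdot> g' = Idn C Y'"
    using is_iso_obtain assms by blast
  show ?thesis
    using f g assms by (intro is_isoI[where g = "f' \<star> g'"]) (simp_all add: interchange)
qed

lemma is_iso_Idn: "X \<in> Ob C \<Longrightarrow> is_iso C X X (Idn C X)"
  by (rule is_isoI[where g = "Idn C X"]) simp_all

lemma isomorphic_TensO:
  assumes "isomorphic C X X'" "isomorphic C Y Y'" "X \<in> Ob C" "X' \<in> Ob C" "Y \<in> Ob C" "Y' \<in> Ob C"
  shows "isomorphic C (X \<boxtimes> Y) (X' \<boxtimes> Y')"
  using assms is_iso_TensM unfolding isomorphic_def by blast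

lemma isomorphic_Assoc:
  "\<lbrakk>X \<in> Ob C; Y \<in> Ob C; Z \<in> Ob C\<rbrakk> \<Longrightarrow> isomorphic C ((X \<boxtimes> Y) \<boxtimes> Z) (X \<boxtimes> (Y \<boxtimes> Z))"
  using Assoc_iso unfolding isomorphic_def by blast

text \<open>
  The computation \<open>X \<cong> X \<otimes> (Y \<otimes> Z) \<cong> (X \<otimes> Y) \<otimes> Z \<cong> Z\<close> from monoid theory.
\<close>

lemma left_inverse_isomorphic_right_inverse:
  assumes X: "X \<in> Ob C" and Y: "Y \<in> Ob C" and Z: "Z \<in> Ob C"
    and XY: "isomorphic C (X \<boxtimes> Y) (Unit C)" and YZ: "isomorphic C (Y \<boxtimes> Z) (Unit C)"
  shows "isomorphic C X Z"
proof -
  have 1: "isomorphic C X (X \<boxtimes> Unit C)"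
    using RUnit_iso[OF X] isomorphic_sym unfolding isomorphic_def by blast
  have 2: "isomorphic C (X \<boxtimes> Unit C) (X \<boxtimes> (Y \<boxtimes> Z))"
    using assms isomorphic_TensO isomorphic_refl isomorphic_sym by simp
  have 3: "isomorphic C (X \<boxtimes> (Y \<boxtimes> Z)) ((X \<boxtimes> Y) \<boxtimes> Z)"
    using assms isomorphic_Assoc isomorphic_sym by simp
  have 4: "isomorphic C ((X \<boxtimes> Y) \<boxtimes> Z) (Unit C \<boxtimes> Z)"
    using assms isomorphic_TensO isomorphic_refl by simp
  have 5: "isomorphic C (Unit C \<boxtimes> Z) Z"
    using LUnit_iso[OF Z] unfolding isomorphic_def by blast
  show ?thesis
    using isomorphic_trans[OF 1 isomorphic_trans[OF 2 isomorphic_trans[OF 3 isomorphic_trans[OF 4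
        5]]]] assms
    by simp
qed

lemma Inv_mult_iso_class:
  assumes X: "X \<in> Ob C" and Y: "Y \<in> Ob C"
  shows "iso_class C X \<otimes>\<^bsub>Inv C\<^esub> iso_class C Y = iso_class C (X \<boxtimes> Y)"
proof -
  have UN_const: "(\<Union>a\<in>P. \<Union>b\<in>Q. F a b) = T"
    if "\<And>a b. \<lbrakk>a \<in> P; b \<in> Q\<rbrakk> \<Longrightarrow> F a b = T" "x \<in> P" "y \<in> Q"
    for P Q :: "'o set" and F and T :: "'o set" and x y
    using that by blast
  have "iso_class C (X' \<boxtimes> Y') = iso_class C (X \<boxtimes> Y)"
    if "X' \<in> iso_class C X" "Y' \<in> iso_class C Y" for X' Y'
    using that X Y isomorphic_TensO by (subst iso_class_eq_iff) (auto simp: iso_class_def)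
  moreover have "X \<in> iso_class C X" "Y \<in> iso_class C Y"
    using X Y isomorphic_refl by (auto simp: iso_class_def)
  ultimately have "(\<Union>X'\<in>iso_class C X. \<Union>Y'\<in>iso_class C Y. iso_class C (X' \<boxtimes> Y'))
      = iso_class C (X \<boxtimes> Y)"
    by (rule UN_const)
  then show ?thesis
    by (simp add: Inv_def)
qed

lemma Inv_carrier_obtain:
  assumes "g \<in> carrier (Inv C)"
  obtains X where "g = iso_class C X" "X \<in> Ob C" "invertible_object C X"
  using assms that unfolding Inv_def invertible_object_def by auto

lemma Inv_carrier_iso_class:
  assumes "g \<in> carrier (Inv C)" "X \<in> g"
  shows "g = iso_class C X" "X \<in> Ob C"
proof -
  obtain Y where Y: "g = iso_class C Y" "Y \<in> Ob C"
    using assms Inv_carrier_obtain by blast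
  with assms(2) show "X \<in> Ob C" by (simp add: iso_class_def)
  with Y assms(2) show "g = iso_class C X"
    using iso_class_eq_iff isomorphic_sym by (auto simp: iso_class_def)
qed

lemma Inv_inverse_unique:
  assumes "x \<in> carrier (Inv C)" "y \<in> carrier (Inv C)" "z \<in> carrier (Inv C)"
    and xy: "x \<otimes>\<^bsub>Inv C\<^esub> y = \<one>\<^bsub>Inv C\<^esub>" and yz: "y \<otimes>\<^bsub>Inv C\<^esub> z = \<one>\<^bsub>Inv C\<^esub>"
  shows "x = z"
proof -
  obtain X where X: "x = iso_class C X" "X \<in> Ob C" using assms(1) by (rule Inv_carrier_obtain)
  obtain Y where Y: "y = iso_class C Y" "Y \<in> Ob C" using assms(2) by (rule Inv_carrier_obtain)
  obtain Z where Z: "z = iso_class C Z" "Z \<in> Ob C" using assms(3) by (rule Inv_carrier_obtain)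
  note XYZ = X Y Z
  have one: "\<one>\<^bsub>Inv C\<^esub> = iso_class C (Unit C)"
    by (simp add: Inv_def)
  have "isomorphic C (X \<boxtimes> Y) (Unit C)" "isomorphic C (Y \<boxtimes> Z) (Unit C)"
    using xy yz unfolding XYZ one
    by (simp_all only: Inv_mult_iso_class iso_class_eq_iff XYZ(2,4,6) TensO_Ob Unit_Ob)
  then show ?thesis
    unfolding XYZ using XYZ(2,4,6) left_inverse_isomorphic_right_inverse iso_class_eq_iff by blast
qed

text \<open>
  The predicate \<open>subgroup\<close> only says that the values of \<open>m_inv\<close> lie in \<open>\<Gamma>\<close>, and \<open>m_inv\<close> is a
  definite description. It denotes an inverse because the class of an invertible object has
  exactly one.
\<close>

lemma subgroup_Inv_inverse:
  assumes "subgroup \<Gamma> (Inv C)" "y \<in> \<Gamma>"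
  obtains y' where "y' \<in> \<Gamma>" "y' \<otimes>\<^bsub>Inv C\<^esub> y = \<one>\<^bsub>Inv C\<^esub>" "y \<otimes>\<^bsub>Inv C\<^esub> y' = \<one>\<^bsub>Inv C\<^esub>"
proof -
  interpret subgroup \<Gamma> "Inv C" by fact
  have y: "y \<in> carrier (Inv C)"
    using assms(2) by simp
  then obtain Y where Y1: "y = iso_class C Y" "Y \<in> Ob C" "invertible_object C Y"
    by (rule Inv_carrier_obtain)
  then obtain Z where Z: "Z \<in> Ob C"
      and YZ: "isomorphic C (Y \<boxtimes> Z) (Unit C)" "isomorphic C (Z \<boxtimes> Y) (Unit C)"
    unfolding invertible_object_def by blast
  note Y = Y1(1,2) Z
  have "\<exists>!z. z \<in> carrier (Inv C) \<and> y \<otimes>\<^bsub>Inv C\<^esub> z = \<one>\<^bsub>Inv C\<^esub> \<and> z \<otimes>\<^bsub>Inv C\<^esub> y = \<one>\<^bsub>Inv C\<^esub>"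
  proof (rule ex1I)
    have "invertible_object C Z"
      using Y YZ unfolding invertible_object_def by blast
    then have "iso_class C Z \<in> carrier (Inv C)"
      by (auto simp: Inv_def)
    moreover have "\<one>\<^bsub>Inv C\<^esub> = iso_class C (Unit C)"
      by (simp add: Inv_def)
    ultimately show "iso_class C Z \<in> carrier (Inv C) \<and> y \<otimes>\<^bsub>Inv C\<^esub> iso_class C Z = \<one>\<^bsub>Inv C\<^esub> \<and>
        iso_class C Z \<otimes>\<^bsub>Inv C\<^esub> y = \<one>\<^bsub>Inv C\<^esub>"
      using Y YZ by (simp add: Inv_mult_iso_class iso_class_eq_iff)
    then show "\<And>z. z \<in> carrier (Inv C) \<and> y \<otimes>\<^bsub>Inv C\<^esub> z = \<one>\<^bsub>Inv C\<^esub> \<and> z \<otimes>\<^bsub>Inv C\<^esub> y = \<one>\<^bsub>Inv C\<^esub>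
        \<Longrightarrow> z = iso_class C Z"
      using Inv_inverse_unique y by blast
  qed
  from theI'[OF this] show ?thesis
    using that m_inv_closed[OF assms(2)] unfolding m_inv_def by blast
qed

text \<open>
  The isomorphism \<open>(W \<otimes> E) \<otimes> E' \<rightarrow> W\<close> induced by \<open>n : E \<otimes> E' \<rightarrow> 1\<close>. Its naturality in \<open>W\<close> says
  that tensoring with \<open>E\<close> and then with \<open>E'\<close> is isomorphic to the identity functor.
\<close>

definition untensor :: "'o \<Rightarrow> 'o \<Rightarrow> 'm \<Rightarrow> 'o \<Rightarrow> 'm" where
  "untensor E E' n W = RUnit C W \<cdot> (Idn C W \<star> n) \<cdot> Assoc C W E E'"

lemma mor_structure [simp]:
  "\<lbrakk>X \<in> Ob C; Y \<in> Ob C; Z \<in> Ob C\<rbrakk> \<Longrightarrow> mor (Assoc C X Y Z)"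
  "\<lbrakk>X \<in> Ob C; Y \<in> Ob C; Z \<in> Ob C\<rbrakk> \<Longrightarrow> source (Assoc C X Y Z) = (X \<boxtimes> Y) \<boxtimes> Z"
  "\<lbrakk>X \<in> Ob C; Y \<in> Ob C; Z \<in> Ob C\<rbrakk> \<Longrightarrow> target (Assoc C X Y Z) = X \<boxtimes> (Y \<boxtimes> Z)"
  "X \<in> Ob C \<Longrightarrow> mor (RUnit C X)" "X \<in> Ob C \<Longrightarrow> source (RUnit C X) = X \<boxtimes> Unit C"
  "X \<in> Ob C \<Longrightarrow> target (RUnit C X) = X"
  using Assoc_iso[of X Y Z] RUnit_iso[of X] unfolding is_iso_def inverse_mor_def by auto

lemma untensor_iso:
  assumes "is_iso C (E \<boxtimes> E') (Unit C) n" "E \<in> Ob C" "E' \<in> Ob C" "W \<in> Ob C"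
  shows "is_iso C ((W \<boxtimes> E) \<boxtimes> E') W (untensor E E' n W)"
  unfolding untensor_def
  using assms RUnit_iso[of W] Assoc_iso[of W E E'] is_iso_TensM[OF is_iso_Idn[of W] assms(1)]
  by (blast intro: is_iso_Comp TensO_closed Unit_closed)

lemma untensor_natural:
  assumes "is_iso C (E \<boxtimes> E') (Unit C) n" "E \<in> Ob C" "E' \<in> Ob C" "mor g"
  shows "untensor E E' n (target g) \<cdot> ((g \<star> Idn C E) \<star> Idn C E') = g \<cdot> untensor E E' n (source g)"
proof -
  let ?W = "source g" and ?Z = "target g"
  have n: "mor n" "source n = E \<boxtimes> E'" "target n = Unit C"
    using assms(1-3) is_iso_obtain[of "E \<boxtimes> E'" "Unit C" n] by auto
  have "untensor E E' n ?Z \<cdot> ((g \<star> Idn C E) \<star> Idn C E')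
      = RUnit C ?Z \<cdot> (Idn C ?Z \<star> n) \<cdot> (Assoc C ?Z E E' \<cdot> ((g \<star> Idn C E) \<star> Idn C E'))"
    unfolding untensor_def using assms n by simp
  also have "Assoc C ?Z E E' \<cdot> ((g \<star> Idn C E) \<star> Idn C E') = (g \<star> Idn C (E \<boxtimes> E')) \<cdot> Assoc C ?W E E'"
    using Assoc_natural[of ?W ?Z E E E' E' g "Idn C E" "Idn C E'"] assms by simp
  also have "(Idn C ?Z \<star> n) \<cdot> (g \<star> Idn C (E \<boxtimes> E')) \<cdot> Assoc C ?W E E'
      = ((Idn C ?Z \<star> n) \<cdot> (g \<star> Idn C (E \<boxtimes> E'))) \<cdot> Assoc C ?W E E'"
    using assms n by simp
  also have "(Idn C ?Z \<star> n) \<cdot> (g \<star> Idn C (E \<boxtimes> E')) = (g \<star> Idn C (Unit C)) \<cdot> (Idn C ?W \<star> n)"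
    using assms n by (simp add: interchange)
  also have "RUnit C ?Z \<cdot> ((g \<star> Idn C (Unit C)) \<cdot> (Idn C ?W \<star> n)) \<cdot> Assoc C ?W E E'
      = (RUnit C ?Z \<cdot> (g \<star> Idn C (Unit C))) \<cdot> (Idn C ?W \<star> n) \<cdot> Assoc C ?W E E'"
    using assms n by simp
  also have "RUnit C ?Z \<cdot> (g \<star> Idn C (Unit C)) = g \<cdot> RUnit C ?W"
    using RUnit_natural[of ?W ?Z g] assms by simp
  also have "(g \<cdot> RUnit C ?W) \<cdot> (Idn C ?W \<star> n) \<cdot> Assoc C ?W E E' = g \<cdot> untensor E E' n ?W"
    unfolding untensor_def using assms n by simp
  finally show ?thesis .
qed

lemma tensor_invertible_faithful:
  assumes n: "is_iso C (E \<boxtimes> E') (Unit C) n" and E: "E \<in> Ob C" "E' \<in> Ob C"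
    and g: "mor g" "mor g'" "source g = source g'" "target g = target g'"
    and eq: "g \<star> Idn C E = g' \<star> Idn C E"
  shows "g = g'"
proof (rule iso_cancel_right[OF untensor_iso[OF n E, of "source g'"]])
  show "g \<cdot> untensor E E' n (source g') = g' \<cdot> untensor E E' n (source g')"
    using untensor_natural[OF n E g(1)] untensor_natural[OF n E g(2)] g eq by simp
qed (use g E in simp_all)

text \<open>
  The preimage of \<open>h\<close> is \<open>h \<otimes> E'\<close>, transported along \<open>untensor\<close>. Its tensor product with \<open>E\<close>
  agrees with \<open>h\<close> after one more tensoring with \<open>E'\<close>, and \<open>- \<otimes> E'\<close> is faithful because of \<open>m\<close>.
\<close>

lemma tensor_invertible_full:
  assumes n: "is_iso C (E \<boxtimes> E') (Unit C) n" and m: "is_iso C (E' \<boxtimes> E) (Unit C) m"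
    and E: "E \<in> Ob C" "E' \<in> Ob C" and W: "W \<in> Ob C" and Z: "Z \<in> Ob C"
    and h: "h \<in> Hom C (W \<boxtimes> E) (Z \<boxtimes> E)"
  obtains g where "g \<in> Hom C W Z" "g \<star> Idn C E = h"
proof -
  have h': "mor h" "source h = W \<boxtimes> E" "target h = Z \<boxtimes> E"
    using h E W Z by simp_all
  obtain r where r: "mor r" "source r = W" "target r = (W \<boxtimes> E) \<boxtimes> E'"
      "untensor E E' n W \<cdot> r = Idn C W" "r \<cdot> untensor E E' n W = Idn C ((W \<boxtimes> E) \<boxtimes> E')"
      "mor (untensor E E' n W)" "source (untensor E E' n W) = (W \<boxtimes> E) \<boxtimes> E'"
      "target (untensor E E' n W) = W"
    using is_iso_obtain[OF untensor_iso[OF n E W]] E W by auto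
  have z: "mor (untensor E E' n Z)" "source (untensor E E' n Z) = (Z \<boxtimes> E) \<boxtimes> E'"
      "target (untensor E E' n Z) = Z"
    using is_iso_obtain[OF untensor_iso[OF n E Z]] E Z by auto
  define g where "g = untensor E E' n Z \<cdot> (h \<star> Idn C E') \<cdot> r"
  have g: "mor g" "source g = W" "target g = Z"
    unfolding g_def using h' r z E by simp_all
  have "untensor E E' n Z \<cdot> ((g \<star> Idn C E) \<star> Idn C E') = g \<cdot> untensor E E' n W"
    using untensor_natural[OF n E g(1)] g by simp
  also have "\<dots> = untensor E E' n Z \<cdot> (h \<star> Idn C E')"
    unfolding g_def using h' r z E by simp
  finally have "(g \<star> Idn C E) \<star> Idn C E' = h \<star> Idn C E'"
    by (rule iso_cancel_left[OF untensor_iso[OF n E Z], rotated -1]) (use g h' E W Z in simp_all)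
  then have "g \<star> Idn C E = h"
    by (rule tensor_invertible_faithful[OF m E(2,1), rotated -1]) (use g h' E W Z in simp_all)
  with g W Z that show ?thesis by simp
qed

text \<open>
  The object \<open>E'\<close> represents \<open>W \<mapsto> Hom (W \<otimes> E, 1)\<close> with universal element \<open>m\<close>: composing \<open>f\<close> with
  the inverse of \<open>m\<close> gives a morphism \<open>W \<otimes> E \<rightarrow> E' \<otimes> E\<close>, and \<open>- \<otimes> E\<close> is full and faithful.
\<close>

lemma pairing_invertible_universal:
  assumes n: "is_iso C (E \<boxtimes> E') (Unit C) n" and m: "is_iso C (E' \<boxtimes> E) (Unit C) m"
    and E: "E \<in> Ob C" "E' \<in> Ob C" and W: "W \<in> Ob C"
    and f: "f \<in> Hom C (W \<boxtimes> E) (Unit C)"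
  shows "\<exists>!g. g \<in> Hom C W E' \<and> m \<cdot> (g \<star> Idn C E) = f"
proof -
  obtain m' where m': "mor m" "source m = E' \<boxtimes> E" "target m = Unit C"
      "mor m'" "source m' = Unit C" "target m' = E' \<boxtimes> E"
      "m' \<cdot> m = Idn C (E' \<boxtimes> E)" "m \<cdot> m' = Idn C (Unit C)"
    using is_iso_obtain[OF m] E by auto
  have f': "mor f" "source f = W \<boxtimes> E" "target f = Unit C"
    using f E W by simp_all
  obtain g where g: "g \<in> Hom C W E'" "g \<star> Idn C E = m' \<cdot> f"
    using tensor_invertible_full[OF n m E W E(2), of "m' \<cdot> f"] m' f' E W by auto
  have gf: "m \<cdot> (g \<star> Idn C E) = f"
    using Comp_assoc'[of f m' m, symmetric] m' f' g(2) by simp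
  show ?thesis
  proof (rule ex1I[of _ g])
    fix g' assume g': "g' \<in> Hom C W E' \<and> m \<cdot> (g' \<star> Idn C E) = f"
    then have "m \<cdot> (g' \<star> Idn C E) = m \<cdot> (g \<star> Idn C E)"
      using gf by simp
    then have "g' \<star> Idn C E = g \<star> Idn C E"
      by (rule iso_cancel_left[OF m, rotated -1]) (use g(1) g' E W in simp_all)
    then show "g' = g"
      by (rule tensor_invertible_faithful[OF n E, rotated -1]) (use g(1) g' E W in simp_all)
  qed (use g gf in blast)
qed

end

section \<open>Linear structure and finite biproducts\<close>

lemma (in category) Comp_reassoc:
  "\<lbrakk>g \<cdot> f = h; mor f; mor g; target f = source g; mor w; target w = source f\<rbrakk> \<Longrightarrow> g \<cdot> (f \<cdot> w) = h \<cdot> w"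
  using Comp_assoc'[of w f g, symmetric] by simp

text \<open>
  Finite sums of elements of \<open>G\<close>. The inductive form turns linearity arguments about a sum over
  an index set into inductions with three trivial cases.
\<close>

inductive_set additive_span ::
    "('k, 'o, 'm, 'z) lin_moncat_scheme \<Rightarrow> 'o \<Rightarrow> 'o \<Rightarrow> 'm set \<Rightarrow> 'm set"
  for C X Y G where
  zero: "hzero C X Y \<in> additive_span C X Y G"
| base: "g \<in> G \<Longrightarrow> g \<in> additive_span C X Y G"
| add: "\<lbrakk>a \<in> additive_span C X Y G; b \<in> additive_span C X Y G\<rbrakk>
    \<Longrightarrow> hadd C a b \<in> additive_span C X Y G"

context tensor_category
begin

lemma hom_group: "\<lbrakk>X \<in> Ob C; Y \<in> Ob C\<rbrakk> \<Longrightarrow> abelian_group (hom_space C X Y)"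
  using hom_module unfolding module_def by blast

lemma mor_hadd [simp]:
  assumes "mor f" "mor g" "source f = source g" "target f = target g"
  shows "mor (hadd C f g)" "source (hadd C f g) = source g" "target (hadd C f g) = target g"
proof -
  interpret H: abelian_group "hom_space C (source g) (target g)"
    by (rule hom_group) (use assms in simp_all)
  show "mor (hadd C f g)" "source (hadd C f g) = source g" "target (hadd C f g) = target g"
    using H.a_closed[of f g] assms by (simp_all add: hom_space_def)
qed

lemma mor_hzero [simp]:
  assumes "X \<in> Ob C" "Y \<in> Ob C"
  shows "mor (hzero C X Y)" "source (hzero C X Y) = X" "target (hzero C X Y) = Y"
proof -
  interpret H: abelian_group "hom_space C X Y"
    by (rule hom_group) (use assms in simp_all)
  show "mor (hzero C X Y)" "source (hzero C X Y) = X" "target (hzero C X Y) = Y"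
    using H.zero_closed assms by (simp_all add: hom_space_def)
qed

lemma hadd_hzero [simp]:
  assumes "mor f" "source f = X" "target f = Y"
  shows "hadd C f (hzero C X Y) = f" "hadd C (hzero C X Y) f = f"
proof -
  interpret H: abelian_group "hom_space C X Y"
    by (rule hom_group) (use assms in auto)
  have "f \<in> carrier (hom_space C X Y)"
    using assms by (auto simp: hom_space_def)
  from H.l_zero[OF this] H.r_zero[OF this]
  show "hadd C f (hzero C X Y) = f" "hadd C (hzero C X Y) f = f"
    by (simp_all add: hom_space_def)
qed

lemma hadd_cancel_zero:
  assumes "mor f" "source f = X" "target f = Y" "mor g" "source g = X" "target g = Y" "hadd C f g
      = g"
  shows "f = hzero C X Y"
proof -
  interpret H: abelian_group "hom_space C X Y"
    by (rule hom_group) (use assms in auto)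
  have f: "f \<in> carrier (hom_space C X Y)"
    using assms by (auto simp: hom_space_def)
  have g: "g \<in> carrier (hom_space C X Y)"
    using assms by (auto simp: hom_space_def)
  have "f \<oplus>\<^bsub>hom_space C X Y\<^esub> g = \<zero>\<^bsub>hom_space C X Y\<^esub> \<oplus>\<^bsub>hom_space C X Y\<^esub> g"
    using assms H.l_zero[OF g] by (simp add: hom_space_def)
  then have "f = \<zero>\<^bsub>hom_space C X Y\<^esub>"
    using f g H.add.r_cancel by blast
  then show ?thesis
    by (simp add: hom_space_def)
qed

lemma hadd_difference:
  assumes "mor f" "mor g" "source f = X" "source g = X" "target f = Y" "target g = Y"
  obtains d where "mor d" "source d = X" "target d = Y" "f = hadd C d g"
proof -
  interpret H: abelian_group "hom_space C X Y"
    by (rule hom_group) (use assms in auto)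
  have XY: "X \<in> Ob C" "Y \<in> Ob C"
    using assms by auto
  have f: "f \<in> carrier (hom_space C X Y)" and g: "g \<in> carrier (hom_space C X Y)"
    using assms by (auto simp: hom_space_def)
  let ?d = "f \<oplus>\<^bsub>hom_space C X Y\<^esub> \<ominus>\<^bsub>hom_space C X Y\<^esub> g"
  have "?d \<in> carrier (hom_space C X Y)"
    using f g by simp
  moreover have "f = ?d \<oplus>\<^bsub>hom_space C X Y\<^esub> g"
    using f g by (simp add: H.a_assoc H.l_neg)
  ultimately show ?thesis
    using that[of ?d] XY by (simp add: hom_space_def)
qed

lemma Comp_hadd:
  "\<lbrakk>mor f; mor g; mor g'; source g = target f; source g' = target f; target g = target g'\<rbrakk>
    \<Longrightarrow> hadd C g g' \<cdot> f = hadd C (g \<cdot> f) (g' \<cdot> f)"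
  "\<lbrakk>mor h; mor g; mor g'; target g = source h; target g' = source h; source g = source g'\<rbrakk>
    \<Longrightarrow> h \<cdot> hadd C g g' = hadd C (h \<cdot> g) (h \<cdot> g')"
  using Comp_add_left[of "source f" "target f" "target g'" f g g']
    Comp_add_right[of "source g'" "source h" "target h" g g' h]
  by simp_all

lemma TensM_hadd:
  "\<lbrakk>mor f; mor g; mor g'; source g = source g'; target g = target g'\<rbrakk>
    \<Longrightarrow> hadd C g g' \<star> f = hadd C (g \<star> f) (g' \<star> f)"
  "\<lbrakk>mor f; mor g; mor g'; source g = source g'; target g = target g'\<rbrakk>
    \<Longrightarrow> f \<star> hadd C g g' = hadd C (f \<star> g) (f \<star> g')"
  using TensM_add_left[of "source g" "target g" "source f" "target f" g g' f]
    TensM_add_right[of "source f" "target f" "source g" "target g" f g g']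
  by simp_all

lemma Comp_hzero [simp]:
  assumes "mor f"
  shows "\<lbrakk>target f = X; Y \<in> Ob C\<rbrakk> \<Longrightarrow> hzero C X Y \<cdot> f = hzero C (source f) Y"
    and "\<lbrakk>source f = Y; X \<in> Ob C\<rbrakk> \<Longrightarrow> f \<cdot> hzero C X Y = hzero C X (target f)"
proof -
  show "hzero C X Y \<cdot> f = hzero C (source f) Y" if "target f = X" "Y \<in> Ob C"
  proof (rule hadd_cancel_zero)
    have X: "X \<in> Ob C" using that assms by auto
    show "hadd C (hzero C X Y \<cdot> f) (hzero C X Y \<cdot> f) = hzero C X Y \<cdot> f"
      using Comp_hadd(1)[of f "hzero C X Y" "hzero C X Y"] X that assms by simp
  qed (use that assms in auto)
  show "f \<cdot> hzero C X Y = hzero C X (target f)" if "source f = Y" "X \<in> Ob C"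
  proof (rule hadd_cancel_zero)
    have Y: "Y \<in> Ob C" using that assms by auto
    show "hadd C (f \<cdot> hzero C X Y) (f \<cdot> hzero C X Y) = f \<cdot> hzero C X Y"
      using Comp_hadd(2)[of f "hzero C X Y" "hzero C X Y"] Y that assms by simp
  qed (use that assms in auto)
qed

lemma TensM_hzero [simp]:
  assumes "mor f" "X \<in> Ob C" "Y \<in> Ob C"
  shows "hzero C X Y \<star> f = hzero C (X \<boxtimes> source f) (Y \<boxtimes> target f)"
    and "f \<star> hzero C X Y = hzero C (source f \<boxtimes> X) (target f \<boxtimes> Y)"
proof -
  show "hzero C X Y \<star> f = hzero C (X \<boxtimes> source f) (Y \<boxtimes> target f)"
    using TensM_hadd(1)[of f "hzero C X Y" "hzero C X Y", symmetric] assms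
    by (intro hadd_cancel_zero[where g = "hzero C X Y \<star> f"]) simp_all
  show "f \<star> hzero C X Y = hzero C (source f \<boxtimes> X) (target f \<boxtimes> Y)"
    using TensM_hadd(2)[of f "hzero C X Y" "hzero C X Y", symmetric] assms
    by (intro hadd_cancel_zero[where g = "f \<star> hzero C X Y"]) simp_all
qed

lemma zero_object_iff: "zero_object C Z \<longleftrightarrow> Z \<in> Ob C \<and> Idn C Z = hzero C Z Z"
proof
  assume Z: "zero_object C Z"
  then have "Z \<in> Ob C" "\<exists>!f. f \<in> Hom C Z Z"
    unfolding zero_object_def by blast+
  moreover from this have "Idn C Z \<in> Hom C Z Z" "hzero C Z Z \<in> Hom C Z Z"
    by simp_all
  ultimately show "Z \<in> Ob C \<and> Idn C Z = hzero C Z Z"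
    by blast
next
  assume Z: "Z \<in> Ob C \<and> Idn C Z = hzero C Z Z"
  have "f = hzero C X Z" if "X \<in> Ob C" "f \<in> Hom C X Z" for X f
  proof -
    have "f = Idn C Z \<cdot> f"
      using that conjunct1[OF Z] by simp
    also have "\<dots> = hzero C X Z"
      unfolding conjunct2[OF Z] using that Z by simp
    finally show ?thesis .
  qed
  moreover have "f = hzero C Z X" if "X \<in> Ob C" "f \<in> Hom C Z X" for X f
  proof -
    have "f = f \<cdot> Idn C Z"
      using that conjunct1[OF Z] by simp
    also have "\<dots> = hzero C Z X"
      unfolding conjunct2[OF Z] using that Z by simp
    finally show ?thesis .
  qed
  moreover have "hzero C X Z \<in> Hom C X Z" "hzero C Z X \<in> Hom C Z X" if "X \<in> Ob C" for X
    using that Z by simp_all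
  ultimately show "zero_object C Z"
    unfolding zero_object_def using Z by blast
qed

lemma zero_mor_iff:
  assumes "X \<in> Ob C" "Y \<in> Ob C"
  shows "zero_mor C X Y f \<longleftrightarrow> f = hzero C X Y"
proof
  assume "zero_mor C X Y f"
  then obtain Z a b where *: "zero_object C Z" "a \<in> Hom C X Z" "b \<in> Hom C Z Y" "f = b \<cdot> a"
    unfolding zero_mor_def by blast
  then have Z: "Z \<in> Ob C" "Idn C Z = hzero C Z Z"
    by (simp_all add: zero_object_iff)
  have "a = Idn C Z \<cdot> a"
    using * Z(1) assms by simp
  also have "\<dots> = hzero C X Z"
    unfolding Z(2) using * Z assms by simp
  finally show "f = hzero C X Y"
    using * Z assms by simp
next
  assume f: "f = hzero C X Y"
  obtain Z where Z: "zero_object C Z" using ex_zero by blast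
  then show "zero_mor C X Y f"
    unfolding zero_mor_def f using assms
    by (intro exI[of _ Z] exI[of _ "hzero C X Z"] exI[of _ "hzero C Z Y"])
      (simp add: zero_object_iff)
qed

text \<open>
  A product in a linear category is a biproduct: the inclusions are the morphisms with
  components \<open>(1, 0)\<close> and \<open>(0, 1)\<close>, and \<open>i \<cdot> p + j \<cdot> q\<close> has the same components as the identity.
\<close>

lemma ex_biproduct:
  assumes X: "X \<in> Ob C" and Y: "Y \<in> Ob C"
  obtains P i j p q where "P \<in> Ob C"
    "mor i" "source i = X" "target i = P" "mor j" "source j = Y" "target j = P"
    "mor p" "source p = P" "target p = X" "mor q" "source q = P" "target q = Y"
    "p \<cdot> i = Idn C X" "q \<cdot> j = Idn C Y" "p \<cdot> j = hzero C Y X" "q \<cdot> i = hzero C X Y"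
    "hadd C (i \<cdot> p) (j \<cdot> q) = Idn C P"
proof -
  obtain P p q where P: "is_product C X Y P p q"
    using ex_product[OF X Y] by blast
  then have PO: "P \<in> Ob C" and "p \<in> Hom C P X" "q \<in> Hom C P Y"
    unfolding is_product_def by blast+
  then have pq: "mor p" "source p = P" "target p = X" "mor q" "source q = P" "target q = Y"
    using X Y by simp_all
  have univ: "\<exists>!h. h \<in> Hom C W P \<and> p \<cdot> h = a \<and> q \<cdot> h = b"
    if "W \<in> Ob C" "a \<in> Hom C W X" "b \<in> Hom C W Y" for W a b
    using P that unfolding is_product_def by blast
  obtain i where i: "i \<in> Hom C X P" "p \<cdot> i = Idn C X" "q \<cdot> i = hzero C X Y"
    using univ[of X "Idn C X" "hzero C X Y"] X Y by auto
  obtain j where j: "j \<in> Hom C Y P" "p \<cdot> j = hzero C Y X" "q \<cdot> j = Idn C Y"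
    using univ[of Y "hzero C Y X" "Idn C Y"] X Y by auto
  have ij: "mor i" "source i = X" "target i = P" "mor j" "source j = Y" "target j = P"
    using i(1) j(1) X Y PO by simp_all
  let ?e = "hadd C (i \<cdot> p) (j \<cdot> q)"
  have e: "mor ?e" "source ?e = P" "target ?e = P"
    using pq ij by simp_all
  have "p \<cdot> ?e = p" "q \<cdot> ?e = q"
    using pq ij X Y
    by (simp_all add: Comp_hadd Comp_reassoc[OF i(2)] Comp_reassoc[OF i(3)] Comp_reassoc[OF j(2)]
        Comp_reassoc[OF j(3)])
  moreover have "p \<cdot> Idn C P = p" "q \<cdot> Idn C P = q"
    using pq by simp_all
  moreover have "?e \<in> Hom C P P" "Idn C P \<in> Hom C P P"
    using e PO by simp_all
  moreover have "\<exists>!h. h \<in> Hom C P P \<and> p \<cdot> h = p \<and> q \<cdot> h = q"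
    using univ[of P p q] pq PO X Y by simp
  ultimately have "?e = Idn C P"
    by blast
  then show ?thesis
    using that PO pq ij i j by blast
qed

text \<open>
  The last condition is the decomposition of the identity of \<open>S\<close> as the sum of all \<open>inc x \<cdot> pr
  x\<close>. In the form given here it says that a condition on endomorphisms of \<open>S\<close> holds for the
  identity as soon as it is additive and holds for these composites.
\<close>

definition fin_biproduct :: "'i set \<Rightarrow> ('i \<Rightarrow> 'o) \<Rightarrow> 'o \<Rightarrow> ('i \<Rightarrow> 'm) \<Rightarrow> ('i \<Rightarrow> 'm) \<Rightarrow> bool" where
  "fin_biproduct F E S inc pr \<longleftrightarrow> S \<in> Ob C \<and>
     (\<forall>x\<in>F. E x \<in> Ob C \<and> inc x \<in> Hom C (E x) S \<and> pr x \<in> Hom C S (E x)) \<and>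
     (\<forall>x\<in>F. \<forall>y\<in>F. pr x \<cdot> inc y = (if x = y then Idn C (E x) else hzero C (E y) (E x))) \<and>
     Idn C S \<in> additive_span C S S ((\<lambda>x. inc x \<cdot> pr x) ` F)"

lemma fin_biproductD:
  assumes "fin_biproduct F E S inc pr"
  shows "S \<in> Ob C"
    and "x \<in> F \<Longrightarrow> E x \<in> Ob C" "x \<in> F \<Longrightarrow> mor (inc x)" "x \<in> F \<Longrightarrow> source (inc x) = E x"
    "x \<in> F \<Longrightarrow> target (inc x) = S" "x \<in> F \<Longrightarrow> mor (pr x)" "x \<in> F \<Longrightarrow> source (pr x) = S"
    "x \<in> F \<Longrightarrow> target (pr x) = E x"
    and "\<lbrakk>x \<in> F; y \<in> F\<rbrakk> \<Longrightarrow> pr x \<cdot> inc y = (if x = y then Idn C (E x) else hzero C (E y) (E x))"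
    and "Idn C S \<in> additive_span C S S ((\<lambda>x. inc x \<cdot> pr x) ` F)"
  using assms unfolding fin_biproduct_def by auto

lemma ex_fin_biproduct:
  assumes "finite F" "\<And>x. x \<in> F \<Longrightarrow> E x \<in> Ob C"
  shows "\<exists>S inc pr. fin_biproduct F E S inc pr"
  using assms
proof (induction F)
  case empty
  obtain Z where Z: "zero_object C Z" using ex_zero by blast
  then have "fin_biproduct {} E Z (\<lambda>_. undefined) (\<lambda>_. undefined)"
    unfolding fin_biproduct_def zero_object_iff by (simp add: additive_span.zero)
  then show ?case by blast
next
  case (insert x F)
  then obtain S inc pr where "fin_biproduct F E S inc pr"
    by auto
  note S = fin_biproductD[OF this]
  obtain P i j p q where P: "P \<in> Ob C"
    "mor i" "source i = S" "target i = P" "mor j" "source j = E x" "target j = P"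
    "mor p" "source p = P" "target p = S" "mor q" "source q = P" "target q = E x"
    and orth: "p \<cdot> i = Idn C S" "q \<cdot> j = Idn C (E x)" "p \<cdot> j = hzero C (E x) S" "q \<cdot> i
        = hzero C S (E x)"
    and sum: "hadd C (i \<cdot> p) (j \<cdot> q) = Idn C P"
    using ex_biproduct[of S "E x"] S(1) insert.prems by blast
  define inc' where "inc' y = (if y = x then j else i \<cdot> inc y)" for y
  define pr' where "pr' y = (if y = x then q else pr y \<cdot> p)" for y
  have Ex: "E x \<in> Ob C"
    using insert.prems by simp
  let ?G = "(\<lambda>y. inc' y \<cdot> pr' y) ` insert x F"
  have ih: "mor e \<and> source e = S \<and> target e = S \<and> i \<cdot> e \<cdot> p \<in> additive_span C P P ?G"
    if "e \<in> additive_span C S S ((\<lambda>x. inc x \<cdot> pr x) ` F)" for e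
    using that
  proof induction
    case zero
    then show ?case
      using P S(1) by (simp add: additive_span.zero)
  next
    case (base g)
    then obtain y where y: "y \<in> F" "g = inc y \<cdot> pr y" by blast
    then have "i \<cdot> g \<cdot> p = inc' y \<cdot> pr' y"
      using S P insert.hyps by (auto simp: inc'_def pr'_def)
    then have "i \<cdot> g \<cdot> p \<in> ?G"
      using y(1) by blast
    then have "i \<cdot> g \<cdot> p \<in> additive_span C P P ?G"
      by (rule additive_span.base)
    then show ?case
      using y S by simp
  next
    case (add a b)
    then show ?case
      using P by (simp add: Comp_hadd additive_span.add)
  qed
  have "i \<cdot> Idn C S \<cdot> p \<in> additive_span C P P ?G"
    using ih[OF S(10)] by blast
  then have "i \<cdot> p \<in> additive_span C P P ?G"
    using P by simp
  moreover have "j \<cdot> q \<in> ?G"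
    by (rule image_eqI[of _ _ x]) (simp_all add: inc'_def pr'_def)
  ultimately have "Idn C P \<in> additive_span C P P ?G"
    unfolding sum[symmetric] by (blast intro: additive_span.intros)
  moreover have "pr' y \<cdot> inc' z = (if y = z then Idn C (E y) else hzero C (E z) (E y))"
    if "y \<in> insert x F" "z \<in> insert x F" for y z
    using that insert.hyps P S orth Ex
    by (auto simp: pr'_def inc'_def Comp_reassoc[OF orth(1)] Comp_reassoc[OF orth(3)]
        Comp_reassoc[OF orth(4)] simp del: Hom_iff)
  moreover have "E y \<in> Ob C \<and> inc' y \<in> Hom C (E y) P \<and> pr' y \<in> Hom C P (E y)" if "y \<in> insert x F"
      for y
    using that P S Ex by (auto simp: pr'_def inc'_def)
  ultimately have "fin_biproduct (insert x F) E P inc' pr'"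
    unfolding fin_biproduct_def using P(1) by blast
  then show ?case by blast
qed

definition linear_functor :: "('m \<Rightarrow> 'm) \<Rightarrow> ('o \<Rightarrow> 'o) \<Rightarrow> bool" where
  "linear_functor T TO \<longleftrightarrow>
     (\<forall>X\<in>Ob C. TO X \<in> Ob C \<and> T (Idn C X) = Idn C (TO X)) \<and>
     (\<forall>f. mor f \<longrightarrow> mor (T f) \<and> source (T f) = TO (source f) \<and> target (T f) = TO (target f)) \<and>
     (\<forall>f g. mor f \<and> mor g \<and> target f = source g \<longrightarrow> T (g \<cdot> f) = T g \<cdot> T f) \<and>
     (\<forall>f g. mor f \<and> mor g \<and> source f = source g \<and> target f = target g \<longrightarrow>
        T (hadd C f g) = hadd C (T f) (T g)) \<and>
     (\<forall>X\<in>Ob C. \<forall>Y\<in>Ob C. T (hzero C X Y) = hzero C (TO X) (TO Y))"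

lemma linear_functorD:
  assumes "linear_functor T TO"
  shows "X \<in> Ob C \<Longrightarrow> TO X \<in> Ob C" "X \<in> Ob C \<Longrightarrow> T (Idn C X) = Idn C (TO X)"
    "mor f \<Longrightarrow> mor (T f)" "mor f \<Longrightarrow> source (T f) = TO (source f)" "mor f \<Longrightarrow> target (T f)
        = TO (target f)"
    "\<lbrakk>mor f; mor g; target f = source g\<rbrakk> \<Longrightarrow> T (g \<cdot> f) = T g \<cdot> T f"
    "\<lbrakk>mor f; mor g; source f = source g; target f = target g\<rbrakk> \<Longrightarrow> T (hadd C f g) = hadd C (T f) (T g)"
    "\<lbrakk>X \<in> Ob C; Y \<in> Ob C\<rbrakk> \<Longrightarrow> T (hzero C X Y) = hzero C (TO X) (TO Y)"
  using assms unfolding linear_functor_def by simp_all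

lemma linear_functor_id: "linear_functor (\<lambda>f. f) (\<lambda>X. X)"
  unfolding linear_functor_def by simp

lemma linear_functor_TensM_left: "V \<in> Ob C \<Longrightarrow> linear_functor (\<lambda>f. Idn C V \<star> f) (\<lambda>X. V \<boxtimes> X)"
  unfolding linear_functor_def by (simp add: interchange TensM_hadd)

lemma linear_functor_TensM_right: "V \<in> Ob C \<Longrightarrow> linear_functor (\<lambda>f. f \<star> Idn C V) (\<lambda>X. X \<boxtimes> V)"
  unfolding linear_functor_def by (simp add: interchange TensM_hadd)

text \<open>
  A linear functor preserves the decomposition of the identity of \<open>S\<close>. This is used for the
  functors \<open>V \<otimes> -\<close> and \<open>- \<otimes> V\<close>.
\<close>

lemma fin_biproduct_eq_from_functor:
  assumes "fin_biproduct F E S inc pr" "linear_functor T TO" "mor h" "mor h'"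
    "source h = TO S" "source h' = TO S" "target h = target h'"
    and eq: "\<And>x. x \<in> F \<Longrightarrow> h \<cdot> T (inc x) = h' \<cdot> T (inc x)"
  shows "h = h'"
proof -
  note S = fin_biproductD[OF assms(1)] and T = linear_functorD[OF assms(2)]
  have "mor e \<and> source e = S \<and> target e = S \<and> h \<cdot> T e = h' \<cdot> T e"
    if "e \<in> additive_span C S S ((\<lambda>x. inc x \<cdot> pr x) ` F)" for e
    using that
  proof induction
    case zero
    then show ?case using assms(3-7) S(1) T by simp
  next
    case (base g)
    then obtain y where y: "y \<in> F" "g = inc y \<cdot> pr y" by blast
    have g: "T g = T (inc y) \<cdot> T (pr y)"
      using T(6) S(3-8)[OF y(1)] y(2) by simp
    have "h \<cdot> T g = (h \<cdot> T (inc y)) \<cdot> T (pr y)"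
      using S(3-8)[OF y(1)] T(3-5) assms(3-6) by (simp add: g)
    also have "\<dots> = (h' \<cdot> T (inc y)) \<cdot> T (pr y)"
      by (simp only: eq[OF y(1)])
    also have "\<dots> = h' \<cdot> T g"
      using S(3-8)[OF y(1)] T(3-5) assms(3-6) by (simp add: g)
    finally show ?case
      using S(3-8)[OF y(1)] y(2) by simp
  next
    case (add a b)
    then show ?case using assms(3-7) T(3-5,7) by (simp add: Comp_hadd)
  qed
  from this[OF S(10)] show ?thesis
    using assms(3-6) S(1) T(2) by simp
qed

lemmas fin_biproduct_eq_from = fin_biproduct_eq_from_functor[OF _ linear_functor_id]

lemma fin_biproduct_eq_to:
  assumes "fin_biproduct F E S inc pr" "mor h" "mor h'" "target h = S" "target h' = S"
    "source h = source h'" and eq: "\<And>x. x \<in> F \<Longrightarrow> pr x \<cdot> h = pr x \<cdot> h'"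
  shows "h = h'"
proof -
  note S = fin_biproductD[OF assms(1)]
  have "mor e \<and> source e = S \<and> target e = S \<and> e \<cdot> h = e \<cdot> h'"
    if "e \<in> additive_span C S S ((\<lambda>x. inc x \<cdot> pr x) ` F)" for e
    using that
  proof induction
    case (base g)
    then obtain y where y: "y \<in> F" "g = inc y \<cdot> pr y" by blast
    then show ?case
      using S assms eq[OF y(1)] by simp
  qed (use assms S in \<open>simp_all add: Comp_hadd\<close>)
  from this[OF S(10)] show ?thesis
    using assms by simp
qed

text \<open>
  The sum of the \<open>f x \<cdot> pr x\<close> is built up one summand at a time, over growing subsets \<open>G\<close> of
  \<open>F\<close>.
\<close>

lemma fin_biproduct_ex_from:
  assumes "fin_biproduct F E S inc pr" "finite F" "Z \<in> Ob C"
    "\<And>x. x \<in> F \<Longrightarrow> mor (f x) \<and> source (f x) = E x \<and> target (f x) = Z"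
  obtains h where "mor h" "source h = S" "target h = Z" "\<And>x. x \<in> F \<Longrightarrow> h \<cdot> inc x = f x"
proof -
  note S = fin_biproductD[OF assms(1)]
  have "\<exists>h. mor h \<and> source h = S \<and> target h = Z \<and>
      (\<forall>x\<in>F. h \<cdot> inc x = (if x \<in> G then f x else hzero C (E x) Z))" if "finite G" "G \<subseteq> F" for G
    using that
  proof (induction G)
    case empty
    then show ?case
      using S assms by (intro exI[of _ "hzero C S Z"]) simp
  next
    case (insert y G)
    then obtain h where h: "mor h" "source h = S" "target h = Z"
        "\<And>x. x \<in> F \<Longrightarrow> h \<cdot> inc x = (if x \<in> G then f x else hzero C (E x) Z)"
      by auto
    then show ?case
      using S assms insert.prems insert.hyps
      by (intro exI[of _ "hadd C h (f y \<cdot> pr y)"]) (auto simp: Comp_hadd)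
  qed
  from this[of F] that assms(2) show ?thesis by auto
qed

lemma fin_biproduct_ex_to:
  assumes "fin_biproduct F E S inc pr" "finite F" "Z \<in> Ob C"
    "\<And>x. x \<in> F \<Longrightarrow> mor (f x) \<and> source (f x) = Z \<and> target (f x) = E x"
  obtains h where "mor h" "source h = Z" "target h = S" "\<And>x. x \<in> F \<Longrightarrow> pr x \<cdot> h = f x"
proof -
  note S = fin_biproductD[OF assms(1)]
  have "\<exists>h. mor h \<and> source h = Z \<and> target h = S \<and>
      (\<forall>x\<in>F. pr x \<cdot> h = (if x \<in> G then f x else hzero C Z (E x)))" if "finite G" "G \<subseteq> F" for G
    using that
  proof (induction G)
    case empty
    then show ?case
      using S assms by (intro exI[of _ "hzero C Z S"]) simp
  next
    case (insert y G)
    then obtain h where h: "mor h" "source h = Z" "target h = S"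
        "\<And>x. x \<in> F \<Longrightarrow> pr x \<cdot> h = (if x \<in> G then f x else hzero C Z (E x))"
      by auto
    have "pr x \<cdot> (inc y \<cdot> f y) = (if x = y then f y else hzero C Z (E x))" if "x \<in> F" for x
      using S assms(4)[of y] insert.prems that
      by (auto simp: Comp_reassoc[OF S(9)])
    then show ?case
      using h S assms insert.prems insert.hyps
      by (intro exI[of _ "hadd C h (inc y \<cdot> f y)"]) (auto simp: Comp_hadd)
  qed
  from this[of F] that assms(2) show ?thesis by auto
qed

section \<open>Simple objects and finite length\<close>

lemma zero_object_TensO:
  assumes "zero_object C X" "Y \<in> Ob C"
  shows "zero_object C (X \<boxtimes> Y)"
proof -
  have X: "X \<in> Ob C" "Idn C X = hzero C X X"
    using assms(1) by (simp_all add: zero_object_iff)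
  have "Idn C (X \<boxtimes> Y) = Idn C X \<star> Idn C Y"
    using X(1) assms(2) by simp
  also have "\<dots> = hzero C (X \<boxtimes> Y) (X \<boxtimes> Y)"
    unfolding X(2) using X(1) assms(2) by (simp del: TensM_Idn')
  finally show ?thesis
    using X(1) assms(2) by (simp add: zero_object_iff)
qed

lemma zero_object_iso:
  assumes "zero_object C X" "is_iso C X Y f" "Y \<in> Ob C"
  shows "zero_object C Y"
proof -
  have X: "X \<in> Ob C" "Idn C X = hzero C X X"
    using assms(1) by (simp_all add: zero_object_iff)
  obtain g where g: "mor f" "source f = X" "target f = Y" "mor g" "source g = Y" "target g = X"
      "f \<cdot> g = Idn C Y"
    using is_iso_obtain[OF assms(2) X(1) assms(3)] by blast
  have "g = Idn C X \<cdot> g"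
    using g by simp
  also have "\<dots> = hzero C Y X"
    unfolding X(2) using g X(1) by simp
  finally have "g = hzero C Y X" .
  then have "f \<cdot> g = hzero C Y Y"
    using g(1-3) X(1) assms(3) by simp
  then show ?thesis
    using g(7) assms(3) by (simp add: zero_object_iff)
qed

text \<open>
  The equivalence \<open>- \<otimes> E'\<close> takes \<open>E\<close> to the unit, which is simple. It preserves monomorphisms,
  and it reflects the properties of being zero and of being invertible.
\<close>

lemma invertible_simple:
  assumes n: "is_iso C (E \<boxtimes> E') (Unit C) n" and m: "is_iso C (E' \<boxtimes> E) (Unit C) m"
    and E: "E \<in> Ob C" "E' \<in> Ob C"
  shows "simple_object C E"
proof -
  have U: "\<not> zero_object C (Unit C)"
    using Unit_simple unfolding simple_object_def by blast
  have n': "mor n" "source n = E \<boxtimes> E'" "target n = Unit C"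
    using is_iso_obtain[OF n] E by auto
  have "\<not> zero_object C E"
    using zero_object_TensO[of E E'] zero_object_iso[OF _ n] E U by auto
  moreover have "zero_object C Y \<or> is_iso C Y E i" if Y: "Y \<in> Ob C" and mono: "is_mono C Y E i"
      for Y i
  proof -
    have i: "mor i" "source i = Y" "target i = E"
      using mono Y E unfolding is_mono_def by simp_all
    let ?j = "n \<cdot> (i \<star> Idn C E')"
    have j: "mor ?j" "source ?j = Y \<boxtimes> E'" "target ?j = Unit C"
      using i n' E by simp_all
    have "is_mono C (Y \<boxtimes> E') (Unit C) ?j"
      unfolding is_mono_def
    proof (intro conjI ballI impI)
      fix W a b
      assume W: "W \<in> Ob C" and a: "a \<in> Hom C W (Y \<boxtimes> E')" and b: "b \<in> Hom C W (Y \<boxtimes> E')"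
        and eq: "?j \<cdot> a = ?j \<cdot> b"
      have ab: "mor a" "source a = W" "target a = Y \<boxtimes> E'" "mor b" "source b = W" "target b = Y \<boxtimes> E'"
        using a b W Y E by simp_all
      \<comment> \<open>\<open>a\<close> and \<open>b\<close> become tensor products with \<open>E'\<close> after their source is replaced
          by \<open>(W \<otimes> E) \<otimes> E'\<close>.\<close>
      let ?w = "untensor E E' n W" and ?V = "W \<boxtimes> E"
      have wi: "is_iso C (?V \<boxtimes> E') W ?w"
        by (rule untensor_iso[OF n E W])
      then have w: "mor ?w" "source ?w = ?V \<boxtimes> E'" "target ?w = W"
        using is_iso_obtain E W by (metis TensO_Ob)+
      obtain a0 where a0: "a0 \<in> Hom C ?V Y" "a0 \<star> Idn C E' = a \<cdot> ?w"
        using tensor_invertible_full[OF m n E(2,1), of ?V Y "a \<cdot> ?w"] ab w W Y E by auto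
      obtain b0 where b0: "b0 \<in> Hom C ?V Y" "b0 \<star> Idn C E' = b \<cdot> ?w"
        using tensor_invertible_full[OF m n E(2,1), of ?V Y "b \<cdot> ?w"] ab w W Y E by auto
      have ab0: "mor a0" "source a0 = ?V" "target a0 = Y" "mor b0" "source b0 = ?V" "target b0 = Y"
        using a0(1) b0(1) W Y E by simp_all
      have "n \<cdot> ((i \<cdot> a0) \<star> Idn C E') = n \<cdot> (i \<star> Idn C E') \<cdot> (a0 \<star> Idn C E')"
        using ab0 i n' E by (simp add: interchange)
      also have "\<dots> = (?j \<cdot> a) \<cdot> ?w"
        unfolding a0(2) using ab w i n' E Y by simp
      also have "\<dots> = n \<cdot> (i \<star> Idn C E') \<cdot> (b0 \<star> Idn C E')"
        unfolding b0(2) eq using ab w i n' E Y by simp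
      also have "\<dots> = n \<cdot> ((i \<cdot> b0) \<star> Idn C E')"
        using ab0 i n' E by (simp add: interchange)
      finally have "(i \<cdot> a0) \<star> Idn C E' = (i \<cdot> b0) \<star> Idn C E'"
        by (rule iso_cancel_left[OF n, rotated -1]) (use ab0 i E in simp_all)
      then have "i \<cdot> a0 = i \<cdot> b0"
        by (rule tensor_invertible_faithful[OF m E(2,1), rotated -1]) (use ab0 i in simp_all)
      then have "a0 = b0"
        using mono a0(1) b0(1) W E unfolding is_mono_def by (metis TensO_Ob)
      then have "a \<cdot> ?w = b \<cdot> ?w"
        using a0 b0 by simp
      then show "a = b"
        by (rule iso_cancel_right[OF wi, rotated -1]) (use ab W E in simp_all)
    qed (use j E Y in simp)
    then consider "zero_object C (Y \<boxtimes> E')" | "is_iso C (Y \<boxtimes> E') (Unit C) ?j"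
      using Unit_simple Y E unfolding simple_object_def by (meson TensO_Ob)
    then show ?thesis
    proof cases
      case 1
      then have "Idn C Y \<star> Idn C E' = hzero C Y Y \<star> Idn C E'"
        using Y E by (simp add: zero_object_iff)
      then have "Idn C Y = hzero C Y Y"
        by (rule tensor_invertible_faithful[OF m E(2,1), rotated -1]) (use Y in simp_all)
      then show ?thesis
        using Y by (simp add: zero_object_iff)
    next
      case 2
      then obtain j' where j': "mor j'" "source j' = Unit C" "target j' = Y \<boxtimes> E'" "?j \<cdot> j'
          = Idn C (Unit C)"
        using is_iso_obtain Y E by (metis TensO_Ob Unit_Ob)
      obtain g where g: "g \<in> Hom C E Y" "g \<star> Idn C E' = j' \<cdot> n"
        using tensor_invertible_full[OF m n E(2,1), of E Y "j' \<cdot> n"] j' n' Y E by auto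
      have g': "mor g" "source g = E" "target g = Y"
        using g Y E by simp_all
      have "n \<cdot> ((i \<cdot> g) \<star> Idn C E') = ?j \<cdot> (g \<star> Idn C E')"
        using g' i n' E by (simp add: interchange)
      also have "\<dots> = (?j \<cdot> j') \<cdot> n"
        unfolding g(2) by (rule Comp_assoc'[symmetric]) (use j j' n' in simp_all)
      also have "\<dots> = n \<cdot> (Idn C E \<star> Idn C E')"
        unfolding j'(4) using n' E by simp
      finally have "(i \<cdot> g) \<star> Idn C E' = Idn C E \<star> Idn C E'"
        by (rule iso_cancel_left[OF n, rotated -1]) (use g' i E in simp_all)
      then have ig: "i \<cdot> g = Idn C E"
        by (rule tensor_invertible_faithful[OF m E(2,1), rotated -1]) (use g' i E in simp_all)
      then have "i \<cdot> (g \<cdot> i) = i \<cdot> Idn C Y"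
        using Comp_reassoc[OF ig, of i] g' i by simp
      then have "g \<cdot> i = Idn C Y"
        using mono Y E g' i unfolding is_mono_def by auto
      then show ?thesis
        using is_isoI[OF Y E(1) _ g(1) _ ig] i Y E by simp
    qed
  qed
  ultimately show ?thesis
    unfolding simple_object_def using E by blast
qed

text \<open>
  Schur's lemma. The kernel of \<open>b\<close> is a subobject of \<open>S\<close> other than \<open>S\<close>, hence zero, so that \<open>b\<close>
  is a nonzero subobject of \<open>T\<close>.
\<close>

lemma simple_nonzero_iso:
  assumes S: "simple_object C S" and T: "simple_object C T" and b: "b \<in> Hom C S T" "b \<noteq> hzero C S T"
  shows "is_iso C S T b"
proof -
  have ST: "S \<in> Ob C" "T \<in> Ob C"
    using S T by (simp_all add: simple_object_def)
  then have b': "mor b" "source b = S" "target b = T"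
    using b by simp_all
  obtain N k where k: "is_kernel C N S T b k"
    using ex_kernel[OF ST b(1)] by blast
  then have N: "N \<in> Ob C" and "k \<in> Hom C N S" "zero_mor C N T (b \<cdot> k)"
    unfolding is_kernel_def by blast+
  then have k': "mor k" "source k = N" "target k = S" and bk: "b \<cdot> k = hzero C N T"
    using ST by (simp_all add: zero_mor_iff)
  have fac: "\<exists>!c. c \<in> Hom C W N \<and> k \<cdot> c = a" if "W \<in> Ob C" "a \<in> Hom C W S" "b \<cdot> a = hzero C W T"
      for W a
    using k that ST unfolding is_kernel_def by (simp add: zero_mor_iff del: Hom_iff)
  have "is_mono C N S k"
    unfolding is_mono_def
  proof (intro conjI ballI impI)
    fix W u v
    assume W: "W \<in> Ob C" and uv: "u \<in> Hom C W N" "v \<in> Hom C W N" "k \<cdot> u = k \<cdot> v"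
    have "b \<cdot> (k \<cdot> v) = hzero C W T"
      using Comp_reassoc[OF bk, of v] uv W N k' b' ST by simp
    then show "u = v"
      using fac[of W "k \<cdot> v"] W uv N k' ST by auto
  qed (use N ST k' in simp)
  then consider "zero_object C N" | "is_iso C N S k"
    using S N unfolding simple_object_def by blast
  then have "zero_object C N"
  proof cases
    case 2
    obtain k1 where "mor k1" "source k1 = S" "target k1 = N" "k \<cdot> k1 = Idn C S"
      using is_iso_obtain[OF 2 N ST(1)] by blast
    then have "b \<cdot> Idn C S = hzero C S T"
      using Comp_reassoc[OF bk, of k1] k' b' ST by simp
    then show ?thesis
      using b b' by simp
  qed
  then have NZ: "Idn C N = hzero C N N"
    by (simp add: zero_object_iff)
  have "is_mono C S T b"
    unfolding is_mono_def
  proof (intro conjI ballI impI)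
    fix W u v
    assume W: "W \<in> Ob C" and uv: "u \<in> Hom C W S" "v \<in> Hom C W S" "b \<cdot> u = b \<cdot> v"
    obtain d where d: "mor d" "source d = W" "target d = S" "u = hadd C d v"
      using hadd_difference[of u v W S] uv W ST by auto
    have "hadd C (b \<cdot> d) (b \<cdot> v) = b \<cdot> v"
      using uv d b' W ST by (simp add: Comp_hadd)
    then have "b \<cdot> d = hzero C W T"
      by (rule hadd_cancel_zero[rotated -1]) (use uv d b' W ST in simp_all)
    then obtain c where c: "c \<in> Hom C W N" "k \<cdot> c = d"
      using fac[of W d] d W ST by auto
    have "c = Idn C N \<cdot> c"
      using c W N by simp
    also have "\<dots> = hzero C W N"
      unfolding NZ using c W N by simp
    finally have "d = hzero C W S"
      using c(2) W k' N by simp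
    then show "u = v"
      using d uv W ST by simp
  qed (use b in blast)
  then show ?thesis
    using S T unfolding simple_object_def by blast
qed

text \<open>
  Each step of a composition series of \<open>W\<close> accounts for at most one \<open>x\<close>: a morphism to \<open>E x\<close>
  that vanishes on the smaller subobject factors through the simple quotient \<open>S\<close>, and is zero
  unless \<open>S\<close> is isomorphic to \<open>E x\<close>.
\<close>

lemma finite_nonzero_Hom:
  fixes E :: "'i \<Rightarrow> 'o"
  assumes simple: "\<And>x. x \<in> I \<Longrightarrow> simple_object C (E x)"
    and distinct: "\<And>x y. \<lbrakk>x \<in> I; y \<in> I; isomorphic C (E x) (E y)\<rbrakk> \<Longrightarrow> x = y"
    and W: "W \<in> Ob C"
  shows "finite {x \<in> I. \<exists>f\<in>Hom C W (E x). f \<noteq> hzero C W (E x)}"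
  using all_finite_length[OF W]
proof induction
  case (zero X)
  have "f = hzero C X (E x)" if "x \<in> I" "f \<in> Hom C X (E x)" for x f
  proof -
    have "E x \<in> Ob C" using simple that by (simp add: simple_object_def)
    moreover from this have "\<exists>!f. f \<in> Hom C X (E x)" "X \<in> Ob C"
      using zero unfolding zero_object_def by blast+
    moreover from calculation have "hzero C X (E x) \<in> Hom C X (E x)"
      by simp
    ultimately show ?thesis using that by blast
  qed
  then have "{x \<in> I. \<exists>f\<in>Hom C X (E x). f \<noteq> hzero C X (E x)} = {}"
    by blast
  then show ?case by (metis finite.emptyI)
next
  case (step Y X i S q)
  let ?N = "\<lambda>W. {x \<in> I. \<exists>f\<in>Hom C W (E x). f \<noteq> hzero C W (E x)}"
  have S: "S \<in> Ob C" and q: "q \<in> Hom C X S"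
    using step by (simp_all add: simple_object_def is_cokernel_def)
  have Y: "Y \<in> Ob C"
    using step.hyps(1) by cases (simp_all add: zero_object_def)
  have i: "i \<in> Hom C Y X"
    using step by (simp add: is_mono_def)
  have "x \<in> ?N Y \<or> isomorphic C S (E x)" if x_X: "x \<in> ?N X" for x
  proof (rule disjCI)
    assume no: "\<not> isomorphic C S (E x)"
    obtain f where x: "x \<in> I" and f: "f \<in> Hom C X (E x)" "f \<noteq> hzero C X (E x)"
      using x_X by blast
    have E: "E x \<in> Ob C"
      using simple x by (simp add: simple_object_def)
    have "f \<cdot> i \<noteq> hzero C Y (E x)"
    proof
      assume "f \<cdot> i = hzero C Y (E x)"
      then have "zero_mor C Y (E x) (f \<cdot> i)"
        using Y E by (simp add: zero_mor_iff)
      then obtain b where b: "b \<in> Hom C S (E x)" "b \<cdot> q = f"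
        using step.hyps(4) f(1) E unfolding is_cokernel_def by blast
      then have "b \<noteq> hzero C S (E x)"
        using f(2) q S E step.hyps(2) by (metis Comp_hzero(1) Hom_iff)
      then show False
        using no simple_nonzero_iso[OF step.hyps(5) simple[OF x] b(1)] unfolding isomorphic_def
            by blast
    qed
    then show "x \<in> ?N Y"
      using x f i Y E step.hyps(2) by auto
  qed
  then have "?N X \<subseteq> ?N Y \<union> {x \<in> I. isomorphic C S (E x)}"
    by blast
  moreover have "finite {x \<in> I. isomorphic C S (E x)}"
  proof (cases "\<exists>x0\<in>I. isomorphic C S (E x0)")
    case True
    then obtain x0 where x0: "x0 \<in> I" "isomorphic C S (E x0)" by blast
    have "x = x0" if "x \<in> I" "isomorphic C S (E x)" for x
      using that x0 S simple distinct isomorphic_trans[of "E x" S "E x0"] isomorphic_sym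
      by (simp add: simple_object_def)
    then have "{x \<in> I. isomorphic C S (E x)} \<subseteq> {x0}" by blast
    then show ?thesis by (rule finite_subset) simp
  next
    case False
    then have "{x \<in> I. isomorphic C S (E x)} = {}" by blast
    then show ?thesis by (metis finite.emptyI)
  qed
  ultimately show ?case
    using step.IH by (meson finite_UnI finite_subset)
qed

end

section \<open>Calculus of representatives in the ind-completion\<close>

lemma Ind_simps [simp]:
  "Ob (Ind C) = {X. ind_object C X}" "Hom (Ind C) = ind_Hom C" "Comp (Ind C) = ind_comp C"
  "TensO (Ind C) = ind_tensor C" "TensM (Ind C) = ind_tensor_mor C"
  "Unit (Ind C) = const_ind C (Unit C)"
  "Idn (Ind C) X = ind_map C X X (\<lambda>i. (i, Idn C (ob X i)))"
  by (simp_all add: Ind_def)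

context category
begin

lemma ind_objectD:
  assumes "ind_object C X"
  shows "category (ix X)" "filtered (ix X)"
    and "i \<in> Ob (ix X) \<Longrightarrow> ob X i \<in> Ob C"
    and "i \<in> Ob (ix X) \<Longrightarrow> ar X (Idn (ix X) i) = Idn C (ob X i)"
    and "\<lbrakk>i \<in> Ob (ix X); j \<in> Ob (ix X); u \<in> Hom (ix X) i j\<rbrakk> \<Longrightarrow> mor (ar X u) \<and> source (ar X u)
        = ob X i \<and> target (ar X u) = ob X j"
    and "\<lbrakk>i \<in> Ob (ix X); j \<in> Ob (ix X); k \<in> Ob (ix X); u \<in> Hom (ix X) i j; v \<in> Hom (ix X) j k\<rbrakk>
      \<Longrightarrow> ar X (v \<cdot>\<^bsub>ix X\<^esub> u) = ar X v \<cdot> ar X u"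
proof -
  show "category (ix X)" "filtered (ix X)"
    using assms unfolding ind_object_def by blast+
  show 1: "i \<in> Ob (ix X) \<Longrightarrow> ob X i \<in> Ob C" for i
    using assms unfolding ind_object_def by blast
  show "i \<in> Ob (ix X) \<Longrightarrow> ar X (Idn (ix X) i) = Idn C (ob X i)"
    using assms unfolding ind_object_def by blast
  show "mor (ar X u) \<and> source (ar X u) = ob X i \<and> target (ar X u) = ob X j"
    if "i \<in> Ob (ix X)" "j \<in> Ob (ix X)" "u \<in> Hom (ix X) i j"
  proof -
    have "ar X u \<in> Hom C (ob X i) (ob X j)"
      using assms that unfolding ind_object_def by blast
    then show ?thesis
      using 1 that by simp
  qed
  show "\<lbrakk>i \<in> Ob (ix X); j \<in> Ob (ix X); k \<in> Ob (ix X); u \<in> Hom (ix X) i j; v \<in> Hom (ix X) j k\<rbrakk>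
      \<Longrightarrow> ar X (v \<cdot>\<^bsub>ix X\<^esub> u) = ar X v \<cdot> ar X u"
    using assms unfolding ind_object_def by blast
qed

lemma ind_join:
  assumes "ind_object C X" "i \<in> Ob (ix X)" "j \<in> Ob (ix X)"
  obtains k u v where "k \<in> Ob (ix X)" "u \<in> Hom (ix X) i k" "v \<in> Hom (ix X) j k"
  using ind_objectD(2)[OF assms(1)] assms(2,3) that unfolding filtered_def by blast

lemma ind_equalize:
  assumes "ind_object C X" "i \<in> Ob (ix X)" "j \<in> Ob (ix X)" "u \<in> Hom (ix X) i j" "v \<in> Hom (ix X) i j"
  obtains k w where "k \<in> Ob (ix X)" "w \<in> Hom (ix X) j k" "ar X w \<cdot> ar X u = ar X w \<cdot> ar X v"
proof -
  obtain k w where k: "k \<in> Ob (ix X)" "w \<in> Hom (ix X) j k" "w \<cdot>\<^bsub>ix X\<^esub> u = w \<cdot>\<^bsub>ix X\<^esub> v"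
    using ind_objectD(2)[OF assms(1)] assms(2-) unfolding filtered_def by blast
  then have "ar X w \<cdot> ar X u = ar X w \<cdot> ar X v"
    using ind_objectD(6)[OF assms(1)] assms by metis
  then show ?thesis
    using that k by blast
qed

text \<open>
  The pairs that \<open>germ\<close> sorts into classes: \<open>e\<close> is a morphism from \<open>V\<close> to one of the objects of
  \<open>Y\<close>, together with the index of that object.
\<close>

definition represents :: "'o \<Rightarrow> ('u, 'o, 'm) ind_obj \<Rightarrow> 'u index \<times> 'm \<Rightarrow> bool" where
  "represents V Y e \<longleftrightarrow> fst e \<in> Ob (ix Y) \<and> mor (snd e) \<and> source (snd e) = V \<and> target (snd e)
      = ob Y (fst e)"

lemma germ_iff:
  assumes "ind_object C Y" "represents V Y (j, h)"
  shows "(j', h') \<in> germ C V Y (j, h) \<longleftrightarrow> represents V Y (j', h') \<and>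
    (\<exists>k\<in>Ob (ix Y). \<exists>u\<in>Hom (ix Y) j k. \<exists>v\<in>Hom (ix Y) j' k. ar Y u \<cdot> h = ar Y v \<cdot> h')"
proof -
  have "V \<in> Ob C"
    using assms(2) by (auto simp: represents_def)
  then show ?thesis
    using ind_objectD(3)[OF assms(1)] unfolding germ_def represents_def by auto
qed

lemma germ_refl:
  assumes "ind_object C Y" "represents V Y e"
  shows "e \<in> germ C V Y e"
proof -
  obtain j h where e: "e = (j, h)" by fastforce
  interpret J: category "ix Y" by (rule ind_objectD(1)[OF assms(1)])
  show ?thesis
    using assms J.Idn_closed[of j] unfolding e
    by (subst germ_iff) (auto simp: represents_def simp del: J.Hom_iff)
qed

text \<open>
  Germs are the classes of an equivalence relation. For transitivity, the indices at which the
  two given coincidences happen are joined; the two resulting arrows out of the middle index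
  need not be equal, but a further transition equalizes them.
\<close>

lemma germ_cong:
  assumes Y: "ind_object C Y" and e: "represents V Y e" and e': "e' \<in> germ C V Y e"
  shows "germ C V Y e' = germ C V Y e"
proof -
  interpret J: category "ix Y" by (rule ind_objectD(1)[OF Y])
  obtain j h where [simp]: "e = (j, h)" by fastforce
  obtain j' h' where [simp]: "e' = (j', h')" by fastforce
  have rep: "represents V Y (j, h)" "represents V Y (j', h')"
    using e e' germ_iff[OF Y] by auto
  have trans: "(j3, h3) \<in> germ C V Y (j1, h1)"
    if 1: "(j2, h2) \<in> germ C V Y (j1, h1)" and 2: "(j3, h3) \<in> germ C V Y (j2, h2)"
      and r: "represents V Y (j1, h1)" for j1 h1 j2 h2 j3 h3
  proof -
    obtain k u v where k: "k \<in> Ob (ix Y)" "u \<in> Hom (ix Y) j1 k" "v \<in> Hom (ix Y) j2 k"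
        "ar Y u \<cdot> h1 = ar Y v \<cdot> h2" and r2: "represents V Y (j2, h2)"
      using 1 germ_iff[OF Y r] by blast
    obtain k' u' v' where k': "k' \<in> Ob (ix Y)" "u' \<in> Hom (ix Y) j2 k'" "v' \<in> Hom (ix Y) j3 k'"
        "ar Y u' \<cdot> h2 = ar Y v' \<cdot> h3" and r3: "represents V Y (j3, h3)"
      using 2 germ_iff[OF Y r2] by blast
    have j: "j1 \<in> Ob (ix Y)" "j2 \<in> Ob (ix Y)" "j3 \<in> Ob (ix Y)"
      using r r2 r3 by (auto simp: represents_def)
    have h: "mor h1" "target h1 = ob Y j1" "mor h2" "target h2 = ob Y j2" "mor h3" "target h3
        = ob Y j3"
      using r r2 r3 by (auto simp: represents_def)
    obtain l w w' where l: "l \<in> Ob (ix Y)" "w \<in> Hom (ix Y) k l" "w' \<in> Hom (ix Y) k' l"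
      using ind_join[OF Y k(1) k'(1)] by blast
    have "w \<cdot>\<^bsub>ix Y\<^esub> v \<in> Hom (ix Y) j2 l" "w' \<cdot>\<^bsub>ix Y\<^esub> u' \<in> Hom (ix Y) j2 l"
      using J.Comp_closed j k(1-3) k'(1-3) l by blast+
    then obtain m z where m: "m \<in> Ob (ix Y)" "z \<in> Hom (ix Y) l m"
        "ar Y z \<cdot> ar Y (w \<cdot>\<^bsub>ix Y\<^esub> v) = ar Y z \<cdot> ar Y (w' \<cdot>\<^bsub>ix Y\<^esub> u')"
      using ind_equalize[OF Y j(2) l(1)] by blast
    note ar = ind_objectD(5)[OF Y] and arC = ind_objectD(6)[OF Y]
    have wv: "ar Y (w \<cdot>\<^bsub>ix Y\<^esub> v) = ar Y w \<cdot> ar Y v" "ar Y (w' \<cdot>\<^bsub>ix Y\<^esub> u') = ar Y w' \<cdot> ar Y u'"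
      using arC j k(1-3) k'(1-3) l by blast+
    have mors: "mor (ar Y u)" "source (ar Y u) = ob Y j1" "target (ar Y u) = ob Y k"
      "mor (ar Y v)" "source (ar Y v) = ob Y j2" "target (ar Y v) = ob Y k"
      "mor (ar Y u')" "source (ar Y u') = ob Y j2" "target (ar Y u') = ob Y k'"
      "mor (ar Y v')" "source (ar Y v') = ob Y j3" "target (ar Y v') = ob Y k'"
      "mor (ar Y w)" "source (ar Y w) = ob Y k" "target (ar Y w) = ob Y l"
      "mor (ar Y w')" "source (ar Y w') = ob Y k'" "target (ar Y w') = ob Y l"
      "mor (ar Y z)" "source (ar Y z) = ob Y l" "target (ar Y z) = ob Y m"
      using ar[OF j(1) k(1,2)] ar[OF j(2) k(1,3)] ar[OF j(2) k'(1,2)] ar[OF j(3) k'(1,3)]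
        ar[OF k(1) l(1,2)] ar[OF k'(1) l(1,3)] ar[OF l(1) m(1,2)] by simp_all
    have "ar Y z \<cdot> ar Y w \<cdot> ar Y u \<cdot> h1 = (ar Y z \<cdot> (ar Y w \<cdot> ar Y v)) \<cdot> h2"
      using mors h k(4) by simp
    also have "\<dots> = (ar Y z \<cdot> (ar Y w' \<cdot> ar Y u')) \<cdot> h2"
      using m(3) unfolding wv by simp
    also have "\<dots> = ar Y z \<cdot> ar Y w' \<cdot> ar Y v' \<cdot> h3"
      using mors h k'(4) by simp
    finally have eq: "ar Y z \<cdot> ar Y w \<cdot> ar Y u \<cdot> h1 = ar Y z \<cdot> ar Y w' \<cdot> ar Y v' \<cdot> h3" .
    let ?U = "z \<cdot>\<^bsub>ix Y\<^esub> (w \<cdot>\<^bsub>ix Y\<^esub> u)" and ?V = "z \<cdot>\<^bsub>ix Y\<^esub> (w' \<cdot>\<^bsub>ix Y\<^esub> v')"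
    have wu: "w \<cdot>\<^bsub>ix Y\<^esub> u \<in> Hom (ix Y) j1 l" "w' \<cdot>\<^bsub>ix Y\<^esub> v' \<in> Hom (ix Y) j3 l"
      using J.Comp_closed j k(1-3) k'(1-3) l by blast+
    then have UV: "?U \<in> Hom (ix Y) j1 m" "?V \<in> Hom (ix Y) j3 m"
      using J.Comp_closed j l(1) m(1,2) by blast+
    have "ar Y ?U = ar Y z \<cdot> ar Y w \<cdot> ar Y u" "ar Y ?V = ar Y z \<cdot> ar Y w' \<cdot> ar Y v'"
      using arC[OF j(1) l(1) m(1) wu(1) m(2)] arC[OF j(3) l(1) m(1) wu(2) m(2)]
        arC[OF j(1) k(1) l(1) k(2) l(2)] arC[OF j(3) k'(1) l(1) k'(3) l(3)] by simp_all
    then have "ar Y ?U \<cdot> h1 = ar Y ?V \<cdot> h3"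
      using eq mors h by simp
    then show ?thesis
      using germ_iff[OF Y r] r3 m(1) UV by blast
  qed
  have sym: "(j, h) \<in> germ C V Y (j', h')"
    using e' germ_iff[OF Y rep(1)] germ_iff[OF Y rep(2)] rep by simp metis
  show ?thesis
  proof (intro equalityI subsetI)
    fix x assume "x \<in> germ C V Y e'"
    then show "x \<in> germ C V Y e"
      using trans[of j' h' j h] rep e' by (cases x) simp
  next
    fix x assume "x \<in> germ C V Y e"
    then show "x \<in> germ C V Y e'"
      using trans[of j h j' h'] rep sym by (cases x) simp
  qed
qed

lemma germ_precompose:
  assumes Y: "ind_object C Y" and e: "represents V Y (j, h)" and e': "(j', h') \<in> germ C V Y (j, h)"
    and w: "mor w" "target w = V"
  shows "(j', h' \<cdot> w) \<in> germ C (source w) Y (j, h \<cdot> w)"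
proof -
  have e'r: "represents V Y (j', h')"
    using e' germ_iff[OF Y e] by blast
  have rep: "represents (source w) Y (j, h \<cdot> w)" "represents (source w) Y (j', h' \<cdot> w)"
    using e e'r w by (simp_all add: represents_def)
  obtain k u v where k: "k \<in> Ob (ix Y)" "u \<in> Hom (ix Y) j k" "v \<in> Hom (ix Y) j' k" "ar Y u \<cdot> h
      = ar Y v \<cdot> h'"
    using e' germ_iff[OF Y e] by blast
  have j: "j \<in> Ob (ix Y)" "j' \<in> Ob (ix Y)"
    using e e'r by (simp_all add: represents_def)
  have "ar Y u \<cdot> (h \<cdot> w) = (ar Y u \<cdot> h) \<cdot> w" "(ar Y v \<cdot> h') \<cdot> w = ar Y v \<cdot> (h' \<cdot> w)"
    using ind_objectD(5)[OF Y j(1) k(1,2)] ind_objectD(5)[OF Y j(2) k(1,3)] e e'r w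
    by (simp_all add: represents_def)
  then have "ar Y u \<cdot> (h \<cdot> w) = ar Y v \<cdot> (h' \<cdot> w)"
    using k(4) by simp
  then show ?thesis
    using germ_iff[OF Y rep(1)] rep(2) k(1-3) by blast
qed

lemma germ_transition:
  assumes Y: "ind_object C Y" and e: "represents V Y (j, h)"
    and u: "k \<in> Ob (ix Y)" "u \<in> Hom (ix Y) j k"
  shows "(k, ar Y u \<cdot> h) \<in> germ C V Y (j, h)"
proof -
  interpret J: category "ix Y" by (rule ind_objectD(1)[OF Y])
  have j: "j \<in> Ob (ix Y)"
    using e by (simp add: represents_def)
  have au: "mor (ar Y u)" "source (ar Y u) = ob Y j" "target (ar Y u) = ob Y k"
    using ind_objectD(5)[OF Y j u] by simp_all
  have "represents V Y (k, ar Y u \<cdot> h)"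
    using e u au by (simp add: represents_def)
  moreover have "ar Y u \<cdot> h = ar Y (Idn (ix Y) k) \<cdot> (ar Y u \<cdot> h)"
    using ind_objectD(4)[OF Y u(1)] e au by (simp add: represents_def)
  ultimately show ?thesis
    using germ_iff[OF Y e] u J.Idn_closed[OF u(1)] by blast
qed

lemma cls_nonempty:
  assumes "f \<in> ind_Hom C X Y" "ind_object C X" "ind_object C Y" "i \<in> Ob (ix X)"
  obtains j h where "(j, h) \<in> cls f i"
proof -
  obtain j h where *: "j \<in> Ob (ix Y)" "h \<in> Hom C (ob X i) (ob Y j)" "cls f i
      = germ C (ob X i) Y (j, h)"
    using assms(1,4) unfolding ind_Hom_def by blast
  then have "represents (ob X i) Y (j, h)"
    using ind_objectD(3)[OF assms(2,4)] ind_objectD(3)[OF assms(3) *(1)]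
        by (simp add: represents_def)
  then show ?thesis
    using that germ_refl[OF assms(3)] *(3) by blast
qed

lemma cls_mem:
  assumes "f \<in> ind_Hom C X Y" "ind_object C X" "ind_object C Y" "(j, h) \<in> cls f i"
  shows "i \<in> Ob (ix X)" "represents (ob X i) Y (j, h)" "cls f i = germ C (ob X i) Y (j, h)"
    "j \<in> Ob (ix Y)" "mor h" "source h = ob X i" "target h = ob Y j"
proof -
  show i: "i \<in> Ob (ix X)"
    using assms(1,4) unfolding ind_Hom_def by force
  obtain j0 h0 where *: "j0 \<in> Ob (ix Y)" "h0 \<in> Hom C (ob X i) (ob Y j0)"
      "cls f i = germ C (ob X i) Y (j0, h0)"
    using assms(1) i unfolding ind_Hom_def by blast
  then have r0: "represents (ob X i) Y (j0, h0)"
    using ind_objectD(3)[OF assms(2) i] ind_objectD(3)[OF assms(3) *(1)]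
        by (simp add: represents_def)
  show r: "represents (ob X i) Y (j, h)"
    using assms(4) germ_iff[OF assms(3) r0] *(3) by simp
  show "cls f i = germ C (ob X i) Y (j, h)"
    using germ_cong[OF assms(3) r0] assms(4) *(3) by simp
  show "j \<in> Ob (ix Y)" "mor h" "source h = ob X i" "target h = ob Y j"
    using r by (simp_all add: represents_def)
qed

lemma cls_transition:
  assumes "f \<in> ind_Hom C X Y" "ind_object C X" "ind_object C Y" "(j, h) \<in> cls f i"
    "k \<in> Ob (ix Y)" "u \<in> Hom (ix Y) j k"
  shows "(k, ar Y u \<cdot> h) \<in> cls f i"
  using germ_transition[OF assms(3) cls_mem(2)[OF assms(1-4)] assms(5,6)] cls_mem(3)[OF assms(1-4)]
  by simp

lemma cls_restrict:
  assumes "f \<in> ind_Hom C X Y" "(j, h) \<in> cls f i'" "i \<in> Ob (ix X)" "i' \<in> Ob (ix X)"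
      "u \<in> Hom (ix X) i i'"
  shows "(j, h \<cdot> ar X u) \<in> cls f i"
  using assms unfolding ind_Hom_def by blast

lemma cls_common:
  assumes "f \<in> ind_Hom C X Y" "ind_object C X" "ind_object C Y" "(j, h) \<in> cls f i"
      "(j', h') \<in> cls f i"
  obtains k u v where "k \<in> Ob (ix Y)" "u \<in> Hom (ix Y) j k" "v \<in> Hom (ix Y) j' k" "ar Y u \<cdot> h
      = ar Y v \<cdot> h'"
  using cls_mem(3)[OF assms(1-4)] germ_iff[OF assms(3) cls_mem(2)[OF assms(1-4)]] assms(5) that
      by blast

lemma cls_absorb:
  assumes "f \<in> ind_Hom C X Y" "ind_object C X" "ind_object C Y" "(j, h) \<in> cls f i"
    "represents (ob X i) Y (j', h')" "k \<in> Ob (ix Y)" "u \<in> Hom (ix Y) j k" "v \<in> Hom (ix Y) j' k"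
    "ar Y u \<cdot> h = ar Y v \<cdot> h'"
  shows "(j', h') \<in> cls f i"
  using cls_mem(3)[OF assms(1-4)] germ_iff[OF assms(3) cls_mem(2)[OF assms(1-4)]] assms(5-) by blast

lemma ind_Hom_eqI:
  assumes "f \<in> ind_Hom C X Y" "g \<in> ind_Hom C X Y" "ind_object C X" "ind_object C Y"
    and "\<And>i. i \<in> Ob (ix X) \<Longrightarrow> \<exists>e. e \<in> cls f i \<and> e \<in> cls g i"
  shows "f = g"
proof -
  have "cls f i = cls g i" for i
  proof (cases "i \<in> Ob (ix X)")
    case True
    then obtain j h where jh: "(j, h) \<in> cls f i" "(j, h) \<in> cls g i"
      using assms(5) by fastforce
    show ?thesis
      using cls_mem(3)[OF assms(1,3,4) jh(1)] cls_mem(3)[OF assms(2,3,4) jh(2)] by simp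
  next
    case False
    then show ?thesis
      using assms(1,2) unfolding ind_Hom_def by auto
  qed
  then show ?thesis
    using assms(1,2) unfolding ind_Hom_def by (auto intro!: ind_mor.equality)
qed

lemma src_tgt: "f \<in> ind_Hom C X Y \<Longrightarrow> src f = X" "f \<in> ind_Hom C X Y \<Longrightarrow> tgt f = Y"
  unfolding ind_Hom_def by auto

text \<open>
  Naturality has to be checked for one representative at each index only.
\<close>

lemma ind_HomI:
  assumes X: "ind_object C X" and Y: "ind_object C Y" and "src f = X" "tgt f = Y"
    and out: "\<And>i. i \<notin> Ob (ix X) \<Longrightarrow> cls f i = {}"
    and F: "\<And>i. i \<in> Ob (ix X) \<Longrightarrow> represents (ob X i) Y (F i) \<and> cls f i = germ C (ob X i) Y (F i)"
    and nat: "\<And>i i' u. \<lbrakk>i \<in> Ob (ix X); i' \<in> Ob (ix X); u \<in> Hom (ix X) i i'\<rbrakk>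
      \<Longrightarrow> (fst (F i'), snd (F i') \<cdot> ar X u) \<in> germ C (ob X i) Y (F i)"
  shows "f \<in> ind_Hom C X Y"
proof -
  have "\<exists>j\<in>Ob (ix Y). \<exists>h\<in>Hom C (ob X i) (ob Y j). cls f i = germ C (ob X i) Y (j, h)"
    if i: "i \<in> Ob (ix X)" for i
    using F[OF i] ind_objectD(3)[OF X i] ind_objectD(3)[OF Y]
    by (intro bexI[of _ "fst (F i)"] bexI[of _ "snd (F i)"]) (simp_all add: represents_def)
  moreover have "(j, h \<cdot> ar X u) \<in> cls f i"
    if i: "i \<in> Ob (ix X)" and i': "i' \<in> Ob (ix X)" and u: "u \<in> Hom (ix X) i i'"
        and jh: "(j, h) \<in> cls f i'"
    for i i' u j h
  proof -
    obtain k a where Fi': "F i' = (k, a)" by fastforce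
    have "(j, h \<cdot> ar X u) \<in> germ C (source (ar X u)) Y (k, a \<cdot> ar X u)"
      by (rule germ_precompose[OF Y]) (use F[OF i'] Fi' jh ind_objectD(5)[OF X i i' u] in auto)
    moreover have "source (ar X u) = ob X i"
      using ind_objectD(5)[OF X i i' u] by simp
    moreover have "germ C (ob X i) Y (k, a \<cdot> ar X u) = germ C (ob X i) Y (F i)"
      using germ_cong[OF Y _ nat[OF i i' u]] F[OF i] Fi' by simp
    ultimately show ?thesis
      using F[OF i] by simp
  qed
  ultimately show ?thesis
    unfolding ind_Hom_def using out assms(3,4) by blast
qed

lemma ind_map_Hom:
  assumes X: "ind_object C X" and Y: "ind_object C Y"
    and F: "\<And>i. i \<in> Ob (ix X) \<Longrightarrow> represents (ob X i) Y (F i)"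
    and nat: "\<And>i i' u. \<lbrakk>i \<in> Ob (ix X); i' \<in> Ob (ix X); u \<in> Hom (ix X) i i'\<rbrakk>
      \<Longrightarrow> (fst (F i'), snd (F i') \<cdot> ar X u) \<in> germ C (ob X i) Y (F i)"
  shows "ind_map C X Y F \<in> ind_Hom C X Y"
    and "i \<in> Ob (ix X) \<Longrightarrow> F i \<in> cls (ind_map C X Y F) i"
proof -
  show "ind_map C X Y F \<in> ind_Hom C X Y"
    by (rule ind_HomI[OF X Y _ _ _ _ nat]) (use F in \<open>simp_all add: ind_map_def\<close>)
  show "i \<in> Ob (ix X) \<Longrightarrow> F i \<in> cls (ind_map C X Y F) i"
    using germ_refl[OF Y F] by (simp add: ind_map_def)
qed

lemma ind_Idn:
  assumes X: "ind_object C X"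
  shows "ind_map C X X (\<lambda>i. (i, Idn C (ob X i))) \<in> ind_Hom C X X"
    and "i \<in> Ob (ix X) \<Longrightarrow> (i, Idn C (ob X i)) \<in> cls (ind_map C X X (\<lambda>i. (i, Idn C (ob X i)))) i"
proof -
  let ?F = "\<lambda>i. (i, Idn C (ob X i))"
  have r: "represents (ob X i) X (?F i)" if "i \<in> Ob (ix X)" for i
    using ind_objectD(3)[OF X that] that by (simp add: represents_def)
  have n: "(fst (?F i'), snd (?F i') \<cdot> ar X u) \<in> germ C (ob X i) X (?F i)"
    if "i \<in> Ob (ix X)" "i' \<in> Ob (ix X)" "u \<in> Hom (ix X) i i'" for i i' u
  proof -
    have "ar X u \<cdot> Idn C (ob X i) = Idn C (ob X i') \<cdot> ar X u"
      using ind_objectD(5)[OF X that] by simp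
    then show ?thesis
      using germ_transition[OF X r[OF that(1)] that(2,3)] by simp
  qed
  show "ind_map C X X ?F \<in> ind_Hom C X X"
    and "i \<in> Ob (ix X) \<Longrightarrow> (i, Idn C (ob X i)) \<in> cls (ind_map C X X ?F) i"
    using ind_map_Hom[OF X X r n] by auto
qed

text \<open>
  Composites can be computed with any representatives. Two representatives of \<open>f\<close> at \<open>i\<close> agree
  at some later index, and a representative of \<open>g\<close> there can be used for both.
\<close>

lemma ind_comp_cls:
  assumes f: "f \<in> ind_Hom C X Y" and g: "g \<in> ind_Hom C Y Z"
    and X: "ind_object C X" and Y: "ind_object C Y" and Z: "ind_object C Z"
    and a: "(j, a) \<in> cls f i" and b: "(k, b) \<in> cls g j"
  shows "cls (ind_comp C g f) i = germ C (ob X i) Z (k, b \<cdot> a)"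
    and "represents (ob X i) Z (k, b \<cdot> a)"
    and "(k, b \<cdot> a) \<in> cls (ind_comp C g f) i"
proof -
  have rep: "represents (ob X i) Z (k', b' \<cdot> a')" if "(j', a') \<in> cls f i" "(k', b') \<in> cls g j'"
      for j' a' k' b'
    using cls_mem[OF f X Y that(1)] cls_mem[OF g Y Z that(2)] by (simp add: represents_def)
  have eq: "germ C (ob X i) Z (k', b' \<cdot> a') = germ C (ob X i) Z (k, b \<cdot> a)"
    if a': "(j', a') \<in> cls f i" and b': "(k', b') \<in> cls g j'" for j' a' k' b'
  proof -
    obtain l u v where l: "l \<in> Ob (ix Y)" "u \<in> Hom (ix Y) j l" "v \<in> Hom (ix Y) j' l" "ar Y u \<cdot> a
        = ar Y v \<cdot> a'"
      using cls_common[OF f X Y a a'] by blast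
    obtain m c where c: "(m, c) \<in> cls g l"
      using cls_nonempty[OF g Y Z l(1)] by blast
    have *: "germ C (ob X i) Z (k0, b0 \<cdot> a0) = germ C (ob X i) Z (m, c \<cdot> (ar Y w \<cdot> a0))"
      if a0: "(j0, a0) \<in> cls f i" and b0: "(k0, b0) \<in> cls g j0" and w: "w \<in> Hom (ix Y) j0 l"
          for j0 a0 k0 b0 w
    proof -
      note A = cls_mem[OF f X Y a0] and B = cls_mem[OF g Y Z b0]
      have "(m, c \<cdot> ar Y w) \<in> germ C (ob Y j0) Z (k0, b0)"
        using cls_restrict[OF g c B(1) l(1) w] B(3) by simp
      then have "(m, (c \<cdot> ar Y w) \<cdot> a0) \<in> germ C (ob X i) Z (k0, b0 \<cdot> a0)"
        using germ_precompose[OF Z B(2), of m "c \<cdot> ar Y w" a0] A by simp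
      moreover have "(c \<cdot> ar Y w) \<cdot> a0 = c \<cdot> (ar Y w \<cdot> a0)"
        using cls_mem[OF g Y Z c] ind_objectD(5)[OF Y A(4) l(1) w] A by simp
      ultimately show ?thesis
        using germ_cong[OF Z rep[OF a0 b0]] by metis
    qed
    show ?thesis
      using *[OF a b l(2)] *[OF a' b' l(3)] l(4) by simp
  qed
  have "cls (ind_comp C g f) i = (\<Union>(j, a)\<in>cls f i. \<Union>(k, b)\<in>cls g j. germ C (ob X i) Z (k, b \<cdot> a))"
    unfolding ind_comp_def using src_tgt(1)[OF f] src_tgt(2)[OF g] by simp
  also have "\<dots> = germ C (ob X i) Z (k, b \<cdot> a)"
  proof (intro equalityI subsetI)
    fix x assume "x \<in> germ C (ob X i) Z (k, b \<cdot> a)"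
    then show "x \<in> (\<Union>(j, a)\<in>cls f i. \<Union>(k, b)\<in>cls g j. germ C (ob X i) Z (k, b \<cdot> a))"
      using a b by fast
  next
    fix x assume "x \<in> (\<Union>(j, a)\<in>cls f i. \<Union>(k, b)\<in>cls g j. germ C (ob X i) Z (k, b \<cdot> a))"
    then obtain j' a' k' b' where "(j', a') \<in> cls f i" "(k', b') \<in> cls g j'"
        "x \<in> germ C (ob X i) Z (k', b' \<cdot> a')"
      by fast
    then show "x \<in> germ C (ob X i) Z (k, b \<cdot> a)"
      using eq by metis
  qed
  finally show 1: "cls (ind_comp C g f) i = germ C (ob X i) Z (k, b \<cdot> a)" .
  show "represents (ob X i) Z (k, b \<cdot> a)"
    by (rule rep[OF a b])
  then show "(k, b \<cdot> a) \<in> cls (ind_comp C g f) i"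
    using 1 germ_refl[OF Z] by simp
qed

lemma ind_comp_closed:
  assumes f: "f \<in> ind_Hom C X Y" and g: "g \<in> ind_Hom C Y Z"
    and X: "ind_object C X" and Y: "ind_object C Y" and Z: "ind_object C Z"
  shows "ind_comp C g f \<in> ind_Hom C X Z"
proof -
  have "\<exists>j a k b. (j, a) \<in> cls f i \<and> (k, b) \<in> cls g j" if "i \<in> Ob (ix X)" for i
    using cls_nonempty[OF f X Y that] cls_nonempty[OF g Y Z] cls_mem(4)[OF f X Y] by metis
  then obtain J A K B where JA: "\<And>i. i \<in> Ob (ix X) \<Longrightarrow> (J i, A i) \<in> cls f i"
      and KB: "\<And>i. i \<in> Ob (ix X) \<Longrightarrow> (K i, B i) \<in> cls g (J i)"
    by metis
  show ?thesis
  proof (rule ind_HomI[OF X Z, where F = "\<lambda>i. (K i, B i \<cdot> A i)"])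
    show "src (ind_comp C g f) = X" "tgt (ind_comp C g f) = Z"
      using src_tgt[OF f] src_tgt[OF g] by (simp_all add: ind_comp_def)
    show "cls (ind_comp C g f) i = {}" if "i \<notin> Ob (ix X)" for i
      using f that unfolding ind_Hom_def ind_comp_def by auto
    show "represents (ob X i) Z (K i, B i \<cdot> A i) \<and> cls (ind_comp C g f) i
        = germ C (ob X i) Z (K i, B i \<cdot> A i)"
      if "i \<in> Ob (ix X)" for i
      using ind_comp_cls[OF assms JA KB] that by blast
    fix i i' u assume u: "i \<in> Ob (ix X)" "i' \<in> Ob (ix X)" "u \<in> Hom (ix X) i i'"
    have 1: "(J i', A i' \<cdot> ar X u) \<in> cls f i"
      by (rule cls_restrict[OF f JA[OF u(2)] u])
    have "(K i', B i' \<cdot> (A i' \<cdot> ar X u)) \<in> germ C (ob X i) Z (K i, B i \<cdot> A i)"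
      using ind_comp_cls(3)[OF assms 1 KB[OF u(2)]] ind_comp_cls(1)[OF assms JA[OF u(1)]
          KB[OF u(1)]]
      by simp
    moreover have "B i' \<cdot> (A i' \<cdot> ar X u) = (B i' \<cdot> A i') \<cdot> ar X u"
      using ind_objectD(5)[OF X u] cls_mem[OF f X Y JA[OF u(2)]] cls_mem[OF g Y Z KB[OF u(2)]]
          by simp
    ultimately show "(fst (K i', B i' \<cdot> A i'), snd (K i', B i' \<cdot> A i') \<cdot> ar X u)
        \<in> germ C (ob X i) Z (K i, B i \<cdot> A i)"
      by simp
  qed
qed

lemma ind_comp_assoc:
  assumes f: "f \<in> ind_Hom C W X" and g: "g \<in> ind_Hom C X Y" and h: "h \<in> ind_Hom C Y Z"
    and W: "ind_object C W" and X: "ind_object C X" and Y: "ind_object C Y" and Z: "ind_object C Z"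
  shows "ind_comp C (ind_comp C h g) f = ind_comp C h (ind_comp C g f)"
proof (rule ind_Hom_eqI[OF _ _ W Z])
  note gf = ind_comp_closed[OF f g W X Y] and hg = ind_comp_closed[OF g h X Y Z]
  show "ind_comp C (ind_comp C h g) f \<in> ind_Hom C W Z" "ind_comp C h (ind_comp C g f) \<in> ind_Hom C W
      Z"
    by (rule ind_comp_closed[OF f hg W X Z], rule ind_comp_closed[OF gf h W Y Z])
  fix i assume i: "i \<in> Ob (ix W)"
  obtain j a where a: "(j, a) \<in> cls f i" using cls_nonempty[OF f W X i] .
  note A = cls_mem[OF f W X a]
  obtain k b where b: "(k, b) \<in> cls g j" using cls_nonempty[OF g X Y A(4)] .
  note B = cls_mem[OF g X Y b]
  obtain l c where c: "(l, c) \<in> cls h k" using cls_nonempty[OF h Y Z B(4)] .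
  note D = cls_mem[OF h Y Z c]
  have "(l, (c \<cdot> b) \<cdot> a) \<in> cls (ind_comp C (ind_comp C h g) f) i"
    by (rule ind_comp_cls(3)[OF f hg W X Z a ind_comp_cls(3)[OF g h X Y Z b c]])
  moreover have "(l, c \<cdot> (b \<cdot> a)) \<in> cls (ind_comp C h (ind_comp C g f)) i"
    by (rule ind_comp_cls(3)[OF gf h W Y Z ind_comp_cls(3)[OF f g W X Y a b] c])
  moreover have "(c \<cdot> b) \<cdot> a = c \<cdot> (b \<cdot> a)"
    using A B D by simp
  ultimately show "\<exists>e. e \<in> cls (ind_comp C (ind_comp C h g) f) i \<and>
      e \<in> cls (ind_comp C h (ind_comp C g f)) i"
    by metis
qed

lemma ind_comp_Idn:
  assumes f: "f \<in> ind_Hom C X Y" and X: "ind_object C X" and Y: "ind_object C Y"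
  shows "ind_comp C f (ind_map C X X (\<lambda>i. (i, Idn C (ob X i)))) = f"
    and "ind_comp C (ind_map C Y Y (\<lambda>i. (i, Idn C (ob Y i)))) f = f"
proof -
  show "ind_comp C f (ind_map C X X (\<lambda>i. (i, Idn C (ob X i)))) = f"
  proof (rule ind_Hom_eqI[OF ind_comp_closed[OF ind_Idn(1)[OF X] f X X Y] f X Y])
    fix i assume i: "i \<in> Ob (ix X)"
    obtain j a where a: "(j, a) \<in> cls f i" using cls_nonempty[OF f X Y i] .
    then show "\<exists>e. e \<in> cls (ind_comp C f (ind_map C X X (\<lambda>i. (i, Idn C (ob X i))))) i \<and> e \<in> cls f i"
      using ind_comp_cls(3)[OF ind_Idn(1)[OF X] f X X Y ind_Idn(2)[OF X i] a] cls_mem[OF f X Y a]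
          by auto
  qed
  show "ind_comp C (ind_map C Y Y (\<lambda>i. (i, Idn C (ob Y i)))) f = f"
  proof (rule ind_Hom_eqI[OF ind_comp_closed[OF f ind_Idn(1)[OF Y] X Y Y] f X Y])
    fix i assume i: "i \<in> Ob (ix X)"
    obtain j a where a: "(j, a) \<in> cls f i" using cls_nonempty[OF f X Y i] .
    then show "\<exists>e. e \<in> cls (ind_comp C (ind_map C Y Y (\<lambda>i. (i, Idn C (ob Y i)))) f) i \<and> e \<in> cls f i"
      using ind_comp_cls(3)[OF f ind_Idn(1)[OF Y] X Y Y a ind_Idn(2)[OF Y]] cls_mem[OF f X Y a]
          by auto
  qed
qed

lemma const_simps [simp]:
  "Ob (ix (const_ind C V)) = {Star}" "Hom (ix (const_ind C V)) i j = {Star}"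
  "ob (const_ind C V) i = V" "ar (const_ind C V) u = Idn C V"
  by (simp_all add: const_ind_def)

lemma const_ind_object: "V \<in> Ob C \<Longrightarrow> ind_object C (const_ind C V)"
  unfolding ind_object_def filtered_def category_def const_ind_def by simp

text \<open>
  The colimit over a one-point diagram is trivial, so a morphism to a constant ind-object
  amounts to a compatible family of morphisms of \<open>C\<close>, and its classes are singletons.
\<close>

definition component :: "('u, 'o, 'm) ind_mor \<Rightarrow> 'u index \<Rightarrow> 'm" where
  "component f j = snd (the_elem (cls f j))"

lemma component:
  fixes Y :: "('u, 'o, 'm) ind_obj"
  assumes f: "f \<in> ind_Hom C Y (const_ind C W)" and Y: "ind_object C Y" and W: "W \<in> Ob C"
      and j: "j \<in> Ob (ix Y)"
  shows "cls f j = {(Star, component f j)}" "mor (component f j)" "source (component f j) = ob Y j"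
    "target (component f j) = W"
proof -
  have Wi: "ind_object C (const_ind C W :: ('u, 'o, 'm) ind_obj)"
    by (rule const_ind_object[OF W])
  obtain k h where kh: "(k, h) \<in> cls f j"
    using cls_nonempty[OF f Y Wi j] .
  note H = cls_mem[OF f Y Wi kh]
  have k: "k = Star" using H(4) by simp
  have "cls f j = {(Star, h)}"
  proof (intro equalityI subsetI)
    fix x assume x: "x \<in> cls f j"
    obtain k' h' where x': "x = (k', h')" by fastforce
    note H' = cls_mem[OF f Y Wi x[unfolded x']]
    have "Idn C W \<cdot> h = Idn C W \<cdot> h'"
      using cls_common[OF f Y Wi kh x[unfolded x']] by auto
    then show "x \<in> {(Star, h)}"
      using H H' x' by simp
  qed (use kh k in simp)
  moreover from this have "component f j = h"
    by (simp add: component_def)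
  ultimately show "cls f j = {(Star, component f j)}" "mor (component f j)" "source (component f j)
      = ob Y j"
    "target (component f j) = W"
    using H by simp_all
qed

lemma component_natural:
  fixes Y :: "('u, 'o, 'm) ind_obj"
  assumes f: "f \<in> ind_Hom C Y (const_ind C W)" and Y: "ind_object C Y" and W: "W \<in> Ob C"
    and u: "i \<in> Ob (ix Y)" "j \<in> Ob (ix Y)" "u \<in> Hom (ix Y) i j"
  shows "component f j \<cdot> ar Y u = component f i"
  using cls_restrict[OF f _ u, of Star "component f j"] component(1)[OF f Y W u(1)]
      component(1)[OF f Y W u(2)]
  by simp

lemma component_comp:
  fixes X Y :: "('u, 'o, 'm) ind_obj"
  assumes f: "f \<in> ind_Hom C X Y" and g: "g \<in> ind_Hom C Y (const_ind C W)"
    and X: "ind_object C X" and Y: "ind_object C Y" and W: "W \<in> Ob C" and a: "(j, a) \<in> cls f i"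
  shows "component (ind_comp C g f) i = component g j \<cdot> a"
proof -
  have Wi: "ind_object C (const_ind C W :: ('u, 'o, 'm) ind_obj)"
    by (rule const_ind_object[OF W])
  note A = cls_mem[OF f X Y a]
  have "(Star, component g j) \<in> cls g j"
    using component(1)[OF g Y W A(4)] by simp
  from ind_comp_cls(3)[OF f g X Y Wi a this]
  show ?thesis
    using component(1)[OF ind_comp_closed[OF f g X Y Wi] X W A(1)] by simp
qed

lemma component_eqI:
  fixes Y :: "('u, 'o, 'm) ind_obj"
  assumes f: "f \<in> ind_Hom C Y (const_ind C W)" and g: "g \<in> ind_Hom C Y (const_ind C W)"
    and Y: "ind_object C Y" and W: "W \<in> Ob C" and eq: "\<And>j. j \<in> Ob (ix Y) \<Longrightarrow> component f j
        = component g j"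
  shows "f = g"
proof (rule ind_Hom_eqI[OF f g Y const_ind_object[OF W]])
  fix i assume "i \<in> Ob (ix Y)"
  then show "\<exists>e. e \<in> cls f i \<and> e \<in> cls g i"
    using component(1)[OF f Y W] component(1)[OF g Y W] eq by auto
qed

lemma to_const:
  fixes Y :: "('u, 'o, 'm) ind_obj"
  assumes Y: "ind_object C Y" and W: "W \<in> Ob C"
    and h: "\<And>j. j \<in> Ob (ix Y) \<Longrightarrow> mor (h j) \<and> source (h j) = ob Y j \<and> target (h j) = W"
    and nat: "\<And>i j u. \<lbrakk>i \<in> Ob (ix Y); j \<in> Ob (ix Y); u \<in> Hom (ix Y) i j\<rbrakk> \<Longrightarrow> h j \<cdot> ar Y u = h i"
  obtains f where "f \<in> ind_Hom C Y (const_ind C W)" "\<And>j. j \<in> Ob (ix Y) \<Longrightarrow> component f j = h j"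
proof -
  have Wi: "ind_object C (const_ind C W :: ('u, 'o, 'm) ind_obj)"
    by (rule const_ind_object[OF W])
  let ?F = "\<lambda>j. (Star :: 'u index, h j)"
  have r: "represents (ob Y j) (const_ind C W :: ('u, 'o, 'm) ind_obj) (?F j)" if "j \<in> Ob (ix Y)"
      for j
    using h[OF that] by (simp add: represents_def)
  have n: "(fst (?F j), snd (?F j) \<cdot> ar Y u) \<in> germ C (ob Y i) (const_ind C W) (?F i)"
    if "i \<in> Ob (ix Y)" "j \<in> Ob (ix Y)" "u \<in> Hom (ix Y) i j" for i j u
    using nat[OF that] germ_refl[OF Wi r[OF that(1)]] by simp
  have m: "ind_map C Y (const_ind C W) ?F \<in> ind_Hom C Y (const_ind C W)"
    by (rule ind_map_Hom(1)[OF Y Wi r n])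
  have "component (ind_map C Y (const_ind C W) ?F) j = h j" if j: "j \<in> Ob (ix Y)" for j
  proof -
    have "?F j \<in> cls (ind_map C Y (const_ind C W) ?F) j"
      by (rule ind_map_Hom(2)[OF Y Wi r n j])
    then show ?thesis
      using component(1)[OF m Y W j] by simp
  qed
  then show ?thesis
    using that m by blast
qed

lemma from_const:
  fixes Y :: "('u, 'o, 'm) ind_obj"
  assumes Y: "ind_object C Y" and e: "represents V Y (j, h)"
  obtains f where "f \<in> ind_Hom C (const_ind C V) Y" "(j, h) \<in> cls f Star"
proof -
  have V: "V \<in> Ob C"
    using e by (auto simp: represents_def)
  let ?V = "const_ind C V :: ('u, 'o, 'm) ind_obj"
  have Vi: "ind_object C ?V"
    by (rule const_ind_object[OF V])
  have r: "represents (ob ?V i) Y (j, h)" if "i \<in> Ob (ix ?V)" for i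
    using e by simp
  have n: "(fst (j, h), snd (j, h) \<cdot> ar ?V u) \<in> germ C (ob ?V i) Y (j, h)" for u i
    using germ_refl[OF Y e] e by (simp add: represents_def)
  note m = ind_map_Hom[OF Vi Y, of "\<lambda>_. (j, h)", OF r n]
  have "(j, h) \<in> cls (ind_map C ?V Y (\<lambda>_. (j, h))) Star"
    by (rule m(2)) simp_all
  then show ?thesis
    using that m(1) by simp
qed

end

section \<open>Tensor products of ind-objects\<close>

context monoidal_category
begin

lemma ind_tensor_simps [simp]:
  "Ob (ix (ind_tensor C X Y)) = {Pair i j | i j. i \<in> Ob (ix X) \<and> j \<in> Ob (ix Y)}"
  "ob (ind_tensor C X Y) (Pair i j) = ob X i \<boxtimes> ob Y j"
  "ar (ind_tensor C X Y) (Pair u v) = ar X u \<star> ar Y v"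
  "Hom (ix (ind_tensor C X Y)) (Pair i j) (Pair i' j')
    = {Pair u v | u v. u \<in> Hom (ix X) i i' \<and> v \<in> Hom (ix Y) j j'}"
  "Idn (ix (ind_tensor C X Y)) (Pair i j) = Pair (Idn (ix X) i) (Idn (ix Y) j)"
  "Comp (ix (ind_tensor C X Y)) (Pair u v) (Pair u' v') = Pair (u \<cdot>\<^bsub>ix X\<^esub> u') (v \<cdot>\<^bsub>ix Y\<^esub> v')"
  by (simp_all add: ind_tensor_def prod_cat_def)

lemma ind_tensor_object:
  assumes X: "ind_object C X" and Y: "ind_object C Y"
  shows "ind_object C (ind_tensor C X Y)"
proof -
  interpret I: category "ix X" by (rule ind_objectD(1)[OF X])
  interpret J: category "ix Y" by (rule ind_objectD(1)[OF Y])
  let ?T = "ind_tensor C X Y"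
  have "category (ix ?T)"
  proof
    show "Idn (ix ?T) p \<in> Hom (ix ?T) p p" if "p \<in> Ob (ix ?T)" for p
      using that I.Idn_closed J.Idn_closed by (auto simp del: I.Hom_iff J.Hom_iff)
    show "p = p' \<and> q = q'" if "p \<in> Ob (ix ?T)" "q \<in> Ob (ix ?T)" "p' \<in> Ob (ix ?T)" "q' \<in> Ob (ix ?T)"
        "f \<in> Hom (ix ?T) p q" "f \<in> Hom (ix ?T) p' q'" for p q p' q' f
      using that by auto
    show "g \<cdot>\<^bsub>ix ?T\<^esub> f \<in> Hom (ix ?T) p r" if "p \<in> Ob (ix ?T)" "q \<in> Ob (ix ?T)" "r \<in> Ob (ix ?T)"
        "f \<in> Hom (ix ?T) p q" "g \<in> Hom (ix ?T) q r" for p q r f g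
      using that by auto
    show "f \<cdot>\<^bsub>ix ?T\<^esub> Idn (ix ?T) p = f" if "p \<in> Ob (ix ?T)" "q \<in> Ob (ix ?T)" "f \<in> Hom (ix ?T) p q"
        for p q f
      using that by auto
    show "Idn (ix ?T) q \<cdot>\<^bsub>ix ?T\<^esub> f = f" if "p \<in> Ob (ix ?T)" "q \<in> Ob (ix ?T)" "f \<in> Hom (ix ?T) p q"
        for p q f
      using that by auto
    show "(h \<cdot>\<^bsub>ix ?T\<^esub> g) \<cdot>\<^bsub>ix ?T\<^esub> f = h \<cdot>\<^bsub>ix ?T\<^esub> (g \<cdot>\<^bsub>ix ?T\<^esub> f)"
      if "p \<in> Ob (ix ?T)" "q \<in> Ob (ix ?T)" "r \<in> Ob (ix ?T)" "s \<in> Ob (ix ?T)"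
        "f \<in> Hom (ix ?T) p q" "g \<in> Hom (ix ?T) q r" "h \<in> Hom (ix ?T) r s" for p q r s f g h
      using that by auto
  qed
  moreover have "filtered (ix ?T)"
    unfolding filtered_def
  proof (intro conjI ballI)
    show "Ob (ix ?T) \<noteq> {}"
      using ind_objectD(2)[OF X] ind_objectD(2)[OF Y] unfolding filtered_def by auto
    show "\<exists>r\<in>Ob (ix ?T). Hom (ix ?T) p r \<noteq> {} \<and> Hom (ix ?T) q r \<noteq> {}"
      if pq: "p \<in> Ob (ix ?T)" "q \<in> Ob (ix ?T)" for p q
    proof -
      obtain i j i' j' where p: "p = Pair i j" "q = Pair i' j'" "i \<in> Ob (ix X)" "i' \<in> Ob (ix X)"
          "j \<in> Ob (ix Y)" "j' \<in> Ob (ix Y)"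
        using pq by auto
      obtain k u v where k: "k \<in> Ob (ix X)" "u \<in> Hom (ix X) i k" "v \<in> Hom (ix X) i' k"
        using ind_join[OF X p(3,4)] .
      obtain l w z where l: "l \<in> Ob (ix Y)" "w \<in> Hom (ix Y) j l" "z \<in> Hom (ix Y) j' l"
        using ind_join[OF Y p(5,6)] .
      have "Pair u w \<in> Hom (ix ?T) p (Pair k l)" "Pair v z \<in> Hom (ix ?T) q (Pair k l)"
          "Pair k l \<in> Ob (ix ?T)"
        using p k l by (auto simp del: I.Hom_iff J.Hom_iff)
      then show ?thesis by blast
    qed
    show "\<exists>r\<in>Ob (ix ?T). \<exists>w\<in>Hom (ix ?T) q r. w \<cdot>\<^bsub>ix ?T\<^esub> u = w \<cdot>\<^bsub>ix ?T\<^esub> v"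
      if pq: "p \<in> Ob (ix ?T)" "q \<in> Ob (ix ?T)" "u \<in> Hom (ix ?T) p q" "v \<in> Hom (ix ?T) p q"
          for p q u v
    proof -
      obtain i j i' j' where p: "p = Pair i j" "q = Pair i' j'" "i \<in> Ob (ix X)" "i' \<in> Ob (ix X)"
          "j \<in> Ob (ix Y)" "j' \<in> Ob (ix Y)"
        using pq(1,2) by auto
      obtain u1 u2 v1 v2 where u: "u = Pair u1 u2" "v = Pair v1 v2" "u1 \<in> Hom (ix X) i i'"
          "v1 \<in> Hom (ix X) i i'"
          "u2 \<in> Hom (ix Y) j j'" "v2 \<in> Hom (ix Y) j j'"
        using pq(3,4) unfolding p(1,2) by (auto simp del: I.Hom_iff J.Hom_iff)
      obtain k w where k: "k \<in> Ob (ix X)" "w \<in> Hom (ix X) i' k" "w \<cdot>\<^bsub>ix X\<^esub> u1 = w \<cdot>\<^bsub>ix X\<^esub> v1"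
        using ind_objectD(2)[OF X] p(3,4) u(3,4) unfolding filtered_def by blast
      obtain l z where l: "l \<in> Ob (ix Y)" "z \<in> Hom (ix Y) j' l" "z \<cdot>\<^bsub>ix Y\<^esub> u2 = z \<cdot>\<^bsub>ix Y\<^esub> v2"
        using ind_objectD(2)[OF Y] p(5,6) u(5,6) unfolding filtered_def by blast
      show ?thesis
        using p u k l by (intro bexI[of _ "Pair k l"] bexI[of _
            "Pair w z"]) (auto simp del: I.Hom_iff J.Hom_iff)
    qed
  qed
  moreover have "ob ?T p \<in> Ob C \<and> ar ?T (Idn (ix ?T) p) = Idn C (ob ?T p)" if "p \<in> Ob (ix ?T)" for p
    using that ind_objectD(3,4)[OF X] ind_objectD(3,4)[OF Y] by auto
  moreover have "ar ?T u \<in> Hom C (ob ?T p) (ob ?T q)"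
    if pq: "p \<in> Ob (ix ?T)" "q \<in> Ob (ix ?T)" "u \<in> Hom (ix ?T) p q" for p q u
  proof -
    obtain i j i' j' where p: "p = Pair i j" "q = Pair i' j'" "i \<in> Ob (ix X)" "i' \<in> Ob (ix X)"
        "j \<in> Ob (ix Y)" "j' \<in> Ob (ix Y)"
      using pq(1,2) by auto
    obtain u1 u2 where u: "u = Pair u1 u2" "u1 \<in> Hom (ix X) i i'" "u2 \<in> Hom (ix Y) j j'"
      using pq(3) unfolding p(1,2) by (auto simp del: I.Hom_iff J.Hom_iff)
    show ?thesis
      using ind_objectD(5)[OF X p(3,4) u(2)] ind_objectD(5)[OF Y p(5,6) u(3)]
        ind_objectD(3)[OF X] ind_objectD(3)[OF Y] p u(1) by simp
  qed
  moreover have "ar ?T (v \<cdot>\<^bsub>ix ?T\<^esub> u) = ar ?T v \<cdot> ar ?T u"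
    if pq: "p \<in> Ob (ix ?T)" "q \<in> Ob (ix ?T)" "r \<in> Ob (ix ?T)" "u \<in> Hom (ix ?T) p q"
        "v \<in> Hom (ix ?T) q r" for p q r u v
  proof -
    obtain i j i' j' k l where p: "p = Pair i j" "q = Pair i' j'" "r = Pair k l" "i \<in> Ob (ix X)"
        "i' \<in> Ob (ix X)"
        "j \<in> Ob (ix Y)" "j' \<in> Ob (ix Y)" "k \<in> Ob (ix X)" "l \<in> Ob (ix Y)"
      using pq(1-3) by auto
    obtain u1 u2 where u: "u = Pair u1 u2" "u1 \<in> Hom (ix X) i i'" "u2 \<in> Hom (ix Y) j j'"
      using pq(4) unfolding p(1,2) by (auto simp del: I.Hom_iff J.Hom_iff)
    obtain v1 v2 where v: "v = Pair v1 v2" "v1 \<in> Hom (ix X) i' k" "v2 \<in> Hom (ix Y) j' l"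
      using pq(5) unfolding p(2,3) by (auto simp del: I.Hom_iff J.Hom_iff)
    show ?thesis
      using ind_objectD(5)[OF X p(4,5) u(2)] ind_objectD(5)[OF Y p(6,7) u(3)]
        ind_objectD(5)[OF X p(5,8) v(2)] ind_objectD(5)[OF Y p(7,9) v(3)]
        ind_objectD(6)[OF X p(4,5,8) u(2) v(2)] ind_objectD(6)[OF Y p(6,7,9) u(3) v(3)] u(1) v(1)
      by (simp add: interchange)
  qed
  ultimately show ?thesis
    unfolding ind_object_def by blast
qed

lemma ind_tensor_mor_cls:
  assumes f: "f \<in> ind_Hom C X X'" and g: "g \<in> ind_Hom C Y Y'"
    and X: "ind_object C X" and X': "ind_object C X'" and Y: "ind_object C Y"
        and Y': "ind_object C Y'"
    and a: "(i', a) \<in> cls f i" and b: "(j', b) \<in> cls g j"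
  shows "cls (ind_tensor_mor C f g) (Pair i j) = germ C (ob X i \<boxtimes> ob Y j) (ind_tensor C X' Y') (Pair
      i' j', a \<star> b)"
    and "represents (ob X i \<boxtimes> ob Y j) (ind_tensor C X' Y') (Pair i' j', a \<star> b)"
    and "(Pair i' j', a \<star> b) \<in> cls (ind_tensor_mor C f g) (Pair i j)"
proof -
  let ?T = "ind_tensor C X' Y'" and ?V = "ob X i \<boxtimes> ob Y j"
  note T = ind_tensor_object[OF X' Y']
  have rep: "represents ?V ?T (Pair i' j', a \<star> b)" if "(i', a) \<in> cls f i" "(j', b) \<in> cls g j"
      for i' j' a b
    using cls_mem[OF f X X' that(1)] cls_mem[OF g Y Y' that(2)] by (simp add: represents_def)
  have eq: "germ C ?V ?T (Pair i2 j2, a2 \<star> b2) = germ C ?V ?T (Pair i' j', a \<star> b)"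
    if a2: "(i2, a2) \<in> cls f i" and b2: "(j2, b2) \<in> cls g j" for i2 a2 j2 b2
  proof -
    obtain k u v where k: "k \<in> Ob (ix X')" "u \<in> Hom (ix X') i' k" "v \<in> Hom (ix X') i2 k"
        "ar X' u \<cdot> a = ar X' v \<cdot> a2"
      using cls_common[OF f X X' a a2] .
    obtain l w z where l: "l \<in> Ob (ix Y')" "w \<in> Hom (ix Y') j' l" "z \<in> Hom (ix Y') j2 l"
        "ar Y' w \<cdot> b = ar Y' z \<cdot> b2"
      using cls_common[OF g Y Y' b b2] .
    note A = cls_mem[OF f X X' a] and A2 = cls_mem[OF f X X' a2]
      and B = cls_mem[OF g Y Y' b] and B2 = cls_mem[OF g Y Y' b2]
    have "ar ?T (Pair u w) \<cdot> (a \<star> b) = ar ?T (Pair v z) \<cdot> (a2 \<star> b2)"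
      using A B A2 B2 k(4) l(4) ind_objectD(5)[OF X' A(4) k(1,2)] ind_objectD(5)[OF X' A2(4) k(1,3)]
        ind_objectD(5)[OF Y' B(4) l(1,2)] ind_objectD(5)[OF Y' B2(4) l(1,3)]
      by (simp add: interchange)
    moreover have "Pair k l \<in> Ob (ix ?T)" "Pair u w \<in> Hom (ix ?T) (Pair i' j') (Pair k l)"
      "Pair v z \<in> Hom (ix ?T) (Pair i2 j2) (Pair k l)"
      using k(1-3) l(1-3) by auto
    ultimately have "(Pair i2 j2, a2 \<star> b2) \<in> germ C ?V ?T (Pair i' j', a \<star> b)"
      using germ_iff[OF T rep[OF a b]] rep[OF a2 b2] by blast
    then show ?thesis
      by (rule germ_cong[OF T rep[OF a b]])
  qed
  have "cls (ind_tensor_mor C f g) (Pair i j)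
      = (\<Union>(i2, a2)\<in>cls f i. \<Union>(j2, b2)\<in>cls g j. germ C ?V ?T (Pair i2 j2, a2 \<star> b2))"
    unfolding ind_tensor_mor_def Let_def
    using src_tgt[OF f] src_tgt[OF g] cls_mem(1)[OF f X X' a] cls_mem(1)[OF g Y Y' b] by simp
  also have "\<dots> = germ C ?V ?T (Pair i' j', a \<star> b)"
  proof (intro equalityI subsetI)
    fix x assume "x \<in> germ C ?V ?T (Pair i' j', a \<star> b)"
    then show "x \<in> (\<Union>(i2, a2)\<in>cls f i. \<Union>(j2, b2)\<in>cls g j. germ C ?V ?T (Pair i2 j2, a2 \<star> b2))"
      using a b by fast
  next
    fix x assume "x \<in> (\<Union>(i2, a2)\<in>cls f i. \<Union>(j2, b2)\<in>cls g j. germ C ?V ?T (Pair i2 j2, a2 \<star> b2))"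
    then obtain i2 a2 j2 b2 where "(i2, a2) \<in> cls f i" "(j2, b2) \<in> cls g j"
        "x \<in> germ C ?V ?T (Pair i2 j2, a2 \<star> b2)"
      by fast
    then show "x \<in> germ C ?V ?T (Pair i' j', a \<star> b)"
      using eq by metis
  qed
  finally show 1: "cls (ind_tensor_mor C f g) (Pair i j) = germ C ?V ?T (Pair i' j', a \<star> b)" .
  show "represents ?V ?T (Pair i' j', a \<star> b)"
    by (rule rep[OF a b])
  then show "(Pair i' j', a \<star> b) \<in> cls (ind_tensor_mor C f g) (Pair i j)"
    using 1 germ_refl[OF T] by simp
qed

lemma ind_tensor_mor_closed:
  assumes f: "f \<in> ind_Hom C X X'" and g: "g \<in> ind_Hom C Y Y'"
    and X: "ind_object C X" and X': "ind_object C X'" and Y: "ind_object C Y"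
        and Y': "ind_object C Y'"
  shows "ind_tensor_mor C f g \<in> ind_Hom C (ind_tensor C X Y) (ind_tensor C X' Y')"
proof -
  let ?S = "ind_tensor C X Y" and ?T = "ind_tensor C X' Y'"
  have "\<forall>i\<in>Ob (ix X). \<exists>i' a. (i', a) \<in> cls f i"
    using cls_nonempty[OF f X X'] by metis
  then obtain I A where IA: "\<And>i. i \<in> Ob (ix X) \<Longrightarrow> (I i, A i) \<in> cls f i"
    by metis
  have "\<forall>j\<in>Ob (ix Y). \<exists>j' b. (j', b) \<in> cls g j"
    using cls_nonempty[OF g Y Y'] by metis
  then obtain J B where JB: "\<And>j. j \<in> Ob (ix Y) \<Longrightarrow> (J j, B j) \<in> cls g j"
    by metis
  let ?F = "\<lambda>p. (Pair (I (left p)) (J (right p)), A (left p) \<star> B (right p))"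
  show ?thesis
  proof (rule ind_HomI[OF ind_tensor_object[OF X Y] ind_tensor_object[OF X' Y'], where F = ?F])
    show "src (ind_tensor_mor C f g) = ?S" "tgt (ind_tensor_mor C f g) = ?T"
      using src_tgt[OF f] src_tgt[OF g] by (simp_all add: ind_tensor_mor_def Let_def)
    show "cls (ind_tensor_mor C f g) p = {}" if "p \<notin> Ob (ix ?S)" for p
      using that src_tgt[OF f] src_tgt[OF g]
          by (simp add: ind_tensor_mor_def Let_def del: ind_tensor_simps)
    show "represents (ob ?S p) ?T (?F p) \<and> cls (ind_tensor_mor C f g) p
        = germ C (ob ?S p) ?T (?F p)"
      if p: "p \<in> Ob (ix ?S)" for p
    proof -
      obtain i j where ij: "p = Pair i j" "i \<in> Ob (ix X)" "j \<in> Ob (ix Y)" using p by auto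
      show ?thesis
        using ind_tensor_mor_cls(1,2)[OF assms IA[OF ij(2)] JB[OF ij(3)]] ij(1) by simp
    qed
    fix p p' w assume pw: "p \<in> Ob (ix ?S)" "p' \<in> Ob (ix ?S)" "w \<in> Hom (ix ?S) p p'"
    obtain i j i' j' where p: "p = Pair i j" "p' = Pair i' j'" "i \<in> Ob (ix X)" "i' \<in> Ob (ix X)"
        "j \<in> Ob (ix Y)" "j' \<in> Ob (ix Y)"
      using pw(1,2) by auto
    obtain u v where w: "w = Pair u v" "u \<in> Hom (ix X) i i'" "v \<in> Hom (ix Y) j j'"
      using pw(3) unfolding p(1,2) by auto
    note a = cls_restrict[OF f IA[OF p(4)] p(3,4) w(2)]
        and b = cls_restrict[OF g JB[OF p(6)] p(5,6) w(3)]
    have "(A i' \<star> B j') \<cdot> (ar X u \<star> ar Y v) = (A i' \<cdot> ar X u) \<star> (B j' \<cdot> ar Y v)"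
      using cls_mem[OF f X X' IA[OF p(4)]] cls_mem[OF g Y Y' JB[OF p(6)]]
        ind_objectD(5)[OF X p(3,4) w(2)] ind_objectD(5)[OF Y p(5,6) w(3)]
      by (simp add: interchange)
    then show "(fst (?F p'), snd (?F p') \<cdot> ar ?S w) \<in> germ C (ob ?S p) ?T (?F p)"
      using ind_tensor_mor_cls(3)[OF assms a b] ind_tensor_mor_cls(1)[OF assms IA[OF p(3)]
          JB[OF p(5)]]
        p(1,2) w(1) by simp
  qed
qed

lemma ind_tensor_mor_comp:
  assumes f: "f \<in> ind_Hom C X X'" and f': "f' \<in> ind_Hom C X' X''" and g: "g \<in> ind_Hom C Y Y'"
      and g': "g' \<in> ind_Hom C Y' Y''"
    and X: "ind_object C X" and X': "ind_object C X'" and X'': "ind_object C X''"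
    and Y: "ind_object C Y" and Y': "ind_object C Y'" and Y'': "ind_object C Y''"
  shows "ind_tensor_mor C (ind_comp C f' f) (ind_comp C g' g)
    = ind_comp C (ind_tensor_mor C f' g') (ind_tensor_mor C f g)"
proof -
  note ff = ind_comp_closed[OF f f' X X' X''] and gg = ind_comp_closed[OF g g' Y Y' Y'']
  note S = ind_tensor_object[OF X Y] and S' = ind_tensor_object[OF X' Y']
      and S'' = ind_tensor_object[OF X'' Y'']
  note t = ind_tensor_mor_closed[OF f g X X' Y Y']
      and t' = ind_tensor_mor_closed[OF f' g' X' X'' Y' Y'']
  show ?thesis
  proof (rule ind_Hom_eqI[OF ind_tensor_mor_closed[OF ff gg X X'' Y Y''] ind_comp_closed[OF t t' S
      S' S''] S S''])
    fix p assume "p \<in> Ob (ix (ind_tensor C X Y))"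
    then obtain i j where p: "p = Pair i j" "i \<in> Ob (ix X)" "j \<in> Ob (ix Y)" by auto
    obtain i' a where a: "(i', a) \<in> cls f i" using cls_nonempty[OF f X X' p(2)] .
    note A = cls_mem[OF f X X' a]
    obtain i'' a' where a': "(i'', a') \<in> cls f' i'" using cls_nonempty[OF f' X' X'' A(4)] .
    note A' = cls_mem[OF f' X' X'' a']
    obtain j' b where b: "(j', b) \<in> cls g j" using cls_nonempty[OF g Y Y' p(3)] .
    note B = cls_mem[OF g Y Y' b]
    obtain j'' b' where b': "(j'', b') \<in> cls g' j'" using cls_nonempty[OF g' Y' Y'' B(4)] .
    note B' = cls_mem[OF g' Y' Y'' b']
    have "(Pair i'' j'', (a' \<cdot> a) \<star> (b' \<cdot> b)) \<in> cls (ind_tensor_mor C (ind_comp C f' f) (ind_comp C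
        g' g)) p"
      unfolding p(1)
      by (rule ind_tensor_mor_cls(3)[OF ff gg X X'' Y Y'' ind_comp_cls(3)[OF f f' X X' X'' a a']
          ind_comp_cls(3)[OF g g' Y Y' Y'' b b']])
    moreover have "(Pair i'' j'', (a' \<star> b') \<cdot> (a \<star> b)) \<in> cls (ind_comp C (ind_tensor_mor C f' g')
        (ind_tensor_mor C f g)) p"
      unfolding p(1)
      by (rule ind_comp_cls(3)[OF t t' S S' S'' ind_tensor_mor_cls(3)[OF f g X X' Y Y' a b]
          ind_tensor_mor_cls(3)[OF f' g' X' X'' Y' Y'' a' b']])
    moreover have "(a' \<star> b') \<cdot> (a \<star> b) = (a' \<cdot> a) \<star> (b' \<cdot> b)"
      using A A' B B' by (simp add: interchange)
    ultimately show "\<exists>e. e \<in> cls (ind_tensor_mor C (ind_comp C f' f) (ind_comp C g' g)) p \<and>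
        e \<in> cls (ind_comp C (ind_tensor_mor C f' g') (ind_tensor_mor C f g)) p"
      by metis
  qed
qed

lemma ind_tensor_mor_Idn:
  assumes X: "ind_object C X" and Y: "ind_object C Y"
  shows "ind_tensor_mor C (ind_map C X X (\<lambda>i. (i, Idn C (ob X i)))) (ind_map C Y Y (\<lambda>i. (i, Idn C
      (ob Y i))))
    = ind_map C (ind_tensor C X Y) (ind_tensor C X Y) (\<lambda>i. (i, Idn C (ob (ind_tensor C X Y) i)))"
proof -
  note S = ind_tensor_object[OF X Y]
  show ?thesis
  proof (rule ind_Hom_eqI[OF ind_tensor_mor_closed[OF ind_Idn(1)[OF X] ind_Idn(1)[OF Y] X X Y Y]
      ind_Idn(1)[OF S] S S])
    fix p assume p: "p \<in> Ob (ix (ind_tensor C X Y))"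
    then obtain i j where ij: "p = Pair i j" "i \<in> Ob (ix X)" "j \<in> Ob (ix Y)" by auto
    show "\<exists>e. e \<in> cls (ind_tensor_mor C (ind_map C X X (\<lambda>i. (i, Idn C (ob X i)))) (ind_map C Y Y
        (\<lambda>i. (i, Idn C (ob Y i))))) p \<and>
      e \<in> cls (ind_map C (ind_tensor C X Y) (ind_tensor C X Y) (\<lambda>i. (i, Idn C (ob (ind_tensor C X Y)
          i)))) p"
      using ind_tensor_mor_cls(3)[OF ind_Idn(1)[OF X] ind_Idn(1)[OF Y] X X Y Y ind_Idn(2)[OF X
          ij(2)] ind_Idn(2)[OF Y ij(3)]]
        ind_Idn(2)[OF S p] ind_objectD(3)[OF X ij(2)] ind_objectD(3)[OF Y ij(3)] ij by auto
  qed
qed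

end

section \<open>Coproducts as filtered colimits of finite sums\<close>

text \<open>
  The type of indices is closed under pairing, hence has room for finite lists of its elements.
\<close>

fun encode_list :: "'u index list \<Rightarrow> 'u index" where
  "encode_list [] = Star"
| "encode_list (x # xs) = Pair x (encode_list xs)"

lemma encode_list_inj: "encode_list xs = encode_list ys \<Longrightarrow> xs = ys"
proof (induction xs arbitrary: ys)
  case Nil
  then show ?case by (cases ys) simp_all
next
  case (Cons x xs)
  then show ?case by (cases ys) simp_all
qed

lemma ex_code_finite_subsets:
  fixes e :: "'i \<Rightarrow> 'u index"
  assumes "inj_on e I"
  obtains code :: "'i set \<Rightarrow> 'u index" where "inj_on code {F. finite F \<and> F \<subseteq> I}"
proof
  define enum where "enum F = (SOME xs. set xs = F)" for F :: "'i set"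
  have enum: "set (enum F) = F" if "finite F" for F
    unfolding enum_def using finite_list[OF that] by (rule someI_ex)
  show "inj_on (\<lambda>F. encode_list (map e (enum F))) {F. finite F \<and> F \<subseteq> I}"
  proof (rule inj_onI)
    fix F G assume F: "F \<in> {F. finite F \<and> F \<subseteq> I}" and G: "G \<in> {F. finite F \<and> F \<subseteq> I}"
      and "encode_list (map e (enum F)) = encode_list (map e (enum G))"
    then have "map e (enum F) = map e (enum G)"
      using encode_list_inj by blast
    then have "e ` set (enum F) = e ` set (enum G)"
      by (metis set_map)
    then have "e ` F = e ` G"
      using enum F G by simp
    then show "F = G"
      using inj_on_image_eq_iff[OF assms] F G by blast
  qed
qed

text \<open>
  The coproduct of a family as a filtered diagram: its objects \<open>S F\<close> are the sums over the
  finite subsets \<open>F\<close> of \<open>I\<close>, its arrows the inclusions \<open>tr F G\<close> for \<open>F \<subseteq> G\<close>. Finite subsets have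
  to be encoded as indices, and an arrow is encoded as the pair of its endpoints to keep
  hom-sets disjoint.
\<close>

definition sum_diagram ::
    "'i set \<Rightarrow> ('i set \<Rightarrow> 'u index) \<Rightarrow> ('i set \<Rightarrow> 'o) \<Rightarrow> ('i set \<Rightarrow> 'i set \<Rightarrow> 'm) \<Rightarrow>
     ('u, 'o, 'm) ind_obj" where
  "sum_diagram I code S tr =
     (let dec = inv_into {F. finite F \<and> F \<subseteq> I} code in
      \<lparr>ix = \<lparr>Ob = code ` {F. finite F \<and> F \<subseteq> I},
             Hom = (\<lambda>i j. if dec i \<subseteq> dec j then {Pair i j} else {}),
             Idn = (\<lambda>i. Pair i i), Comp = (\<lambda>v u. Pair (left u) (right v))\<rparr>,
       ob = (\<lambda>i. S (dec i)), ar = (\<lambda>u. tr (dec (left u)) (dec (right u)))\<rparr>)"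

lemma (in category) sum_diagram_object:
  assumes inj: "inj_on code {F. finite F \<and> F \<subseteq> I}"
    and S: "\<And>F. \<lbrakk>finite F; F \<subseteq> I\<rbrakk> \<Longrightarrow> S F \<in> Ob C"
    and tr: "\<And>F G. \<lbrakk>finite G; G \<subseteq> I; F \<subseteq> G\<rbrakk> \<Longrightarrow> tr F G \<in> Hom C (S F) (S G)"
    and tr_Idn: "\<And>F. \<lbrakk>finite F; F \<subseteq> I\<rbrakk> \<Longrightarrow> tr F F = Idn C (S F)"
    and tr_Comp: "\<And>F G H. \<lbrakk>finite H; H \<subseteq> I; F \<subseteq> G; G \<subseteq> H\<rbrakk> \<Longrightarrow> tr F H = tr G H \<cdot> tr F G"
  shows "ind_object C (sum_diagram I code S tr)"
proof -
  let ?Fin = "{F. finite F \<and> F \<subseteq> I}" and ?B = "sum_diagram I code S tr"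
  let ?dec = "inv_into ?Fin code"
  have dec: "?dec i \<in> ?Fin" if "i \<in> code ` ?Fin" for i
    using that by (rule inv_into_into)
  have dec_code: "?dec (code F) = F" if "F \<in> ?Fin" for F
    using inv_into_f_f[OF inj that] .
  have B: "Ob (ix ?B) = code ` ?Fin" "Hom (ix ?B) i j = (if ?dec i \<subseteq> ?dec j then {Pair i j} else
      {})"
    "Idn (ix ?B) i = Pair i i" "v \<cdot>\<^bsub>ix ?B\<^esub> u = Pair (left u) (right v)"
    "ob ?B i = S (?dec i)" "ar ?B u = tr (?dec (left u)) (?dec (right u))" for i j u v
    by (simp_all add: sum_diagram_def Let_def)
  have "category (ix ?B)"
    by unfold_locales (unfold B, auto split: if_splits)
  moreover have "filtered (ix ?B)"
    unfolding filtered_def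
  proof (intro conjI ballI)
    show "Ob (ix ?B) \<noteq> {}"
      unfolding B by blast
    show "\<exists>k\<in>Ob (ix ?B). Hom (ix ?B) i k \<noteq> {} \<and> Hom (ix ?B) j k \<noteq> {}"
      if ij: "i \<in> Ob (ix ?B)" "j \<in> Ob (ix ?B)" for i j
    proof -
      have un: "?dec i \<union> ?dec j \<in> ?Fin"
        using dec ij unfolding B by blast
      show ?thesis
        unfolding B using dec_code[OF un] un by (intro bexI[of _ "code (?dec i \<union> ?dec j)"]) auto
    qed
    show "\<exists>k\<in>Ob (ix ?B). \<exists>w\<in>Hom (ix ?B) j k. w \<cdot>\<^bsub>ix ?B\<^esub> u = w \<cdot>\<^bsub>ix ?B\<^esub> v"
      if "i \<in> Ob (ix ?B)" "j \<in> Ob (ix ?B)" "u \<in> Hom (ix ?B) i j" "v \<in> Hom (ix ?B) i j" for i j u v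
      using that unfolding B by (intro bexI[of _ j] bexI[of _ "Pair j j"]) (auto split: if_splits)
  qed
  moreover have "ob ?B i \<in> Ob C \<and> ar ?B (Idn (ix ?B) i) = Idn C (ob ?B i)" if "i \<in> Ob (ix ?B)" for i
    using dec[of i] that S tr_Idn unfolding B by simp
  moreover have "ar ?B u \<in> Hom C (ob ?B i) (ob ?B j)"
    if "i \<in> Ob (ix ?B)" "j \<in> Ob (ix ?B)" "u \<in> Hom (ix ?B) i j" for i j u
    using dec[of j] that tr unfolding B by (auto split: if_splits simp del: Hom_iff)
  moreover have "ar ?B (v \<cdot>\<^bsub>ix ?B\<^esub> u) = ar ?B v \<cdot> ar ?B u"
    if "i \<in> Ob (ix ?B)" "j \<in> Ob (ix ?B)" "k \<in> Ob (ix ?B)" "u \<in> Hom (ix ?B) i j"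
        "v \<in> Hom (ix ?B) j k"
    for i j k u v
  proof -
    have uv: "u = Pair i j" "v = Pair j k" "?dec i \<subseteq> ?dec j" "?dec j \<subseteq> ?dec k" "?dec k \<in> ?Fin"
      using that dec[of k] unfolding B by (simp_all split: if_splits)
    then show ?thesis
      unfolding B using tr_Comp[of "?dec k" "?dec i" "?dec j"] by simp
  qed
  ultimately show ?thesis
    unfolding ind_object_def by blast
qed

context tensor_category
begin

lemma germ_same_index:
  assumes Y: "ind_object C Y" and h: "represents V Y (j, h)" and h': "(j, h') \<in> germ C V Y (j, h)"
  obtains k w where "k \<in> Ob (ix Y)" "w \<in> Hom (ix Y) j k" "ar Y w \<cdot> h = ar Y w \<cdot> h'"
proof -
  interpret J: category "ix Y" by (rule ind_objectD(1)[OF Y])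
  obtain k u v where k: "k \<in> Ob (ix Y)" "u \<in> Hom (ix Y) j k" "v \<in> Hom (ix Y) j k" "ar Y u \<cdot> h
      = ar Y v \<cdot> h'"
      and r: "represents V Y (j, h')"
    using h' germ_iff[OF Y h] by blast
  have j: "j \<in> Ob (ix Y)"
    using h by (simp add: represents_def)
  obtain l w where l: "l \<in> Ob (ix Y)" "w \<in> Hom (ix Y) k l" "ar Y w \<cdot> ar Y u = ar Y w \<cdot> ar Y v"
    using ind_equalize[OF Y j k(1-3)] .
  note ar = ind_objectD(5)[OF Y j k(1,2)] ind_objectD(5)[OF Y j k(1,3)] ind_objectD(5)[OF Y k(1)
      l(1,2)]
  have "ar Y w \<cdot> (ar Y u \<cdot> h) = (ar Y w \<cdot> ar Y v) \<cdot> h'"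
    using k(4) ar r by (simp add: represents_def)
  then have "(ar Y w \<cdot> ar Y u) \<cdot> h = (ar Y w \<cdot> ar Y u) \<cdot> h'"
    unfolding l(3) using ar h r l(3) by (simp add: represents_def Comp_reassoc[OF l(3)])
  moreover have "ar Y (w \<cdot>\<^bsub>ix Y\<^esub> u) = ar Y w \<cdot> ar Y u"
    using ind_objectD(6)[OF Y j k(1) l(1) k(2) l(2)] .
  ultimately show ?thesis
    using that[OF l(1) J.Comp_closed[OF j k(1) l(1) k(2) l(2)]] by simp
qed

text \<open>
  The finitely many coincidences on the summands happen at a common later index, where the two
  morphisms out of the biproduct then agree.
\<close>

lemma fin_biproduct_germ_eqI:
  assumes Y: "ind_object C Y" and S: "fin_biproduct F E S inc pr" and F: "finite F"
    and t: "represents S Y (j, t)" and t': "represents S Y (j', t')"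
    and eq: "\<And>x. x \<in> F \<Longrightarrow> (j', t' \<cdot> inc x) \<in> germ C (E x) Y (j, t \<cdot> inc x)"
  shows "(j', t') \<in> germ C S Y (j, t)"
proof -
  interpret J: category "ix Y" by (rule ind_objectD(1)[OF Y])
  note B = fin_biproductD[OF S]
  have j: "j \<in> Ob (ix Y)" "j' \<in> Ob (ix Y)"
    using t t' by (simp_all add: represents_def)
  obtain k u v where k: "k \<in> Ob (ix Y)" "u \<in> Hom (ix Y) j k" "v \<in> Hom (ix Y) j' k"
    using ind_join[OF Y j] .
  note au = ind_objectD(5)[OF Y j(1) k(1,2)] and av = ind_objectD(5)[OF Y j(2) k(1,3)]
  let ?a = "ar Y u \<cdot> t" and ?b = "ar Y v \<cdot> t'"
  have ab: "represents S Y (k, ?a)" "represents S Y (k, ?b)"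
    using t t' au av k(1) by (simp_all add: represents_def)
  have ab_eq: "(k, ?b \<cdot> inc x) \<in> germ C (E x) Y (k, ?a \<cdot> inc x)" if x: "x \<in> F" for x
  proof -
    have r: "represents (E x) Y (j, t \<cdot> inc x)" "represents (E x) Y (j', t' \<cdot> inc x)"
      using t t' B x by (simp_all add: represents_def)
    have "(k, ar Y u \<cdot> (t \<cdot> inc x)) \<in> germ C (E x) Y (j, t \<cdot> inc x)"
      "(k, ar Y v \<cdot> (t' \<cdot> inc x)) \<in> germ C (E x) Y (j', t' \<cdot> inc x)"
      by (rule germ_transition[OF Y r(1) k(1,2)], rule germ_transition[OF Y r(2) k(1,3)])
    then have "(k, ar Y v \<cdot> (t' \<cdot> inc x)) \<in> germ C (E x) Y (k, ar Y u \<cdot> (t \<cdot> inc x))"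
      using germ_cong[OF Y r(1)] eq[OF x] by blast
    then show ?thesis
      using t t' au av B x by (simp add: represents_def)
  qed
  have "\<exists>l\<in>Ob (ix Y). \<exists>w\<in>Hom (ix Y) k l. \<forall>x\<in>G. ar Y w \<cdot> (?a \<cdot> inc x) = ar Y w \<cdot> (?b \<cdot> inc x)"
    if "finite G" "G \<subseteq> F" for G
    using that
  proof (induction G)
    case empty
    show ?case using k(1) J.Idn_closed by blast
  next
    case (insert y G)
    then obtain l w where l: "l \<in> Ob (ix Y)" "w \<in> Hom (ix Y) k l"
        and IH: "\<And>x. x \<in> G \<Longrightarrow> ar Y w \<cdot> (?a \<cdot> inc x) = ar Y w \<cdot> (?b \<cdot> inc x)"
      by auto
    have y: "y \<in> F" using insert.prems by simp
    have r: "represents (E y) Y (k, ?a \<cdot> inc y)" "represents (E y) Y (k, ?b \<cdot> inc y)"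
      using ab B y by (auto simp: represents_def)
    have "(l, ar Y w \<cdot> (?b \<cdot> inc y)) \<in> germ C (E y) Y (k, ?b \<cdot> inc y)"
      "(l, ar Y w \<cdot> (?a \<cdot> inc y)) \<in> germ C (E y) Y (k, ?a \<cdot> inc y)"
      using germ_transition[OF Y r(1) l] germ_transition[OF Y r(2) l] by blast+
    then have "(l, ar Y w \<cdot> (?b \<cdot> inc y)) \<in> germ C (E y) Y (l, ar Y w \<cdot> (?a \<cdot> inc y))"
      using germ_cong[OF Y r(1)] ab_eq[OF y] by blast
    moreover have aw: "mor (ar Y w)" "source (ar Y w) = ob Y k" "target (ar Y w) = ob Y l"
      using ind_objectD(5)[OF Y k(1) l] by simp_all
    moreover have "represents (E y) Y (l, ar Y w \<cdot> (?a \<cdot> inc y))"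
      using r aw l(1) by (simp add: represents_def)
    ultimately obtain m z where m: "m \<in> Ob (ix Y)" "z \<in> Hom (ix Y) l m"
        "ar Y z \<cdot> (ar Y w \<cdot> (?a \<cdot> inc y)) = ar Y z \<cdot> (ar Y w \<cdot> (?b \<cdot> inc y))"
      using germ_same_index[OF Y] by metis
    have az: "mor (ar Y z)" "source (ar Y z) = ob Y l" "target (ar Y z) = ob Y m"
      using ind_objectD(5)[OF Y l(1) m(1,2)] by simp_all
    have zw: "ar Y (z \<cdot>\<^bsub>ix Y\<^esub> w) = ar Y z \<cdot> ar Y w"
      using ind_objectD(6)[OF Y k(1) l(1) m(1) l(2) m(2)] .
    have "ar Y (z \<cdot>\<^bsub>ix Y\<^esub> w) \<cdot> (?a \<cdot> inc x) = ar Y (z \<cdot>\<^bsub>ix Y\<^esub> w) \<cdot> (?b \<cdot> inc x)"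
        if x: "x \<in> insert y G" for x
    proof -
      have xF: "x \<in> F" using x insert.prems by blast
      have "ar Y z \<cdot> (ar Y w \<cdot> (?a \<cdot> inc x)) = ar Y z \<cdot> (ar Y w \<cdot> (?b \<cdot> inc x))"
        using x m(3) IH by auto
      moreover have "(ar Y z \<cdot> ar Y w) \<cdot> (c \<cdot> inc x) = ar Y z \<cdot> (ar Y w \<cdot> (c \<cdot> inc x))"
        if "represents S Y (k, c)" for c
        by (rule Comp_assoc') (use that az aw B xF in \<open>simp_all add: represents_def\<close>)
      ultimately show ?thesis
        unfolding zw using ab by simp
    qed
    then show ?case
      using m(1) J.Comp_closed[OF k(1) l(1) m(1) l(2) m(2)] by blast
  qed
  from this[OF F] obtain l w where l: "l \<in> Ob (ix Y)" "w \<in> Hom (ix Y) k l"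
      and w: "\<And>x. x \<in> F \<Longrightarrow> ar Y w \<cdot> (?a \<cdot> inc x) = ar Y w \<cdot> (?b \<cdot> inc x)"
    by blast
  have aw: "mor (ar Y w)" "source (ar Y w) = ob Y k" "target (ar Y w) = ob Y l"
    using ind_objectD(5)[OF Y k(1) l] by simp_all
  have "ar Y w \<cdot> ?a = ar Y w \<cdot> ?b"
  proof (rule fin_biproduct_eq_from[OF S])
    fix x assume x: "x \<in> F"
    have "(ar Y w \<cdot> c) \<cdot> inc x = ar Y w \<cdot> (c \<cdot> inc x)" if "represents S Y (k, c)" for c
      by (rule Comp_assoc') (use that aw B x in \<open>simp_all add: represents_def\<close>)
    then show "(ar Y w \<cdot> ?a) \<cdot> inc x = (ar Y w \<cdot> ?b) \<cdot> inc x"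
      using w[OF x] ab by simp
  qed (use ab aw in \<open>simp_all add: represents_def\<close>)
  moreover have "(l, ar Y w \<cdot> ?b) \<in> germ C S Y (k, ?b)" "(l, ar Y w \<cdot> ?a) \<in> germ C S Y (k, ?a)"
    using germ_transition[OF Y ab(1) l] germ_transition[OF Y ab(2) l] by blast+
  moreover have "(k, ?a) \<in> germ C S Y (j, t)" "(k, ?b) \<in> germ C S Y (j', t')"
    using germ_transition[OF Y t k(1,2)] germ_transition[OF Y t' k(1,3)] by blast+
  ultimately show ?thesis
    using germ_cong[OF Y t] germ_cong[OF Y t'] germ_cong[OF Y ab(1)] germ_cong[OF Y ab(2)]
      germ_refl[OF Y t'] by metis
qed

end

text \<open>
  The coproduct of a small family of objects of \<open>C\<close> in the ind-completion. Smallness is what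
  allows the finite subsets of \<open>I\<close> to index a diagram.
\<close>

locale ind_coproduct = tensor_category U K C
  for U :: "'u itself" and K :: "('k, 'r) ring_scheme"
    and C :: "('k, 'o, 'm, 'z) lin_moncat_scheme" (structure) +
  fixes I :: "'i set" and E :: "'i \<Rightarrow> 'o" and A :: "('u, 'o, 'm) ind_obj"
    and \<iota> :: "'i \<Rightarrow> ('u, 'o, 'm) ind_mor"
  assumes E_Ob: "x \<in> I \<Longrightarrow> E x \<in> Ob C"
    and coproduct: "is_coproduct (Ind C) I (\<lambda>x. const_ind C (E x)) A \<iota>"
    and small: "\<exists>e :: 'i \<Rightarrow> 'u index. inj_on e I"
begin

lemma A_obj: "ind_object C A"
  using coproduct unfolding is_coproduct_def by simp

lemma const_obj: "V \<in> Ob C \<Longrightarrow> ind_object C (const_ind C V :: ('u, 'o, 'm) ind_obj)"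
  by (rule const_ind_object)

lemma iota_Hom: "x \<in> I \<Longrightarrow> \<iota> x \<in> ind_Hom C (const_ind C (E x)) A"
  using coproduct unfolding is_coproduct_def by simp

lemma universal:
  assumes "ind_object C Y" "\<And>x. x \<in> I \<Longrightarrow> f x \<in> ind_Hom C (const_ind C (E x)) Y"
  shows "\<exists>!h. h \<in> ind_Hom C A Y \<and> (\<forall>x\<in>I. ind_comp C h (\<iota> x) = f x)"
  using coproduct assms unfolding is_coproduct_def by simp

lemma iota_mem:
  assumes "x \<in> I" "(k, c) \<in> cls (\<iota> x) Star"
  shows "k \<in> Ob (ix A)" "mor c" "source c = E x" "target c = ob A k" "represents (E x) A (k, c)"
    "cls (\<iota> x) Star = germ C (E x) A (k, c)"
  using cls_mem[OF iota_Hom[OF assms(1)] const_obj[OF E_Ob[OF assms(1)]] A_obj assms(2)] by simp_all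

lemma ex_common_index:
  assumes "finite F" "F \<subseteq> I"
  shows "\<exists>j\<in>Ob (ix A). \<forall>x\<in>F. \<exists>c. (j, c) \<in> cls (\<iota> x) Star"
  using assms
proof (induction F)
  case empty
  then show ?case
    using ind_objectD(2)[OF A_obj] unfolding filtered_def by blast
next
  case (insert y F)
  then obtain j where j: "j \<in> Ob (ix A)" "\<And>x. x \<in> F \<Longrightarrow> \<exists>c. (j, c) \<in> cls (\<iota> x) Star"
    by auto
  have y: "y \<in> I" using insert.prems by simp
  obtain k d where d: "(k, d) \<in> cls (\<iota> y) Star"
    using cls_nonempty[OF iota_Hom[OF y] const_obj[OF E_Ob[OF y]] A_obj] by auto
  obtain l u v where l: "l \<in> Ob (ix A)" "u \<in> Hom (ix A) j l" "v \<in> Hom (ix A) k l"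
    using ind_join[OF A_obj j(1) iota_mem(1)[OF y d]] .
  have "\<exists>c. (l, c) \<in> cls (\<iota> x) Star" if x: "x \<in> insert y F" for x
  proof (cases "x = y")
    case True
    then show ?thesis
      using cls_transition[OF iota_Hom[OF y] const_obj[OF E_Ob[OF y]] A_obj d l(1,3)] by blast
  next
    case False
    then obtain c where "(j, c) \<in> cls (\<iota> x) Star" using x j(2) by blast
    moreover have "x \<in> I" using False x insert.prems by blast
    ultimately show ?thesis
      using cls_transition[OF iota_Hom const_obj[OF E_Ob] A_obj _ l(1,2)] by blast
  qed
  then show ?case using l(1) by blast
qed

lemma ex_sum_inclusion:
  assumes S: "fin_biproduct F E S inc pr" and F: "finite F" "F \<subseteq> I"
  obtains j t where "represents S A (j, t)" "\<forall>x\<in>F. (j, t \<cdot> inc x) \<in> cls (\<iota> x) Star"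
proof -
  obtain j where j: "j \<in> Ob (ix A)" "\<And>x. x \<in> F \<Longrightarrow> \<exists>c. (j, c) \<in> cls (\<iota> x) Star"
    using ex_common_index[OF F] by blast
  then obtain c where c: "\<And>x. x \<in> F \<Longrightarrow> (j, c x) \<in> cls (\<iota> x) Star"
    by metis
  have "mor (c x) \<and> source (c x) = E x \<and> target (c x) = ob A j" if "x \<in> F" for x
    using iota_mem[OF _ c[OF that]] F that by blast
  then obtain t where "mor t" "source t = S" "target t = ob A j" "\<And>x. x \<in> F \<Longrightarrow> t \<cdot> inc x = c x"
    using fin_biproduct_ex_from[OF S F(1) ind_objectD(3)[OF A_obj j(1)]] by metis
  then show ?thesis
    using that[of j t] c j(1) by (simp add: represents_def)
qed

text \<open>
  The compactness statement: every object \<open>A\<^sub>i\<close> maps to \<open>A\<close> through a finite partial sum. The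
  inclusions of the summands into the diagram \<open>B\<close> of finite partial sums give \<open>s : A \<rightarrow> B\<close> by the
  universal property of \<open>A\<close>, and the inclusions \<open>\<iota>\<close> give \<open>\<tau> : B \<rightarrow> A\<close>. As \<open>\<tau>s\<close> fixes each \<open>\<iota> x\<close>,
  it is the identity of \<open>A\<close>. At the index \<open>i\<close> this equation says that a transition of \<open>A\<close>
  starting at \<open>i\<close> factors through some \<open>S F\<close>.
\<close>

lemma transition_factors_through_finite_sum:
  assumes i: "i \<in> Ob (ix A)"
  obtains F S inc pr k u s t where "finite F" "F \<subseteq> I" "fin_biproduct F E S inc pr"
    "k \<in> Ob (ix A)" "u \<in> Hom (ix A) i k" "mor s" "source s = ob A i" "target s = S"
    "represents S A (k, t)" "ar A u = t \<cdot> s" "\<forall>x\<in>F. (k, t \<cdot> inc x) \<in> cls (\<iota> x) Star"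
proof -
  let ?Fin = "{F. finite F \<and> F \<subseteq> I}"
  obtain e :: "'i \<Rightarrow> 'u index" where e: "inj_on e I"
    using small by blast
  obtain code :: "'i set \<Rightarrow> 'u index" where inj: "inj_on code ?Fin"
    using ex_code_finite_subsets[OF e] .
  have "\<exists>S inc pr. fin_biproduct F E S inc pr" if "F \<in> ?Fin" for F
    by (rule ex_fin_biproduct) (use that E_Ob in auto)
  then obtain S inc pr where S: "\<And>F. F \<in> ?Fin \<Longrightarrow> fin_biproduct F E (S F) (inc F) (pr F)"
    by metis
  note SD = fin_biproductD[OF S]
  have "\<exists>h. mor h \<and> source h = S F \<and> target h = S G \<and> (\<forall>x\<in>F. h \<cdot> inc F x = inc G x)"
    if G: "G \<in> ?Fin" and FG: "F \<subseteq> G" for F G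
  proof -
    have F: "F \<in> ?Fin" using G FG finite_subset by auto
    have finF: "finite F" using F by simp
    have inc: "mor (inc G x) \<and> source (inc G x) = E x \<and> target (inc G x) = S G" if "x \<in> F" for x
      using SD(3-5)[OF G] that FG by blast
    show ?thesis
      by (rule fin_biproduct_ex_from[OF S[OF F] finF SD(1)[OF G] inc]) auto
  qed
  \<comment> \<open>\<open>tr F G\<close> is determined by its restrictions to the summands, hence functorial in \<open>F \<subseteq> G\<close>.\<close>
  note ex_tr = this
  define tr where "tr F G = (SOME h. mor h \<and> source h = S F \<and> target h = S G \<and>
      (\<forall>x\<in>F. h \<cdot> inc F x = inc G x))" for F G
  have tr: "mor (tr F G) \<and> source (tr F G) = S F \<and> target (tr F G) = S G \<and>
      (\<forall>x\<in>F. tr F G \<cdot> inc F x = inc G x)" if "G \<in> ?Fin" "F \<subseteq> G" for F G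
    unfolding tr_def by (rule someI_ex) (rule ex_tr[OF that])
  have tr_inc: "tr F G \<cdot> inc F x = inc G x" if "G \<in> ?Fin" "F \<subseteq> G" "x \<in> F" for F G x
    using tr that by blast
  have tr_Idn: "tr F F = Idn C (S F)" if F: "F \<in> ?Fin" for F
    by (rule fin_biproduct_eq_from[OF S[OF F]]) (use tr[OF F] SD[OF F] in simp_all)
  have tr_Comp: "tr F H = tr G H \<cdot> tr F G" if H: "H \<in> ?Fin" "F \<subseteq> G" "G \<subseteq> H" for F G H
  proof -
    have G: "G \<in> ?Fin" using H finite_subset by auto
    then have F: "F \<in> ?Fin" using H finite_subset by auto
    have FH: "F \<subseteq> H" using H by blast
    note t = tr[OF H(1) FH] tr[OF H(1,3)] tr[OF G H(2)]
    show ?thesis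
    proof (rule fin_biproduct_eq_from[OF S[OF F]])
      fix x assume x: "x \<in> F"
      have xG: "x \<in> G" using x H by blast
      have "(tr G H \<cdot> tr F G) \<cdot> inc F x = tr G H \<cdot> (tr F G \<cdot> inc F x)"
        using t SD[OF F] x by simp
      also have "\<dots> = tr F H \<cdot> inc F x"
        using tr_inc[OF G H(2) x] tr_inc[OF H(1,3) xG] tr_inc[OF H(1) FH x] by simp
      finally show "tr F H \<cdot> inc F x = (tr G H \<cdot> tr F G) \<cdot> inc F x" ..
    qed (use t in simp_all)
  qed
  define B where "B = sum_diagram I code S tr"
  have B: "ind_object C B"
    unfolding B_def
  proof (rule sum_diagram_object[OF inj])
    show "tr F G \<in> Hom C (S F) (S G)" if G: "finite G" "G \<subseteq> I" "F \<subseteq> G" for F G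
    proof -
      have GF: "G \<in> ?Fin" "F \<in> ?Fin" using G finite_subset[OF G(3,1)] by auto
      show ?thesis
        using SD(1)[OF GF(1)] SD(1)[OF GF(2)] tr[OF GF(1) G(3)] by simp
    qed
    show "S F \<in> Ob C" if "finite F" "F \<subseteq> I" for F
      by (rule SD(1)) (use that in simp)
    show "tr F F = Idn C (S F)" if "finite F" "F \<subseteq> I" for F
      by (rule tr_Idn) (use that in simp)
    show "tr F H = tr G H \<cdot> tr F G" if "finite H" "H \<subseteq> I" "F \<subseteq> G" "G \<subseteq> H" for F G H
      by (rule tr_Comp) (use that in simp_all)
  qed
  let ?dec = "inv_into ?Fin code"
  have dec: "?dec i \<in> ?Fin" if "i \<in> code ` ?Fin" for i
    using that by (rule inv_into_into)
  have dec_code: "?dec (code F) = F" if "F \<in> ?Fin" for F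
    using inv_into_f_f[OF inj that] .
  have B_simps: "Ob (ix B) = code ` ?Fin" "Hom (ix B) i j = (if ?dec i \<subseteq> ?dec j then {Pair i j} else
      {})"
    "ob B i = S (?dec i)" "ar B u = tr (?dec (left u)) (?dec (right u))" for i j u
    by (simp_all add: B_def sum_diagram_def Let_def)

  have "\<exists>f. f \<in> ind_Hom C (const_ind C (E x)) B \<and> (code {x}, inc {x} x) \<in> cls f Star" if x: "x \<in> I"
      for x
  proof -
    have xF: "{x} \<in> ?Fin" using x by simp
    have "represents (E x) B (code {x}, inc {x} x)"
      using SD(3-5)[OF xF, of x] dec_code[OF xF] x by (simp add: represents_def B_simps)
    then show ?thesis
      using from_const[OF B] by metis
  qed
  then obtain \<iota>' where \<iota>': "\<And>x. x \<in> I \<Longrightarrow> \<iota>' x \<in> ind_Hom C (const_ind C (E x)) B"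
      "\<And>x. x \<in> I \<Longrightarrow> (code {x}, inc {x} x) \<in> cls (\<iota>' x) Star"
    by metis
  obtain s where s: "s \<in> ind_Hom C A B" "\<And>x. x \<in> I \<Longrightarrow> ind_comp C s (\<iota> x) = \<iota>' x"
    using universal[OF B \<iota>'(1)] by blast

  have ex_T: "\<exists>e. represents (S F) A e \<and> (\<forall>x\<in>F. (fst e, snd e \<cdot> inc F x) \<in> cls (\<iota> x) Star)"
    if "F \<in> ?Fin" for F
  proof -
    have F: "finite F" "F \<subseteq> I" using that by auto
    show ?thesis
      by (rule ex_sum_inclusion[OF S[OF that] F]) (metis fst_conv snd_conv)
  qed
  \<comment> \<open>A morphism \<open>T F : S F \<rightarrow> A\<^sub>k\<close> with \<open>k = J F\<close>, representing \<open>\<iota> x\<close> on the summand of each \<open>x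
      \<in> F\<close>.\<close>
  define R where "R F = (SOME e. represents (S F) A e \<and> (\<forall>x\<in>F. (fst e, snd e \<cdot> inc F x) \<in> cls (\<iota> x)
      Star))" for F
  define J where "J F = fst (R F)" for F
  define T where "T F = snd (R F)" for F
  have R: "represents (S F) A (R F) \<and> (\<forall>x\<in>F. (fst (R F), snd (R F) \<cdot> inc F x) \<in> cls (\<iota> x) Star)"
    if "F \<in> ?Fin" for F
    unfolding R_def by (rule someI_ex) (rule ex_T[OF that])
  have JT: "represents (S F) A (J F, T F)" "x \<in> F \<Longrightarrow> (J F, T F \<cdot> inc F x) \<in> cls (\<iota> x) Star"
    if "F \<in> ?Fin" for F x
    using R[OF that] by (simp_all add: J_def T_def)
  let ?\<tau> = "ind_map C B A (\<lambda>i. (J (?dec i), T (?dec i)))"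
  have r: "represents (ob B i) A (J (?dec i), T (?dec i))" if "i \<in> Ob (ix B)" for i
    using JT(1) dec that by (simp add: B_simps)
  have nat: "(fst (J (?dec i'), T (?dec i')), snd (J (?dec i'), T (?dec i')) \<cdot> ar B u)
      \<in> germ C (ob B i) A (J (?dec i), T (?dec i))"
    if u: "i \<in> Ob (ix B)" "i' \<in> Ob (ix B)" "u \<in> Hom (ix B) i i'" for i i' u
  proof -
    let ?F = "?dec i" and ?G = "?dec i'"
    have u': "u = Pair i i'" "?F \<subseteq> ?G" using u(3) by (simp_all add: B_simps split: if_splits)
    have F: "?F \<in> ?Fin" and G: "?G \<in> ?Fin" using dec u(1,2) by (simp_all add: B_simps)
    note t = tr[OF G u'(2)]
    have "(J ?G, T ?G \<cdot> tr ?F ?G) \<in> germ C (S ?F) A (J ?F, T ?F)"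
    proof (rule fin_biproduct_germ_eqI[OF A_obj S[OF F] _ JT(1)[OF F]])
      show "finite ?F" using F by simp
      show "represents (S ?F) A (J ?G, T ?G \<cdot> tr ?F ?G)"
        using JT(1)[OF G] t by (simp add: represents_def)
      fix x assume x: "x \<in> ?F"
      then have xG: "x \<in> ?G" and xI: "x \<in> I" using u'(2) F by blast+
      have "(T ?G \<cdot> tr ?F ?G) \<cdot> inc ?F x = T ?G \<cdot> (tr ?F ?G \<cdot> inc ?F x)"
        using JT(1)[OF G] t SD[OF F] x by (simp add: represents_def)
      then have "(T ?G \<cdot> tr ?F ?G) \<cdot> inc ?F x = T ?G \<cdot> inc ?G x"
        using tr_inc[OF G u'(2) x] by simp
      then show "(J ?G, (T ?G \<cdot> tr ?F ?G) \<cdot> inc ?F x) \<in> germ C (E x) A (J ?F, T ?F \<cdot> inc ?F x)"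
        using JT(2)[OF G xG] iota_mem(6)[OF xI JT(2)[OF F x]] by simp
    qed
    then show ?thesis
      by (simp add: B_simps u'(1))
  qed
  have \<tau>: "?\<tau> \<in> ind_Hom C B A"
    by (rule ind_map_Hom(1)[OF B A_obj r nat])
  have \<tau>_cls: "(J (?dec i), T (?dec i)) \<in> cls ?\<tau> i" if "i \<in> Ob (ix B)" for i
    by (rule ind_map_Hom(2)[OF B A_obj r nat that])
  have \<tau>s: "ind_comp C ?\<tau> s \<in> ind_Hom C A A"
    by (rule ind_comp_closed[OF s(1) \<tau> A_obj B A_obj])
  have "ind_comp C (ind_comp C ?\<tau> s) (\<iota> x) = \<iota> x" if x: "x \<in> I" for x
  proof -
    note cE = const_obj[OF E_Ob[OF x]]
    have "ind_comp C (ind_comp C ?\<tau> s) (\<iota> x) = ind_comp C ?\<tau> (\<iota>' x)"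
      using ind_comp_assoc[OF iota_Hom[OF x] s(1) \<tau> cE A_obj B A_obj] s(2)[OF x] by simp
    also have "\<dots> = \<iota> x"
    proof (rule ind_Hom_eqI[OF ind_comp_closed[OF \<iota>'(1)[OF x] \<tau> cE B A_obj] iota_Hom[OF x] cE
        A_obj])
      fix i assume "i \<in> Ob (ix (const_ind C (E x) :: ('u, 'o, 'm) ind_obj))"
      then have i: "i = Star" by simp
      have xF: "{x} \<in> ?Fin" using x by simp
      have "(J {x}, T {x}) \<in> cls ?\<tau> (code {x})"
        using \<tau>_cls[of "code {x}"] dec_code[OF xF] xF by (simp add: B_simps)
      from ind_comp_cls(3)[OF \<iota>'(1)[OF x] \<tau> cE B A_obj \<iota>'(2)[OF x] this]
      show "\<exists>e. e \<in> cls (ind_comp C ?\<tau> (\<iota>' x)) i \<and> e \<in> cls (\<iota> x) i"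
        using JT(2)[OF xF] i by blast
    qed
    finally show ?thesis .
  qed
  moreover have "ind_comp C (ind_map C A A (\<lambda>i. (i, Idn C (ob A i)))) (\<iota> x) = \<iota> x" if x: "x \<in> I"
      for x
    by (rule ind_comp_Idn(2)[OF iota_Hom[OF x] const_obj[OF E_Ob[OF x]] A_obj])
  ultimately have id: "ind_comp C ?\<tau> s = ind_map C A A (\<lambda>i. (i, Idn C (ob A i)))"
    using universal[OF A_obj iota_Hom] \<tau>s ind_Idn(1)[OF A_obj] by blast

  \<comment> \<open>Compare \<open>\<tau>s\<close> with the identity at the index \<open>i\<close>.\<close>
  obtain b si where si: "(b, si) \<in> cls s i"
    using cls_nonempty[OF s(1) A_obj B i] .
  note siD = cls_mem[OF s(1) A_obj B si]
  let ?F = "?dec b"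
  have F: "?F \<in> ?Fin" using dec siD(4) by (simp add: B_simps)
  have TF_cls: "(J ?F, T ?F \<cdot> si) \<in> cls (ind_comp C ?\<tau> s) i"
    by (rule ind_comp_cls(3)[OF s(1) \<tau> A_obj B A_obj si \<tau>_cls[OF siD(4)]])
  have id_cls: "(i, Idn C (ob A i)) \<in> cls (ind_comp C ?\<tau> s) i"
    unfolding id by (rule ind_Idn(2)[OF A_obj i])
  obtain k u v where k: "k \<in> Ob (ix A)" "u \<in> Hom (ix A) i k" "v \<in> Hom (ix A) (J ?F) k"
      and eq: "ar A u \<cdot> Idn C (ob A i) = ar A v \<cdot> (T ?F \<cdot> si)"
    by (rule cls_common[OF \<tau>s A_obj A_obj id_cls TF_cls])
  have JF: "J ?F \<in> Ob (ix A)" using JT(1)[OF F] by (simp add: represents_def)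
  note au = ind_objectD(5)[OF A_obj i k(1,2)] and av = ind_objectD(5)[OF A_obj JF k(1,3)]
  have si': "mor si" "source si = ob A i" "target si = S ?F"
    using siD by (simp_all add: B_simps)
  note TF = JT(1)[OF F, unfolded represents_def fst_conv snd_conv]
  have auts: "ar A u = (ar A v \<cdot> T ?F) \<cdot> si"
    using eq au av si' TF by simp
  have rt: "represents (S ?F) A (k, ar A v \<cdot> T ?F)"
    using TF av k(1) by (simp add: represents_def)
  have cov: "(k, (ar A v \<cdot> T ?F) \<cdot> inc ?F x) \<in> cls (\<iota> x) Star" if x: "x \<in> ?F" for x
  proof -
    have xI: "x \<in> I" using x F by blast
    have "(k, ar A v \<cdot> (T ?F \<cdot> inc ?F x)) \<in> cls (\<iota> x) Star"
      by (rule cls_transition[OF iota_Hom[OF xI] const_obj[OF E_Ob[OF xI]] A_obj JT(2)[OF F x]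
          k(1,3)])
    moreover have "(ar A v \<cdot> T ?F) \<cdot> inc ?F x = ar A v \<cdot> (T ?F \<cdot> inc ?F x)"
      by (rule Comp_assoc') (use TF av SD(3,5)[OF F x] in simp_all)
    ultimately show ?thesis
      by (simp only:)
  qed
  have fin: "finite ?F" "?F \<subseteq> I" using F by simp_all
  show ?thesis
    by (rule that[OF fin S[OF F] k(1,2) si' rt auts ballI[OF cov]])
qed

end

section \<open>Projections of a coproduct\<close>

context ind_coproduct
begin

definition proj :: "'i \<Rightarrow> ('u, 'o, 'm) ind_mor" where
  "proj x = (SOME p. p \<in> ind_Hom C A (const_ind C (E x)) \<and>
     (\<forall>y\<in>I. component (ind_comp C p (\<iota> y)) Star = (if x = y then Idn C (E x) else hzero C (E y) (E
         x))))"

lemma ex1_proj: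
  assumes x: "x \<in> I"
  shows "\<exists>!p. p \<in> ind_Hom C A (const_ind C (E x)) \<and>
     (\<forall>y\<in>I. component (ind_comp C p (\<iota> y)) Star = (if x = y then Idn C (E x) else hzero C (E y) (E
         x)))"
    (is "\<exists>!p. ?P p")
proof -
  let ?d = "\<lambda>y. if x = y then Idn C (E x) else hzero C (E y) (E x)"
  have d: "mor (?d y) \<and> source (?d y) = E y \<and> target (?d y) = E x" if "y \<in> I" for y
    using E_Ob x that by simp
  have ex: "\<exists>f. f \<in> ind_Hom C (const_ind C (E y)) (const_ind C (E x) :: ('u, 'o, 'm) ind_obj) \<and>
      component f Star = ?d y"
    if y: "y \<in> I" for y
    by (rule to_const[OF const_obj[OF E_Ob[OF y]] E_Ob[OF x], of "\<lambda>_. ?d y"]) (use d[OF y] in auto)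
  define f where "f y = (SOME f. f \<in> ind_Hom C (const_ind C (E y)) (const_ind C (E x) ::
      ('u, 'o, 'm) ind_obj) \<and>
      component f Star = ?d y)" for y
  have f: "f y \<in> ind_Hom C (const_ind C (E y)) (const_ind C (E x)) \<and> component (f y) Star = ?d y"
    if "y \<in> I" for y
    unfolding f_def by (rule someI_ex) (rule ex[OF that])
  have iff: "component (ind_comp C p (\<iota> y)) Star = ?d y \<longleftrightarrow> ind_comp C p (\<iota> y) = f y"
    if p: "p \<in> ind_Hom C A (const_ind C (E x))" and y: "y \<in> I" for p y
  proof
    assume eq: "component (ind_comp C p (\<iota> y)) Star = ?d y"
    show "ind_comp C p (\<iota> y) = f y"
      by (rule component_eqI[OF ind_comp_closed[OF iota_Hom[OF y] p const_obj[OF E_Ob[OF y]] A_obj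
          const_obj[OF E_Ob[OF x]]]
            conjunct1[OF f[OF y]] const_obj[OF E_Ob[OF y]] E_Ob[OF x]])
        (use eq f[OF y] in simp)
  qed (use f[OF y] in simp)
  have "\<exists>!p. p \<in> ind_Hom C A (const_ind C (E x)) \<and> (\<forall>y\<in>I. ind_comp C p (\<iota> y) = f y)"
    by (rule universal[OF const_obj[OF E_Ob[OF x]]]) (use f in blast)
  moreover have "?P p \<longleftrightarrow> p \<in> ind_Hom C A (const_ind C (E x)) \<and> (\<forall>y\<in>I. ind_comp C p (\<iota> y) = f y)"
      for p
    using iff by blast
  ultimately show ?thesis
    by (simp only:)
qed

lemma proj:
  assumes "x \<in> I"
  shows "proj x \<in> ind_Hom C A (const_ind C (E x))"
    and "y \<in> I \<Longrightarrow> component (ind_comp C (proj x) (\<iota> y)) Star = (if x = y then Idn C (E x) else hzero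
        C (E y) (E x))"
  using someI_ex[OF ex1_implies_ex[OF ex1_proj[OF assms]]] unfolding proj_def[symmetric] by blast+

abbreviation \<pi> :: "'i \<Rightarrow> 'u index \<Rightarrow> 'm" where
  "\<pi> x j \<equiv> component (proj x) j"

lemma pi_mor:
  assumes "x \<in> I" "j \<in> Ob (ix A)"
  shows "mor (\<pi> x j)" "source (\<pi> x j) = ob A j" "target (\<pi> x j) = E x"
  using component(2-4)[OF proj(1)[OF assms(1)] A_obj E_Ob[OF assms(1)] assms(2)] .

lemma pi_natural:
  assumes "x \<in> I" "i \<in> Ob (ix A)" "j \<in> Ob (ix A)" "u \<in> Hom (ix A) i j"
  shows "\<pi> x j \<cdot> ar A u = \<pi> x i"
  by (rule component_natural[OF proj(1)[OF assms(1)] A_obj E_Ob[OF assms(1)] assms(2-4)])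

lemma pi_iota:
  assumes "x \<in> I" "y \<in> I" "(k, c) \<in> cls (\<iota> y) Star"
  shows "\<pi> x k \<cdot> c = (if x = y then Idn C (E x) else hzero C (E y) (E x))"
  using component_comp[OF iota_Hom[OF assms(2)] proj(1)[OF assms(1)] const_obj[OF E_Ob[OF assms(2)]]
      A_obj
      E_Ob[OF assms(1)] assms(3)] proj(2)[OF assms(1,2)] by simp

lemma pi_sum_inclusion:
  assumes S: "fin_biproduct F E S inc pr" and F: "F \<subseteq> I" and t: "represents S A (k, t)"
    and cov: "\<And>x. x \<in> F \<Longrightarrow> (k, t \<cdot> inc x) \<in> cls (\<iota> x) Star" and x: "x \<in> I"
  shows "\<pi> x k \<cdot> t = (if x \<in> F then pr x else hzero C S (E x))"
proof -
  note SD = fin_biproductD[OF S]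
  have k: "k \<in> Ob (ix A)" and t': "mor t" "source t = S" "target t = ob A k"
    using t by (simp_all add: represents_def)
  note p = pi_mor[OF x k]
  show ?thesis
  proof (rule fin_biproduct_eq_from[OF S])
    fix y assume y: "y \<in> F"
    have yI: "y \<in> I" using y F by blast
    have "(\<pi> x k \<cdot> t) \<cdot> inc y = \<pi> x k \<cdot> (t \<cdot> inc y)"
      by (rule Comp_assoc') (use p t' SD(3,5)[OF y] in simp_all)
    also have "\<dots> = (if x = y then Idn C (E x) else hzero C (E y) (E x))"
      by (rule pi_iota[OF x yI cov[OF y]])
    also have "\<dots> = (if x \<in> F then pr x else hzero C S (E x)) \<cdot> inc y"
      using SD(9)[of x y] SD(3-5)[OF y] y E_Ob[OF x] by auto
    finally show "(\<pi> x k \<cdot> t) \<cdot> inc y = (if x \<in> F then pr x else hzero C S (E x)) \<cdot> inc y" .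
  qed (use p t' SD(1) SD(6-8)[of x] E_Ob[OF x] in auto)
qed

text \<open>
  A linear functor \<open>T\<close> of \<open>C\<close>, extended to ind-objects, takes the inclusions of the summands to
  a jointly epimorphic family: up to a transition, \<open>T\<close> applied to \<open>A\<^sub>i\<close> maps through \<open>T\<close> applied
  to a finite partial sum.
\<close>

lemma jointly_epic:
  assumes T: "linear_functor T TO"
    and h: "\<And>j. j \<in> Ob (ix A) \<Longrightarrow> mor (h j) \<and> source (h j) = TO (ob A j) \<and> target (h j) = Z"
    and h': "\<And>j. j \<in> Ob (ix A) \<Longrightarrow> mor (h' j) \<and> source (h' j) = TO (ob A j) \<and> target (h' j) = Z"
    and nat: "\<And>i j u. \<lbrakk>i \<in> Ob (ix A); j \<in> Ob (ix A); u \<in> Hom (ix A) i j\<rbrakk> \<Longrightarrow> h j \<cdot> T (ar A u) = h i"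
    and nat': "\<And>i j u. \<lbrakk>i \<in> Ob (ix A); j \<in> Ob (ix A); u \<in> Hom (ix A) i j\<rbrakk> \<Longrightarrow> h' j \<cdot> T (ar A u)
        = h' i"
    and eq: "\<And>x k c. \<lbrakk>x \<in> I; (k, c) \<in> cls (\<iota> x) Star\<rbrakk> \<Longrightarrow> h k \<cdot> T c = h' k \<cdot> T c"
    and i: "i \<in> Ob (ix A)"
  shows "h i = h' i"
proof -
  obtain F S inc pr k u s t where F: "finite F" "F \<subseteq> I" and S: "fin_biproduct F E S inc pr"
    and k: "k \<in> Ob (ix A)" "u \<in> Hom (ix A) i k" and s: "mor s" "source s = ob A i" "target s = S"
    and t: "represents S A (k, t)" and uts: "ar A u = t \<cdot> s"
    and "\<forall>x\<in>F. (k, t \<cdot> inc x) \<in> cls (\<iota> x) Star"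
    by (rule transition_factors_through_finite_sum[OF i])
  note cov = bspec[OF \<open>\<forall>x\<in>F. (k, t \<cdot> inc x) \<in> cls (\<iota> x) Star\<close>]
  note SD = fin_biproductD[OF S] and TD = linear_functorD[OF T]
  have t': "mor t" "source t = S" "target t = ob A k"
    using t by (simp_all add: represents_def)
  have "h k \<cdot> T t = h' k \<cdot> T t"
  proof (rule fin_biproduct_eq_from_functor[OF S T])
    fix x assume x: "x \<in> F"
    have xI: "x \<in> I" using x F by blast
    have *: "(g \<cdot> T t) \<cdot> T (inc x) = g \<cdot> T (t \<cdot> inc x)"
      if "mor g \<and> source g = TO (ob A k) \<and> target g = Z" for g
      using that t' SD(3-5)[OF x] TD(3-6) by simp
    show "(h k \<cdot> T t) \<cdot> T (inc x) = (h' k \<cdot> T t) \<cdot> T (inc x)"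
      unfolding *[OF h[OF k(1)]] *[OF h'[OF k(1)]] by (rule eq[OF xI cov[OF x]])
  qed (use h[OF k(1)] h'[OF k(1)] t' TD(3-5) in simp_all)
  moreover have "g \<cdot> T (ar A u) = (g \<cdot> T t) \<cdot> T s"
    if "mor g \<and> source g = TO (ob A k) \<and> target g = Z" for g
    unfolding uts using that t' s TD(3-6) by simp
  ultimately show ?thesis
    using nat[OF i k] nat'[OF i k] h[OF k(1)] h'[OF k(1)] by metis
qed

text \<open>
  The canonical morphism from the coproduct to the product is a monomorphism: a suitable
  transition factors through a finite biproduct, where the components are known.
\<close>

lemma germ_eqI_projections:
  assumes a: "represents W A (j, a)" and b: "represents W A (j', b)"
    and eq: "\<And>x. x \<in> I \<Longrightarrow> \<pi> x j \<cdot> a = \<pi> x j' \<cdot> b"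
  shows "(j', b) \<in> germ C W A (j, a)"
proof -
  interpret J: category "ix A" by (rule ind_objectD(1)[OF A_obj])
  have a': "j \<in> Ob (ix A)" "mor a" "source a = W" "target a = ob A j"
    and b': "j' \<in> Ob (ix A)" "mor b" "source b = W" "target b = ob A j'"
    using a b by (simp_all add: represents_def)
  obtain i u v where i: "i \<in> Ob (ix A)" "u \<in> Hom (ix A) j i" "v \<in> Hom (ix A) j' i"
    by (rule ind_join[OF A_obj a'(1) b'(1)])
  note au = ind_objectD(5)[OF A_obj a'(1) i(1,2)] and av = ind_objectD(5)[OF A_obj b'(1) i(1,3)]
  obtain F S inc pr k w s t where F: "finite F" "F \<subseteq> I" and S: "fin_biproduct F E S inc pr"
    and k: "k \<in> Ob (ix A)" "w \<in> Hom (ix A) i k" and s: "mor s" "source s = ob A i" "target s = S"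
    and t: "represents S A (k, t)" and wts: "ar A w = t \<cdot> s"
    and "\<forall>x\<in>F. (k, t \<cdot> inc x) \<in> cls (\<iota> x) Star"
    by (rule transition_factors_through_finite_sum[OF i(1)])
  note cov = bspec[OF \<open>\<forall>x\<in>F. (k, t \<cdot> inc x) \<in> cls (\<iota> x) Star\<close>]
  note SD = fin_biproductD[OF S]
  have t': "mor t" "source t = S" "target t = ob A k"
    using t by (simp_all add: represents_def)
  note aw = ind_objectD(5)[OF A_obj i(1) k]
  have "s \<cdot> (ar A u \<cdot> a) = s \<cdot> (ar A v \<cdot> b)"
  proof (rule fin_biproduct_eq_to[OF S])
    fix x assume x: "x \<in> F"
    have xI: "x \<in> I" using x F by blast
    have "pr x \<cdot> s = (\<pi> x k \<cdot> t) \<cdot> s"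
      using pi_sum_inclusion[OF S F(2) t cov xI] x by simp
    also have "\<dots> = \<pi> x k \<cdot> ar A w"
      unfolding wts by (rule Comp_assoc') (use s t' pi_mor[OF xI k(1)] in simp_all)
    also have "\<dots> = \<pi> x i"
      by (rule pi_natural[OF xI i(1) k])
    finally have prs: "pr x \<cdot> s = \<pi> x i" .
    have "pr x \<cdot> (s \<cdot> (ar A u \<cdot> a)) = \<pi> x j \<cdot> a"
      using Comp_reassoc[OF prs, of "ar A u \<cdot> a"] Comp_reassoc[OF pi_natural[OF xI a'(1)
          i(1,2)], of a]
        s SD(6,7)[OF x] a' au pi_mor[OF xI i(1)] by simp
    moreover have "pr x \<cdot> (s \<cdot> (ar A v \<cdot> b)) = \<pi> x j' \<cdot> b"
      using Comp_reassoc[OF prs, of "ar A v \<cdot> b"] Comp_reassoc[OF pi_natural[OF xI b'(1)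
          i(1,3)], of b]
        s SD(6,7)[OF x] b' av pi_mor[OF xI i(1)] by simp
    ultimately show "pr x \<cdot> (s \<cdot> (ar A u \<cdot> a)) = pr x \<cdot> (s \<cdot> (ar A v \<cdot> b))"
      using eq[OF xI] by simp
  qed (use s au av a' b' in simp_all)
  then have "t \<cdot> (s \<cdot> (ar A u \<cdot> a)) = t \<cdot> (s \<cdot> (ar A v \<cdot> b))"
    by (rule arg_cong)
  then have "(ar A w \<cdot> ar A u) \<cdot> a = (ar A w \<cdot> ar A v) \<cdot> b"
    unfolding wts using s t' au av a' b' by simp
  moreover have "ar A (w \<cdot>\<^bsub>ix A\<^esub> u) = ar A w \<cdot> ar A u" "ar A (w \<cdot>\<^bsub>ix A\<^esub> v) = ar A w \<cdot> ar A v"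
    using ind_objectD(6)[OF A_obj a'(1) i(1) k(1) i(2) k(2)] ind_objectD(6)[OF A_obj b'(1) i(1) k(1)
        i(3) k(2)] .
  ultimately have "ar A (w \<cdot>\<^bsub>ix A\<^esub> u) \<cdot> a = ar A (w \<cdot>\<^bsub>ix A\<^esub> v) \<cdot> b"
    by (simp only:)
  moreover have "w \<cdot>\<^bsub>ix A\<^esub> u \<in> Hom (ix A) j k" "w \<cdot>\<^bsub>ix A\<^esub> v \<in> Hom (ix A) j' k"
    using J.Comp_closed[OF a'(1) i(1) k(1) i(2) k(2)] J.Comp_closed[OF b'(1) i(1) k(1) i(3) k(2)] .
  ultimately show ?thesis
    using germ_iff[OF A_obj a] b k(1) by blast
qed

text \<open>
  A finitely supported family of morphisms comes from the finite partial sum over its support.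
\<close>

lemma ex_element_with_projections:
  assumes W: "W \<in> Ob C" and f: "\<And>x. x \<in> I \<Longrightarrow> mor (f x) \<and> source (f x) = W \<and> target (f x) = E x"
    and fin: "finite {x \<in> I. f x \<noteq> hzero C W (E x)}"
  shows "\<exists>e. represents W A e \<and> (\<forall>x\<in>I. \<pi> x (fst e) \<cdot> snd e = f x)"
proof -
  let ?F = "{x \<in> I. f x \<noteq> hzero C W (E x)}"
  have FI: "?F \<subseteq> I" by blast
  obtain S inc pr where S: "fin_biproduct ?F E S inc pr"
    using ex_fin_biproduct[OF fin, of E] E_Ob by blast
  note SD = fin_biproductD[OF S]
  obtain k t where t: "represents S A (k, t)" and c: "\<forall>x\<in>?F. (k, t \<cdot> inc x) \<in> cls (\<iota> x) Star"
    by (rule ex_sum_inclusion[OF S fin FI])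
  note cov = bspec[OF c]
  obtain h where h: "mor h" "source h = W" "target h = S" "\<And>x. x \<in> ?F \<Longrightarrow> pr x \<cdot> h = f x"
    by (rule fin_biproduct_ex_to[OF S fin W, of f]) (use f in auto)
  have t': "k \<in> Ob (ix A)" "mor t" "source t = S" "target t = ob A k"
    using t by (simp_all add: represents_def)
  have "\<pi> x k \<cdot> (t \<cdot> h) = f x" if x: "x \<in> I" for x
  proof -
    have "\<pi> x k \<cdot> (t \<cdot> h) = (\<pi> x k \<cdot> t) \<cdot> h"
      by (rule Comp_assoc'[symmetric]) (use h t' pi_mor[OF x t'(1)] in simp_all)
    also have "\<dots> = (if x \<in> ?F then pr x else hzero C S (E x)) \<cdot> h"
      by (simp only: pi_sum_inclusion[OF S FI t cov x])
    also have "\<dots> = f x"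
    proof (cases "x \<in> ?F")
      case True
      then show ?thesis using h(4) by simp
    next
      case False
      then have "f x = hzero C W (E x)" using x by blast
      then show ?thesis using False h(1-3) E_Ob[OF x] by simp
    qed
    finally show ?thesis .
  qed
  moreover have "represents W A (k, t \<cdot> h)"
    using t' h by (simp add: represents_def)
  ultimately show ?thesis
    by (intro exI[of _ "(k, t \<cdot> h)"]) simp
qed

end

section \<open>Coproducts with a perfect pairing\<close>

text \<open>
  What the multiplication of a simple current algebra contributes to the argument: \<open>\<beta>\<close> is \<open>\<lambda>\<mu>\<close>,
  and \<open>dual\<close> is inversion in \<open>\<Gamma>\<close>.
\<close>

locale dual_summands = ind_coproduct U K C I E A \<iota>
  for U :: "'u itself" and K :: "('k, 'r) ring_scheme"
    and C :: "('k, 'o, 'm, 'z) lin_moncat_scheme" (structure)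
    and I :: "'i set" and E A \<iota> +
  fixes \<beta> :: "('u, 'o, 'm) ind_mor" and dual :: "'i \<Rightarrow> 'i" and m :: "'i \<Rightarrow> 'm"
  assumes beta: "\<beta> \<in> ind_Hom C (ind_tensor C A A) (const_ind C (Unit C))"
    and dual_closed: "y \<in> I \<Longrightarrow> dual y \<in> I" and dual_dual: "y \<in> I \<Longrightarrow> dual (dual y) = y"
    and m_iso: "y \<in> I \<Longrightarrow> is_iso C (E (dual y) \<boxtimes> E y) (Unit C) (m y)"
    and beta_iota: "\<lbrakk>x \<in> I; y \<in> I; (j, c) \<in> cls (\<iota> x) Star; (k, d) \<in> cls (\<iota> y) Star\<rbrakk> \<Longrightarrow>
      component \<beta> (Pair j k) \<cdot> (c \<star> d) = (if x = dual y then m y else hzero C (E x \<boxtimes> E y) (Unit C))"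
    and finite_Hom: "W \<in> Ob C \<Longrightarrow> finite {x \<in> I. \<exists>f\<in>Hom C W (E x). f \<noteq> hzero C W (E x)}"
begin

lemma AA_obj: "ind_object C (ind_tensor C A A)"
  by (rule ind_tensor_object[OF A_obj A_obj])

lemma m_mor:
  assumes "y \<in> I"
  shows "mor (m y)" "source (m y) = E (dual y) \<boxtimes> E y" "target (m y) = Unit C"
  by (rule is_iso_obtain[OF m_iso[OF assms]]; use E_Ob dual_closed assms in simp)+

lemma m_universal:
  assumes y: "y \<in> I" and W: "W \<in> Ob C" and f: "f \<in> Hom C (W \<boxtimes> E y) (Unit C)"
  shows "\<exists>!g. g \<in> Hom C W (E (dual y)) \<and> m y \<cdot> (g \<star> Idn C (E y)) = f"
  using pairing_invertible_universal[OF _ m_iso[OF y] E_Ob[OF y] E_Ob[OF dual_closed[OF y]] W f]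
    m_iso[OF dual_closed[OF y]] dual_dual[OF y] by simp

lemma b_mor:
  assumes "j \<in> Ob (ix A)" "k \<in> Ob (ix A)"
  shows "mor (component \<beta> (Pair j k))" "source (component \<beta> (Pair j k)) = ob A j \<boxtimes> ob A k"
    "target (component \<beta> (Pair j k)) = Unit C"
  using component(2-4)[OF beta AA_obj Unit_closed, of "Pair j k"] assms by simp_all

lemma b_natural_left:
  assumes "i \<in> Ob (ix A)" "j \<in> Ob (ix A)" "u \<in> Hom (ix A) i j" "k \<in> Ob (ix A)"
  shows "component \<beta> (Pair j k) \<cdot> (ar A u \<star> Idn C (ob A k)) = component \<beta> (Pair i k)"
proof -
  interpret J: category "ix A" by (rule ind_objectD(1)[OF A_obj])
  have "Pair u (Idn (ix A) k) \<in> Hom (ix (ind_tensor C A A)) (Pair i k) (Pair j k)"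
    using assms(3) J.Idn_closed[OF assms(4)] by simp
  from component_natural[OF beta AA_obj Unit_closed _ _ this] show ?thesis
    using assms ind_objectD(4)[OF A_obj assms(4)] by simp
qed

text \<open>
  On \<open>A \<otimes> E y\<close> the pairing is the projection to the dual summand followed by \<open>m y\<close>, because the
  two agree on each \<open>E x \<otimes> E y\<close>.
\<close>

lemma b_iota_right:
  assumes j: "j \<in> Ob (ix A)" and y: "y \<in> I" and d: "(k, d) \<in> cls (\<iota> y) Star"
  shows "component \<beta> (Pair j k) \<cdot> (Idn C (ob A j) \<star> d) = m y \<cdot> (\<pi> (dual y) j \<star> Idn C (E y))"
proof (rule jointly_epic[OF linear_functor_TensM_right[OF E_Ob[OF y]], where i = j
    and Z = "Unit C" and
      h = "\<lambda>j. component \<beta> (Pair j k) \<cdot> (Idn C (ob A j) \<star> d)"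
          and h' = "\<lambda>j. m y \<cdot> (\<pi> (dual y) j \<star> Idn C (E y))"])
  note D = iota_mem[OF y d] and y' = dual_closed[OF y]
  show "mor (component \<beta> (Pair i k) \<cdot> (Idn C (ob A i) \<star> d)) \<and>
      source (component \<beta> (Pair i k) \<cdot> (Idn C (ob A i) \<star> d)) = ob A i \<boxtimes> E y \<and>
      target (component \<beta> (Pair i k) \<cdot> (Idn C (ob A i) \<star> d)) = Unit C" if "i \<in> Ob (ix A)" for i
    using b_mor[OF that D(1)] D(2-4) ind_objectD(3)[OF A_obj that] by simp
  show "mor (m y \<cdot> (\<pi> (dual y) i \<star> Idn C (E y))) \<and> source (m y \<cdot> (\<pi> (dual y) i \<star> Idn C (E y)))
      = ob A i \<boxtimes> E y \<and>
      target (m y \<cdot> (\<pi> (dual y) i \<star> Idn C (E y))) = Unit C" if "i \<in> Ob (ix A)" for i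
    using m_mor[OF y] pi_mor[OF y' that] E_Ob[OF y] by simp
  fix i l u assume u: "i \<in> Ob (ix A)" "l \<in> Ob (ix A)" "u \<in> Hom (ix A) i l"
  note au = ind_objectD(5)[OF A_obj u]
  have "(Idn C (ob A l) \<star> d) \<cdot> (ar A u \<star> Idn C (E y)) = (ar A u \<star> Idn C (ob A k)) \<cdot> (Idn C (ob A i)
      \<star> d)"
    using au D(1-4) ind_objectD(3)[OF A_obj] u E_Ob[OF y] by (simp add: interchange)
  then show "(component \<beta> (Pair l k) \<cdot> (Idn C (ob A l) \<star> d)) \<cdot> (ar A u \<star> Idn C (E y))
      = component \<beta> (Pair i k) \<cdot> (Idn C (ob A i) \<star> d)"
    using Comp_reassoc[OF b_natural_left[OF u D(1)], of "Idn C (ob A i) \<star> d"] b_mor[OF u(2) D(1)]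
        b_mor[OF u(1) D(1)]
      au D(1-4) ind_objectD(3)[OF A_obj] u E_Ob[OF y] by simp
  show "(m y \<cdot> (\<pi> (dual y) l \<star> Idn C (E y))) \<cdot> (ar A u \<star> Idn C (E y))
      = m y \<cdot> (\<pi> (dual y) i \<star> Idn C (E y))"
    using m_mor[OF y] pi_mor[OF y' u(2)] pi_natural[OF y' u] au E_Ob[OF y]
        by (simp add: interchange)
next
  note D = iota_mem[OF y d] and y' = dual_closed[OF y]
  fix x i c assume x: "x \<in> I" and c: "(i, c) \<in> cls (\<iota> x) Star"
  note G = iota_mem[OF x c]
  have "(component \<beta> (Pair i k) \<cdot> (Idn C (ob A i) \<star> d)) \<cdot> (c \<star> Idn C (E y))
      = component \<beta> (Pair i k) \<cdot> (c \<star> d)"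
    using b_mor[OF G(1) D(1)] D(1-4) G(1-4) ind_objectD(3)[OF A_obj G(1)] E_Ob[OF y]
        by (simp add: interchange)
  also have "\<dots> = (if x = dual y then m y else hzero C (E x \<boxtimes> E y) (Unit C))"
    by (rule beta_iota[OF x y c d])
  also have "\<dots> = m y \<cdot> ((if dual y = x then Idn C (E (dual y)) else hzero C (E x) (E (dual y)))
      \<star> Idn C (E y))"
    using m_mor[OF y] E_Ob[OF y] E_Ob[OF x] E_Ob[OF y'] by auto
  also have "\<dots> = m y \<cdot> ((\<pi> (dual y) i \<cdot> c) \<star> Idn C (E y))"
    by (simp only: pi_iota[OF y' x c])
  also have "\<dots> = (m y \<cdot> (\<pi> (dual y) i \<star> Idn C (E y))) \<cdot> (c \<star> Idn C (E y))"
    using m_mor[OF y] pi_mor[OF y' G(1)] G(1-4) E_Ob[OF y] by (simp add: interchange)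
  finally show "(component \<beta> (Pair i k) \<cdot> (Idn C (ob A i) \<star> d)) \<cdot> (c \<star> Idn C (E y))
      = (m y \<cdot> (\<pi> (dual y) i \<star> Idn C (E y))) \<cdot> (c \<star> Idn C (E y))" .
qed (rule j)

lemma b_element_iota:
  assumes a: "represents W A (j, a)" and y: "y \<in> I" and d: "(k, d) \<in> cls (\<iota> y) Star"
  shows "(component \<beta> (Pair j k) \<cdot> (a \<star> Idn C (ob A k))) \<cdot> (Idn C W \<star> d)
    = m y \<cdot> ((\<pi> (dual y) j \<cdot> a) \<star> Idn C (E y))"
proof -
  note D = iota_mem[OF y d] and y' = dual_closed[OF y]
  have a': "j \<in> Ob (ix A)" "mor a" "source a = W" "target a = ob A j" "W \<in> Ob C"
    using a by (auto simp: represents_def)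
  have "(component \<beta> (Pair j k) \<cdot> (a \<star> Idn C (ob A k))) \<cdot> (Idn C W \<star> d)
      = component \<beta> (Pair j k) \<cdot> ((Idn C (ob A j) \<star> d) \<cdot> (a \<star> Idn C (E y)))"
    using b_mor[OF a'(1) D(1)] a' D(1-4) ind_objectD(3)[OF A_obj] E_Ob[OF y]
        by (simp add: interchange)
  also have "\<dots> = (component \<beta> (Pair j k) \<cdot> (Idn C (ob A j) \<star> d)) \<cdot> (a \<star> Idn C (E y))"
    by (rule Comp_assoc'[symmetric])
      (use b_mor[OF a'(1) D(1)] a' D(1-4) ind_objectD(3)[OF A_obj] E_Ob[OF y] in simp_all)
  also have "\<dots> = (m y \<cdot> (\<pi> (dual y) j \<star> Idn C (E y))) \<cdot> (a \<star> Idn C (E y))"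
    by (simp only: b_iota_right[OF a'(1) y d])
  also have "\<dots> = m y \<cdot> ((\<pi> (dual y) j \<cdot> a) \<star> Idn C (E y))"
    using m_mor[OF y] pi_mor[OF y' a'(1)] a' E_Ob[OF y] by (simp add: interchange)
  finally show ?thesis .
qed

text \<open>
  Given \<open>f : X \<otimes> A \<rightarrow> 1\<close>, its restriction to \<open>X\<^sub>i \<otimes> E y\<close> corresponds to a morphism \<open>\<gamma> i y\<close> from
  \<open>X\<^sub>i\<close> to the dual summand. A morphism \<open>g : X \<rightarrow> A\<close> is a transpose of \<open>f\<close> if and only if its
  projections are the \<open>\<gamma> i y\<close>. Such a \<open>g\<close> exists since only finitely many \<open>\<gamma> i y\<close> are nonzero
  for each \<open>i\<close>, and there is at most one since projections determine a morphism into \<open>A\<close>.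
\<close>

lemma internal_hom_A: "internal_hom (Ind C) A (const_ind C (Unit C)) A \<beta>"
proof -
  let ?idA = "ind_map C A A (\<lambda>i. (i, Idn C (ob A i)))"
  have "\<exists>!g. g \<in> ind_Hom C X A \<and> ind_comp C \<beta> (ind_tensor_mor C g ?idA) = f"
    if X: "ind_object C X" and f: "f \<in> ind_Hom C (ind_tensor C X A) (const_ind C (Unit C))" for X f
  proof -
    interpret XI: category "ix X" by (rule ind_objectD(1)[OF X])
    interpret AI: category "ix A" by (rule ind_objectD(1)[OF A_obj])
    note XA = ind_tensor_object[OF X A_obj]
    have idA: "?idA \<in> ind_Hom C A A" by (rule ind_Idn(1)[OF A_obj])
    let ?\<phi> = "\<lambda>i k. component f (Pair i k)"
    have \<phi>: "mor (?\<phi> i k)" "source (?\<phi> i k) = ob X i \<boxtimes> ob A k" "target (?\<phi> i k) = Unit C"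
      if "i \<in> Ob (ix X)" "k \<in> Ob (ix A)" for i k
      using component(2-4)[OF f XA Unit_closed, of "Pair i k"] that by simp_all
    have \<phi>_nat: "?\<phi> i' k' \<cdot> (ar X u \<star> ar A v) = ?\<phi> i k"
      if "i \<in> Ob (ix X)" "i' \<in> Ob (ix X)" "u \<in> Hom (ix X) i i'"
        "k \<in> Ob (ix A)" "k' \<in> Ob (ix A)" "v \<in> Hom (ix A) k k'" for i i' u k k' v
      using component_natural[OF f XA Unit_closed, of "Pair i k" "Pair i' k'" "Pair u v"] that
          by simp
    have \<phi>_nat_right: "?\<phi> i k' \<cdot> (Idn C (ob X i) \<star> ar A v) = ?\<phi> i k"
      if "i \<in> Ob (ix X)" "k \<in> Ob (ix A)" "k' \<in> Ob (ix A)" "v \<in> Hom (ix A) k k'" for i k k' v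
      using \<phi>_nat[OF that(1,1) XI.Idn_closed[OF that(1)] that(2-4)] ind_objectD(4)[OF X that(1)]
          by simp
    have \<phi>_nat_left: "?\<phi> i' k \<cdot> (ar X u \<star> Idn C (ob A k)) = ?\<phi> i k"
      if "i \<in> Ob (ix X)" "i' \<in> Ob (ix X)" "u \<in> Hom (ix X) i i'" "k \<in> Ob (ix A)" for i i' u k
      using \<phi>_nat[OF that(1-4,4) AI.Idn_closed[OF that(4)]] ind_objectD(4)[OF A_obj that(4)] by simp
    \<comment> \<open>The restriction of \<open>f\<close> to \<open>X\<^sub>i \<otimes> E y\<close> can be computed with any representative of \<open>\<iota> y\<close>.\<close>
    have indep: "?\<phi> i k \<cdot> (Idn C (ob X i) \<star> d) = ?\<phi> i k' \<cdot> (Idn C (ob X i) \<star> d')"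
      if i: "i \<in> Ob (ix X)" and y: "y \<in> I" and d: "(k, d) \<in> cls (\<iota> y) Star"
          and d': "(k', d') \<in> cls (\<iota> y) Star"
      for i y k d k' d'
    proof -
      note D = iota_mem[OF y d] and D' = iota_mem[OF y d']
      obtain l u v where l: "l \<in> Ob (ix A)" "u \<in> Hom (ix A) k l" "v \<in> Hom (ix A) k' l" "ar A u \<cdot> d
          = ar A v \<cdot> d'"
        by (rule cls_common[OF iota_Hom[OF y] const_obj[OF E_Ob[OF y]] A_obj d d'])
      have *: "?\<phi> i k0 \<cdot> (Idn C (ob X i) \<star> d0) = ?\<phi> i l \<cdot> (Idn C (ob X i) \<star> (ar A w \<cdot> d0))"
        if w: "w \<in> Hom (ix A) k0 l" and d0: "(k0, d0) \<in> cls (\<iota> y) Star" for k0 w d0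
      proof -
        note D0 = iota_mem[OF y d0]
        note aw = ind_objectD(5)[OF A_obj D0(1) l(1) w]
        have "?\<phi> i l \<cdot> (Idn C (ob X i) \<star> (ar A w \<cdot> d0)) = ?\<phi> i l \<cdot> ((Idn C (ob X i) \<star> ar A w) \<cdot> (Idn
            C (ob X i) \<star> d0))"
          using aw D0(1-4) ind_objectD(3)[OF X i] by (simp add: interchange)
        also have "\<dots> = ?\<phi> i k0 \<cdot> (Idn C (ob X i) \<star> d0)"
          by (rule Comp_reassoc[OF \<phi>_nat_right[OF i D0(1) l(1) w]])
            (use \<phi>[OF i l(1)] aw D0(1-4) ind_objectD(3)[OF X i] in simp_all)
        finally show ?thesis ..
      qed
      show ?thesis
        unfolding *[OF l(2) d] *[OF l(3) d'] l(4) ..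
    qed
    define \<gamma> where "\<gamma> i y = (THE g. g \<in> Hom C (ob X i) (E (dual y)) \<and>
        (\<forall>(k, d)\<in>cls (\<iota> y) Star. m y \<cdot> (g \<star> Idn C (E y)) = ?\<phi> i k \<cdot> (Idn C (ob X i) \<star> d)))" for i y
    have ex1: "\<exists>!g. g \<in> Hom C (ob X i) (E (dual y)) \<and>
        (\<forall>(k, d)\<in>cls (\<iota> y) Star. m y \<cdot> (g \<star> Idn C (E y)) = ?\<phi> i k \<cdot> (Idn C (ob X i) \<star> d))"
      if i: "i \<in> Ob (ix X)" and y: "y \<in> I" for i y
    proof -
      obtain k d where d: "(k, d) \<in> cls (\<iota> y) Star"
        by (rule cls_nonempty[OF iota_Hom[OF y] const_obj[OF E_Ob[OF y]] A_obj, of Star]) simp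
      note D = iota_mem[OF y d]
      have "?\<phi> i k \<cdot> (Idn C (ob X i) \<star> d) \<in> Hom C (ob X i \<boxtimes> E y) (Unit C)"
        using \<phi>[OF i D(1)] D(1-4) ind_objectD(3)[OF X i] E_Ob[OF y] by simp
      from m_universal[OF y ind_objectD(3)[OF X i] this]
      have "\<exists>!g. g \<in> Hom C (ob X i) (E (dual y)) \<and> m y \<cdot> (g \<star> Idn C (E y))
          = ?\<phi> i k \<cdot> (Idn C (ob X i) \<star> d)" .
      moreover have "(m y \<cdot> (g \<star> Idn C (E y)) = ?\<phi> i k \<cdot> (Idn C (ob X i) \<star> d)) \<longleftrightarrow>
          (\<forall>(k, d)\<in>cls (\<iota> y) Star. m y \<cdot> (g \<star> Idn C (E y)) = ?\<phi> i k \<cdot> (Idn C (ob X i) \<star> d))" for g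
      proof
        assume eq: "m y \<cdot> (g \<star> Idn C (E y)) = ?\<phi> i k \<cdot> (Idn C (ob X i) \<star> d)"
        show "\<forall>(k, d)\<in>cls (\<iota> y) Star. m y \<cdot> (g \<star> Idn C (E y)) = ?\<phi> i k \<cdot> (Idn C (ob X i) \<star> d)"
          unfolding eq using indep[OF i y d] by blast
      next
        assume "\<forall>(k, d)\<in>cls (\<iota> y) Star. m y \<cdot> (g \<star> Idn C (E y)) = ?\<phi> i k \<cdot> (Idn C (ob X i) \<star> d)"
        from bspec[OF this d] show "m y \<cdot> (g \<star> Idn C (E y)) = ?\<phi> i k \<cdot> (Idn C (ob X i) \<star> d)"
          by simp
      qed
      ultimately show ?thesis
        by (simp only:)
    qed
    have \<gamma>: "\<gamma> i y \<in> Hom C (ob X i) (E (dual y))"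
      "(k, d) \<in> cls (\<iota> y) Star \<Longrightarrow> m y \<cdot> (\<gamma> i y \<star> Idn C (E y)) = ?\<phi> i k \<cdot> (Idn C (ob X i) \<star> d)"
      if "i \<in> Ob (ix X)" "y \<in> I" for i y k d
      using theI'[OF ex1[OF that]] unfolding \<gamma>_def[symmetric] by blast+
    have \<gamma>_mor: "mor (\<gamma> i y)" "source (\<gamma> i y) = ob X i" "target (\<gamma> i y) = E (dual y)"
      if "i \<in> Ob (ix X)" "y \<in> I" for i y
      using \<gamma>(1)[OF that] ind_objectD(3)[OF X that(1)] E_Ob[OF dual_closed[OF that(2)]] by simp_all
    have \<gamma>_eqI: "g = \<gamma> i y"
      if i: "i \<in> Ob (ix X)" and y: "y \<in> I" and g: "mor g" "source g = ob X i" "target g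
          = E (dual y)"
        and eq: "\<And>k d. (k, d) \<in> cls (\<iota> y) Star \<Longrightarrow> m y \<cdot> (g \<star> Idn C (E y))
            = ?\<phi> i k \<cdot> (Idn C (ob X i) \<star> d)"
      for i y g
    proof -
      have "g \<in> Hom C (ob X i) (E (dual y))"
        using g ind_objectD(3)[OF X i] E_Ob[OF dual_closed[OF y]] by simp
      moreover have "\<forall>(k, d)\<in>cls (\<iota> y) Star. m y \<cdot> (g \<star> Idn C (E y))
          = ?\<phi> i k \<cdot> (Idn C (ob X i) \<star> d)"
        using eq by blast
      ultimately have "g \<in> Hom C (ob X i) (E (dual y)) \<and>
          (\<forall>(k, d)\<in>cls (\<iota> y) Star. m y \<cdot> (g \<star> Idn C (E y)) = ?\<phi> i k \<cdot> (Idn C (ob X i) \<star> d))"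
        by (rule conjI)
      from the1_equality[OF ex1[OF i y] this] show ?thesis
        unfolding \<gamma>_def by (rule sym)
    qed
    have \<gamma>_nat: "\<gamma> i' y \<cdot> ar X u = \<gamma> i y"
      if u: "i \<in> Ob (ix X)" "i' \<in> Ob (ix X)" "u \<in> Hom (ix X) i i'" and y: "y \<in> I" for i i' u y
    proof (rule \<gamma>_eqI[OF u(1) y])
      note au = ind_objectD(5)[OF X u] and g = \<gamma>_mor[OF u(2) y]
      show "mor (\<gamma> i' y \<cdot> ar X u)" "source (\<gamma> i' y \<cdot> ar X u) = ob X i" "target (\<gamma> i' y \<cdot> ar X u)
          = E (dual y)"
        using au g by simp_all
      fix k d assume d: "(k, d) \<in> cls (\<iota> y) Star"
      note D = iota_mem[OF y d]
      have "m y \<cdot> ((\<gamma> i' y \<cdot> ar X u) \<star> Idn C (E y)) = (m y \<cdot> (\<gamma> i' y \<star> Idn C (E y))) \<cdot> (ar X u \<star> Idn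
          C (E y))"
        using au g m_mor[OF y] E_Ob[OF y] by (simp add: interchange)
      also have "\<dots> = (?\<phi> i' k \<cdot> (Idn C (ob X i') \<star> d)) \<cdot> (ar X u \<star> Idn C (E y))"
        by (simp only: \<gamma>(2)[OF u(2) y d])
      also have "\<dots> = ?\<phi> i' k \<cdot> ((ar X u \<star> Idn C (ob A k)) \<cdot> (Idn C (ob X i) \<star> d))"
        using au D(1-4) \<phi>[OF u(2) D(1)] ind_objectD(3)[OF X] u ind_objectD(3)[OF A_obj D(1)]
            E_Ob[OF y]
        by (simp add: interchange)
      also have "\<dots> = ?\<phi> i k \<cdot> (Idn C (ob X i) \<star> d)"
        by (rule Comp_reassoc[OF \<phi>_nat_left[OF u D(1)]])
          (use \<phi>[OF u(2) D(1)] au D(1-4) ind_objectD(3)[OF X] u ind_objectD(3)[OF A_obj D(1)] in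
              simp_all)
      finally show "m y \<cdot> ((\<gamma> i' y \<cdot> ar X u) \<star> Idn C (E y)) = ?\<phi> i k \<cdot> (Idn C (ob X i) \<star> d)" .
    qed
    have comp: "component (ind_comp C \<beta> (ind_tensor_mor C g ?idA)) (Pair i k)
        = component \<beta> (Pair j k) \<cdot> (a \<star> Idn C (ob A k))"
      if g: "g \<in> ind_Hom C X A" and a: "(j, a) \<in> cls g i" and k: "k \<in> Ob (ix A)" for g i j a k
      by (rule component_comp[OF ind_tensor_mor_closed[OF g idA X A_obj A_obj A_obj] beta XA AA_obj
          Unit_closed
            ind_tensor_mor_cls(3)[OF g idA X A_obj A_obj A_obj a ind_Idn(2)[OF A_obj k]]])
    \<comment> \<open>Every transpose of \<open>f\<close> has the projections \<open>\<gamma> i y\<close>.\<close>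
    have solution: "\<pi> (dual y) j \<cdot> a = \<gamma> i y"
      if g: "g \<in> ind_Hom C X A" "ind_comp C \<beta> (ind_tensor_mor C g ?idA) = f"
          and a: "(j, a) \<in> cls g i" and y: "y \<in> I"
      for g i j a y
    proof -
      note G = cls_mem[OF g(1) X A_obj a]
      show ?thesis
      proof (rule \<gamma>_eqI[OF G(1) y])
        show "mor (\<pi> (dual y) j \<cdot> a)" "source (\<pi> (dual y) j \<cdot> a) = ob X i"
            "target (\<pi> (dual y) j \<cdot> a) = E (dual y)"
          using G(4-7) pi_mor[OF dual_closed[OF y] G(4)] by simp_all
        fix k d assume d: "(k, d) \<in> cls (\<iota> y) Star"
        show "m y \<cdot> ((\<pi> (dual y) j \<cdot> a) \<star> Idn C (E y)) = ?\<phi> i k \<cdot> (Idn C (ob X i) \<star> d)"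
          using b_element_iota[OF G(2) y d] comp[OF g(1) a iota_mem(1)[OF y d]] g(2) by simp
      qed
    qed
    have ex_good: "\<exists>e. represents (ob X i) A e \<and> (\<forall>x\<in>I. \<pi> x (fst e) \<cdot> snd e = \<gamma> i (dual x))"
      if i: "i \<in> Ob (ix X)" for i
    proof (rule ex_element_with_projections[OF ind_objectD(3)[OF X i]])
      show *: "mor (\<gamma> i (dual x)) \<and> source (\<gamma> i (dual x)) = ob X i \<and> target (\<gamma> i (dual x)) = E x"
          if "x \<in> I" for x
        using \<gamma>_mor[OF i dual_closed[OF that]] dual_dual[OF that] by simp
      have "{x \<in> I. \<gamma> i (dual x) \<noteq> hzero C (ob X i) (E x)}
          \<subseteq> {x \<in> I. \<exists>f\<in>Hom C (ob X i) (E x). f \<noteq> hzero C (ob X i) (E x)}"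
        using * ind_objectD(3)[OF X i] E_Ob by fastforce
      then show "finite {x \<in> I. \<gamma> i (dual x) \<noteq> hzero C (ob X i) (E x)}"
        by (rule finite_subset) (rule finite_Hom[OF ind_objectD(3)[OF X i]])
    qed
    \<comment> \<open>A morphism from \<open>X\<^sub>i\<close> to some object of \<open>A\<close> with the prescribed projections.\<close>
    define G where "G i = (SOME e. represents (ob X i) A e \<and> (\<forall>x\<in>I. \<pi> x (fst e) \<cdot> snd e
        = \<gamma> i (dual x)))" for i
    have G: "represents (ob X i) A (G i) \<and> (\<forall>x\<in>I. \<pi> x (fst (G i)) \<cdot> snd (G i) = \<gamma> i (dual x))"
      if "i \<in> Ob (ix X)" for i
      unfolding G_def by (rule someI_ex) (rule ex_good[OF that])
    have Gr: "represents (ob X i) A (G i)" if "i \<in> Ob (ix X)" for i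
      using G[OF that] by blast
    have Gn: "(fst (G i'), snd (G i') \<cdot> ar X u) \<in> germ C (ob X i) A (G i)"
      if u: "i \<in> Ob (ix X)" "i' \<in> Ob (ix X)" "u \<in> Hom (ix X) i i'" for i i' u
    proof -
      note au = ind_objectD(5)[OF X u]
      have r: "fst (G i') \<in> Ob (ix A)" "mor (snd (G i'))" "source (snd (G i')) = ob X i'"
          "target (snd (G i')) = ob A (fst (G i'))"
        using Gr[OF u(2)] by (simp_all add: represents_def)
      have "(fst (G i'), snd (G i') \<cdot> ar X u) \<in> germ C (ob X i) A (fst (G i), snd (G i))"
      proof (rule germ_eqI_projections)
        show "represents (ob X i) A (fst (G i), snd (G i))"
          using Gr[OF u(1)] by simp
        show "represents (ob X i) A (fst (G i'), snd (G i') \<cdot> ar X u)"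
          using r au by (simp add: represents_def)
        fix x assume x: "x \<in> I"
        have eqs: "\<pi> x (fst (G i)) \<cdot> snd (G i) = \<gamma> i (dual x)" "\<pi> x (fst (G i')) \<cdot> snd (G i')
            = \<gamma> i' (dual x)"
          using G[OF u(1)] G[OF u(2)] x by blast+
        have "\<pi> x (fst (G i')) \<cdot> (snd (G i') \<cdot> ar X u) = \<gamma> i' (dual x) \<cdot> ar X u"
          by (rule Comp_reassoc[OF eqs(2)]) (use r au pi_mor[OF x r(1)] in simp_all)
        also have "\<dots> = \<gamma> i (dual x)"
          by (rule \<gamma>_nat[OF u dual_closed[OF x]])
        finally show "\<pi> x (fst (G i)) \<cdot> snd (G i) = \<pi> x (fst (G i')) \<cdot> (snd (G i') \<cdot> ar X u)"
          using eqs(1) by simp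
      qed
      then show ?thesis by simp
    qed
    let ?g = "ind_map C X A G"
    have g: "?g \<in> ind_Hom C X A"
      by (rule ind_map_Hom(1)[OF X A_obj Gr Gn])
    have g_cls: "(fst (G i), snd (G i)) \<in> cls ?g i" if "i \<in> Ob (ix X)" for i
      using ind_map_Hom(2)[OF X A_obj Gr Gn that] by simp
    note bg = ind_comp_closed[OF ind_tensor_mor_closed[OF g idA X A_obj A_obj A_obj] beta XA AA_obj
        const_obj[OF Unit_closed]]
    have "ind_comp C \<beta> (ind_tensor_mor C ?g ?idA) = f"
    proof (rule component_eqI[OF bg f XA Unit_closed])
      fix p assume "p \<in> Ob (ix (ind_tensor C X A))"
      then obtain i k where p: "p = Pair i k" and i: "i \<in> Ob (ix X)" and k: "k \<in> Ob (ix A)" by auto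
      let ?j = "fst (G i)" and ?a = "snd (G i)"
      have a: "?j \<in> Ob (ix A)" "mor ?a" "source ?a = ob X i" "target ?a = ob A ?j"
          "represents (ob X i) A (?j, ?a)"
        using Gr[OF i] by (simp_all add: represents_def)
      note Xi = ind_objectD(3)[OF X i]
      have bnat: "component \<beta> (Pair ?j k') \<cdot> (Idn C (ob A ?j) \<star> ar A v) = component \<beta> (Pair ?j k)"
        if v: "k \<in> Ob (ix A)" "k' \<in> Ob (ix A)" "v \<in> Hom (ix A) k k'" for k k' v
        using component_natural[OF beta AA_obj Unit_closed, of "Pair ?j k" "Pair ?j k'"
            "Pair (Idn (ix A) ?j) v"]
          AI.Idn_closed[OF a(1)] a(1) v ind_objectD(4)[OF A_obj a(1)] by simp
      have "component \<beta> (Pair ?j k) \<cdot> (?a \<star> Idn C (ob A k)) = ?\<phi> i k"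
      proof (rule jointly_epic[OF linear_functor_TensM_left[OF Xi], where i = k and Z = "Unit C"
          and h' = "\<lambda>k. ?\<phi> i k" and
            h = "\<lambda>k. component \<beta> (Pair ?j k) \<cdot> (?a \<star> Idn C (ob A k))"])
        show "mor (component \<beta> (Pair ?j k) \<cdot> (?a \<star> Idn C (ob A k))) \<and>
            source (component \<beta> (Pair ?j k) \<cdot> (?a \<star> Idn C (ob A k))) = ob X i \<boxtimes> ob A k \<and>
            target (component \<beta> (Pair ?j k) \<cdot> (?a \<star> Idn C (ob A k))) = Unit C" if "k \<in> Ob (ix A)"
                for k
          using b_mor[OF a(1) that] a ind_objectD(3)[OF A_obj that] by simp
        show "mor (?\<phi> i k) \<and> source (?\<phi> i k) = ob X i \<boxtimes> ob A k \<and> target (?\<phi> i k) = Unit C"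
            if "k \<in> Ob (ix A)" for k
          using \<phi>[OF i that] by simp
        show "?\<phi> i k' \<cdot> (Idn C (ob X i) \<star> ar A v) = ?\<phi> i k"
          if "k \<in> Ob (ix A)" "k' \<in> Ob (ix A)" "v \<in> Hom (ix A) k k'" for k k' v
          by (rule \<phi>_nat_right[OF i that])
        show "(component \<beta> (Pair ?j k') \<cdot> (?a \<star> Idn C (ob A k'))) \<cdot> (Idn C (ob X i) \<star> ar A v)
            = component \<beta> (Pair ?j k) \<cdot> (?a \<star> Idn C (ob A k))"
          if v: "k \<in> Ob (ix A)" "k' \<in> Ob (ix A)" "v \<in> Hom (ix A) k k'" for k k' v
        proof -
          note av = ind_objectD(5)[OF A_obj v]
              and kO = ind_objectD(3)[OF A_obj v(1)] ind_objectD(3)[OF A_obj v(2)]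
            ind_objectD(3)[OF A_obj a(1)]
          have "(component \<beta> (Pair ?j k') \<cdot> (?a \<star> Idn C (ob A k'))) \<cdot> (Idn C (ob X i) \<star> ar A v)
              = component \<beta> (Pair ?j k') \<cdot> ((Idn C (ob A ?j) \<star> ar A v) \<cdot> (?a \<star> Idn C (ob A k)))"
            using b_mor[OF a(1) v(2)] a(1-4) av kO Xi by (simp add: interchange)
          also have "\<dots> = component \<beta> (Pair ?j k) \<cdot> (?a \<star> Idn C (ob A k))"
            by (rule Comp_reassoc[OF bnat[OF v]]) (use b_mor[OF a(1) v(2)] a(1-4) av kO in simp_all)
          finally show ?thesis .
        qed
        fix y k d assume y: "y \<in> I" and d: "(k, d) \<in> cls (\<iota> y) Star"
        have "\<pi> (dual y) ?j \<cdot> ?a = \<gamma> i y"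
          using G[OF i] dual_closed[OF y] dual_dual[OF y] by simp
        then show "(component \<beta> (Pair ?j k) \<cdot> (?a \<star> Idn C (ob A k))) \<cdot> (Idn C (ob X i) \<star> d)
            = ?\<phi> i k \<cdot> (Idn C (ob X i) \<star> d)"
          using b_element_iota[OF a(5) y d] \<gamma>(2)[OF i y d] by simp
      qed (rule k)
      then show "component (ind_comp C \<beta> (ind_tensor_mor C ?g ?idA)) p = component f p"
        using comp[OF g g_cls[OF i] k] p by simp
    qed
    moreover have "g1 = g2" if g1: "g1 \<in> ind_Hom C X A" "ind_comp C \<beta> (ind_tensor_mor C g1 ?idA)
        = f"
      and g2: "g2 \<in> ind_Hom C X A" "ind_comp C \<beta> (ind_tensor_mor C g2 ?idA) = f" for g1 g2
    proof (rule ind_Hom_eqI[OF g1(1) g2(1) X A_obj])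
      fix i assume i: "i \<in> Ob (ix X)"
      obtain j a where a: "(j, a) \<in> cls g1 i" by (rule cls_nonempty[OF g1(1) X A_obj i])
      obtain k b where b: "(k, b) \<in> cls g2 i" by (rule cls_nonempty[OF g2(1) X A_obj i])
      note GA = cls_mem[OF g1(1) X A_obj a] and GB = cls_mem[OF g2(1) X A_obj b]
      have "(k, b) \<in> germ C (ob X i) A (j, a)"
      proof (rule germ_eqI_projections[OF GA(2) GB(2)])
        fix x assume x: "x \<in> I"
        show "\<pi> x j \<cdot> a = \<pi> x k \<cdot> b"
          using solution[OF g1 a dual_closed[OF x]] solution[OF g2 b dual_closed[OF x]]
              dual_dual[OF x] by simp
      qed
      then show "\<exists>e. e \<in> cls g1 i \<and> e \<in> cls g2 i"
        using GA(3) b by blast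
    qed
    ultimately show ?thesis
      using g by blast
  qed
  then show ?thesis
    unfolding internal_hom_def using A_obj beta by simp
qed

end

section \<open>Uniqueness of internal homs, zero morphisms and projections\<close>

context monoidal_category
begin

text \<open>
  Two objects with the same universal property are isomorphic by the transposes of their
  evaluations.
\<close>

lemma internal_hom_comparison_iso:
  fixes A H H0 :: "('u, 'o, 'm) ind_obj"
  assumes A: "ind_object C A" and N: "ind_object C N"
    and H0: "internal_hom (Ind C) A N H0 ev0" and H: "internal_hom (Ind C) A N H ev"
    and \<phi>: "\<phi> \<in> ind_Hom C H0 H"
    and ev\<phi>: "ind_comp C ev (ind_tensor_mor C \<phi> (ind_map C A A (\<lambda>i. (i, Idn C (ob A i))))) = ev0"
  shows "is_iso (Ind C) H0 H \<phi>"
proof -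
  let ?id = "\<lambda>X :: ('u, 'o, 'm) ind_obj. ind_map C X X (\<lambda>i. (i, Idn C (ob X i)))"
  have H0': "ind_object C H0" "ev0 \<in> ind_Hom C (ind_tensor C H0 A) N"
    and H0u: "\<And>X f. \<lbrakk>ind_object C X; f \<in> ind_Hom C (ind_tensor C X A) N\<rbrakk> \<Longrightarrow>
      \<exists>!g. g \<in> ind_Hom C X H0 \<and> ind_comp C ev0 (ind_tensor_mor C g (?id A)) = f"
    using H0 unfolding internal_hom_def by simp_all
  have H': "ind_object C H" "ev \<in> ind_Hom C (ind_tensor C H A) N"
    and Hu: "\<And>X f. \<lbrakk>ind_object C X; f \<in> ind_Hom C (ind_tensor C X A) N\<rbrakk> \<Longrightarrow>
      \<exists>!g. g \<in> ind_Hom C X H \<and> ind_comp C ev (ind_tensor_mor C g (?id A)) = f"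
    using H unfolding internal_hom_def by simp_all
  have idA: "?id A \<in> ind_Hom C A A" by (rule ind_Idn(1)[OF A])
  have T: "ind_object C (ind_tensor C X A)" if "ind_object C X" for X :: "('u, 'o, 'm) ind_obj"
    by (rule ind_tensor_object[OF that A])
  have ten: "ind_tensor_mor C f (?id A) \<in> ind_Hom C (ind_tensor C X A) (ind_tensor C Y A)"
    if "f \<in> ind_Hom C X Y" "ind_object C X" "ind_object C Y" for f X Y
    by (rule ind_tensor_mor_closed[OF that(1) idA that(2,3) A A])
  have comp: "ind_comp C e (ind_tensor_mor C (ind_comp C g f) (?id A))
      = ind_comp C (ind_comp C e (ind_tensor_mor C g (?id A))) (ind_tensor_mor C f (?id A))"
    if f: "f \<in> ind_Hom C X Y" and g: "g \<in> ind_Hom C Y Z" and e: "e \<in> ind_Hom C (ind_tensor C Z A) N"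
      and X: "ind_object C X" and Y: "ind_object C Y" and Z: "ind_object C Z" for e f g X Y Z
  proof -
    have "ind_tensor_mor C (ind_comp C g f) (ind_comp C (?id A) (?id A))
        = ind_comp C (ind_tensor_mor C g (?id A)) (ind_tensor_mor C f (?id A))"
      by (rule ind_tensor_mor_comp[OF f g idA idA X Y Z A A A])
    then have 1: "ind_tensor_mor C (ind_comp C g f) (?id A)
        = ind_comp C (ind_tensor_mor C g (?id A)) (ind_tensor_mor C f (?id A))"
      by (simp only: ind_comp_Idn(1)[OF idA A A])
    show ?thesis
      unfolding 1 by (rule ind_comp_assoc[OF ten[OF f X Y] ten[OF g Y Z] e T[OF X] T[OF Y] T[OF Z]
          N, symmetric])
  qed
  have unit: "ind_comp C e (ind_tensor_mor C (?id X) (?id A)) = e"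
    if "e \<in> ind_Hom C (ind_tensor C X A) N" "ind_object C X" for e X
    unfolding ind_tensor_mor_Idn[OF that(2) A] by (rule ind_comp_Idn(1)[OF that(1) T[OF that(2)] N])
  obtain \<psi> where \<psi>: "\<psi> \<in> ind_Hom C H H0" "ind_comp C ev0 (ind_tensor_mor C \<psi> (?id A)) = ev"
    using ex1_implies_ex[OF H0u[OF H'(1,2)]] by blast
  note \<psi>\<phi> = ind_comp_closed[OF \<phi> \<psi>(1) H0'(1) H'(1) H0'(1)]
      and \<phi>\<psi> = ind_comp_closed[OF \<psi>(1) \<phi> H'(1) H0'(1) H'(1)]
  have "ind_comp C ev0 (ind_tensor_mor C (ind_comp C \<psi> \<phi>) (?id A)) = ev0"
    unfolding comp[OF \<phi> \<psi>(1) H0'(2) H0'(1) H'(1) H0'(1)] \<psi>(2) by (rule ev\<phi>)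
  then have "ind_comp C \<psi> \<phi> = ?id H0"
    using H0u[OF H0'] \<psi>\<phi> unit[OF H0'(2,1)] ind_Idn(1)[OF H0'(1)] by blast
  moreover have "ind_comp C ev (ind_tensor_mor C (ind_comp C \<phi> \<psi>) (?id A)) = ev"
    unfolding comp[OF \<psi>(1) \<phi> H'(2) H'(1) H0'(1) H'(1)] ev\<phi> by (rule \<psi>(2))
  then have "ind_comp C \<phi> \<psi> = ?id H"
    using Hu[OF H'] \<phi>\<psi> unit[OF H'(2,1)] ind_Idn(1)[OF H'(1)] by blast
  ultimately show ?thesis
    unfolding is_iso_def inverse_mor_def using \<phi> \<psi>(1) by auto
qed

lemma const_tensor_iso_component:
  fixes f :: "('u, 'o, 'm) ind_mor"
  assumes f: "is_iso (Ind C) (ind_tensor C (const_ind C V) (const_ind C W)) (const_ind C Z) f"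
    and V: "V \<in> Ob C" and W: "W \<in> Ob C" and Z: "Z \<in> Ob C"
  shows "is_iso C (V \<boxtimes> W) Z (component f (Pair Star Star))"
proof -
  let ?T = "ind_tensor C (const_ind C V) (const_ind C W) :: ('u, 'o, 'm) ind_obj"
  let ?Z = "const_ind C Z :: ('u, 'o, 'm) ind_obj" and ?p = "Pair Star Star :: 'u index"
  have T: "ind_object C ?T"
    by (rule ind_tensor_object[OF const_ind_object[OF V] const_ind_object[OF W]])
  have Zi: "ind_object C ?Z" by (rule const_ind_object[OF Z])
  obtain g where f': "f \<in> ind_Hom C ?T ?Z" and g: "g \<in> ind_Hom C ?Z ?T"
      and gf: "ind_comp C g f = ind_map C ?T ?T (\<lambda>i. (i, Idn C (ob ?T i)))"
      and fg: "ind_comp C f g = ind_map C ?Z ?Z (\<lambda>i. (i, Idn C (ob ?Z i)))"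
    using f unfolding is_iso_def inverse_mor_def by auto
  have p: "?p \<in> Ob (ix ?T)" by simp
  note F = component[OF f' T Z p]
  have F_cls: "(Star, component f ?p) \<in> cls f ?p"
    using F(1) by simp
  obtain q b where b: "(q, b) \<in> cls g Star"
    by (rule cls_nonempty[OF g Zi T, of Star]) simp
  note G = cls_mem[OF g Zi T b]
  have q: "q = ?p" using G(4) by simp
  have "component (ind_comp C f g) Star = component f ?p \<cdot> b"
    using component_comp[OF g f' Zi T Z b] q by simp
  moreover have "component (ind_comp C f g) Star = Idn C Z"
    unfolding fg using ind_Idn(2)[OF Zi, of Star] component(1)[OF ind_Idn(1)[OF Zi] Zi Z, of Star]
        by simp
  ultimately have 1: "component f ?p \<cdot> b = Idn C Z" by simp
  have "(?p, b \<cdot> component f ?p) \<in> cls (ind_comp C g f) ?p"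
    using ind_comp_cls(3)[OF f' g T Zi T F_cls b] q by simp
  moreover have "(?p, Idn C (V \<boxtimes> W)) \<in> cls (ind_comp C g f) ?p"
    unfolding gf using ind_Idn(2)[OF T p] by simp
  ultimately obtain k u v where k: "k \<in> Ob (ix ?T)" "u \<in> Hom (ix ?T) ?p k" "v \<in> Hom (ix ?T) ?p k"
      "ar ?T u \<cdot> (b \<cdot> component f ?p) = ar ?T v \<cdot> Idn C (V \<boxtimes> W)"
    using cls_common[OF ind_comp_closed[OF f' g T Zi T] T T] by blast
  have "k = ?p" using k(1) by simp
  then have "u = ?p" "v = ?p" using k(2,3) by simp_all
  then have 2: "b \<cdot> component f ?p = Idn C (V \<boxtimes> W)"
    using k(4) F G(5-7) V W q by simp
  show ?thesis
    by (rule is_isoI[OF _ Z _ _ 2 1]) (use F G(5-7) V W Z q in simp_all)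
qed

end

context tensor_category
begin

lemma zero_object_const_ind:
  assumes Z: "zero_object C Z"
  shows "zero_object (Ind C) (const_ind C Z :: ('u, 'o, 'm) ind_obj)"
proof -
  let ?Z = "const_ind C Z :: ('u, 'o, 'm) ind_obj"
  have ZO: "Z \<in> Ob C" using Z by (simp add: zero_object_iff)
  have to_Z: "f = hzero C (source f) Z" if "mor f" "target f = Z" for f
  proof -
    have "\<exists>!g. g \<in> Hom C (source f) Z"
      using Z source_closed[OF that(1)] unfolding zero_object_def by blast
    moreover have "f \<in> Hom C (source f) Z" "hzero C (source f) Z \<in> Hom C (source f) Z"
      using that ZO by simp_all
    ultimately show ?thesis by blast
  qed
  have from_Z: "f = hzero C Z (target f)" if "mor f" "source f = Z" for f
  proof -
    have "\<exists>!g. g \<in> Hom C Z (target f)"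
      using Z target_closed[OF that(1)] unfolding zero_object_def by blast
    moreover have "f \<in> Hom C Z (target f)" "hzero C Z (target f) \<in> Hom C Z (target f)"
      using that ZO by simp_all
    ultimately show ?thesis by blast
  qed
  have Zi: "ind_object C ?Z" by (rule const_ind_object[OF ZO])
  have "(\<exists>!f. f \<in> ind_Hom C X ?Z) \<and> (\<exists>!f. f \<in> ind_Hom C ?Z X)" if X: "ind_object C X"
      for X :: "('u, 'o, 'm) ind_obj"
  proof
    have "\<exists>f. f \<in> ind_Hom C X ?Z"
      by (rule to_const[OF X ZO, of "\<lambda>j. hzero C (ob X j) Z"])
        (use ind_objectD(3,5)[OF X] ZO in auto)
    moreover have "f = g" if f: "f \<in> ind_Hom C X ?Z" and g: "g \<in> ind_Hom C X ?Z" for f g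
      by (rule component_eqI[OF f g X ZO])
        (use to_Z component(2-4)[OF f X ZO] component(2-4)[OF g X ZO] in metis)
    ultimately show "\<exists>!f. f \<in> ind_Hom C X ?Z" by blast
    obtain j where j: "j \<in> Ob (ix X)"
      using ind_objectD(2)[OF X] unfolding filtered_def by blast
    have "represents Z X (j, hzero C Z (ob X j))"
      using j ZO ind_objectD(3)[OF X j] by (simp add: represents_def)
    then have "\<exists>f. f \<in> ind_Hom C ?Z X"
      using from_const[OF X] by metis
    moreover have "f = g" if f: "f \<in> ind_Hom C ?Z X" and g: "g \<in> ind_Hom C ?Z X" for f g
    proof (rule ind_Hom_eqI[OF f g Zi X])
      fix i assume i: "i \<in> Ob (ix ?Z)"
      obtain j a where a: "(j, a) \<in> cls f i" by (rule cls_nonempty[OF f Zi X i])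
      obtain k b where b: "(k, b) \<in> cls g i" by (rule cls_nonempty[OF g Zi X i])
      note Aa = cls_mem[OF f Zi X a] and Bb = cls_mem[OF g Zi X b]
      obtain l u v where l: "l \<in> Ob (ix X)" "u \<in> Hom (ix X) j l" "v \<in> Hom (ix X) k l"
        by (rule ind_join[OF X Aa(4) Bb(4)])
      have ab: "a = hzero C Z (ob X j)" "b = hzero C Z (ob X k)"
        using from_Z[of a] from_Z[of b] Aa(5-7) Bb(5-7) by simp_all
      have "ar X u \<cdot> a = ar X v \<cdot> b"
        unfolding ab using ind_objectD(5)[OF X Aa(4) l(1,2)] ind_objectD(5)[OF X Bb(4) l(1,3)] ZO
            by simp
      then have "(k, b) \<in> cls f i"
        by (rule cls_absorb[OF f Zi X a Bb(2) l])
      then show "\<exists>e. e \<in> cls f i \<and> e \<in> cls g i" using b by blast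
    qed
    ultimately show "\<exists>!f. f \<in> ind_Hom C ?Z X" by blast
  qed
  then show ?thesis
    unfolding zero_object_def using Zi by simp
qed

text \<open>
  A zero morphism of the ind-completion may pass through any zero object \<open>Y\<close> there. The identity
  of \<open>Y\<close> factors through the constant ind-object on a zero object of \<open>C\<close>, which reduces the
  claim to \<open>C\<close>.
\<close>

lemma zero_mor_const_ind_iff:
  fixes p :: "('u, 'o, 'm) ind_mor"
  assumes V: "V \<in> Ob C" and W: "W \<in> Ob C" and p: "p \<in> ind_Hom C (const_ind C V) (const_ind C W)"
  shows "zero_mor (Ind C) (const_ind C V) (const_ind C W) p \<longleftrightarrow> component p Star = hzero C V W"
proof -
  let ?V = "const_ind C V :: ('u, 'o, 'm) ind_obj" and ?W = "const_ind C W :: ('u, 'o, 'm) ind_obj"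
  note Vi = const_ind_object[OF V, where ?'a = 'u] and Wi = const_ind_object[OF W, where ?'a = 'u]
  obtain Z where Z: "zero_object C Z" using ex_zero by blast
  then have ZO: "Z \<in> Ob C" and ZI: "Idn C Z = hzero C Z Z" by (simp_all add: zero_object_iff)
  let ?Z = "const_ind C Z :: ('u, 'o, 'm) ind_obj"
  have Zi: "ind_object C ?Z" by (rule const_ind_object[OF ZO])
  have through: "component (ind_comp C b a) Star = hzero C V W"
    if a: "a \<in> ind_Hom C ?V ?Z" and b: "b \<in> ind_Hom C ?Z ?W" for a b
  proof -
    have S: "Star \<in> Ob (ix ?V)" "Star \<in> Ob (ix ?Z)" by simp_all
    note CA = component[OF a Vi ZO S(1)] and CB = component[OF b Zi W S(2)]
    have "component (ind_comp C b a) Star = component b Star \<cdot> component a Star"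
      by (rule component_comp[OF a b Vi Zi W]) (simp add: CA(1))
    moreover have "zero_mor C V W (component b Star \<cdot> component a Star)"
      unfolding zero_mor_def using CA(2-4) CB(2-4) V W ZO Z
      by (intro exI[of _ Z] exI[of _ "component a Star"] exI[of _ "component b Star"]) simp
    ultimately show ?thesis
      using V W by (simp add: zero_mor_iff)
  qed
  show ?thesis
  proof
    assume "zero_mor (Ind C) ?V ?W p"
    then obtain Y a b where Y: "zero_object (Ind C) Y" and a: "a \<in> ind_Hom C ?V Y"
        and b: "b \<in> ind_Hom C Y ?W"
        and pba: "p = ind_comp C b a"
      unfolding zero_mor_def by auto
    have Yi: "ind_object C Y" using Y by (simp add: zero_object_def)
    have kl: "\<exists>!f. f \<in> ind_Hom C Y ?Z" "\<exists>!f. f \<in> ind_Hom C ?Z Y" and YY: "\<exists>!f. f \<in> ind_Hom C Y Y"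
      using Y Zi Yi unfolding zero_object_def by simp_all
    obtain k where k: "k \<in> ind_Hom C Y ?Z" using kl(1) by blast
    obtain l where l: "l \<in> ind_Hom C ?Z Y" using kl(2) by blast
    have lk: "ind_comp C l k = ind_map C Y Y (\<lambda>i. (i, Idn C (ob Y i)))"
      using YY ind_comp_closed[OF k l Yi Zi Yi] ind_Idn(1)[OF Yi] by blast
    have "p = ind_comp C b (ind_comp C (ind_comp C l k) a)"
      unfolding pba lk ind_comp_Idn(2)[OF a Vi Yi] ..
    also have "\<dots> = ind_comp C (ind_comp C b l) (ind_comp C k a)"
      using ind_comp_assoc[OF a k l Vi Yi Zi Yi] 
        ind_comp_assoc[OF ind_comp_closed[OF a k Vi Yi Zi] l b Vi Zi Yi Wi] by simp
    finally show "component p Star = hzero C V W"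
      using through[OF ind_comp_closed[OF a k Vi Yi Zi] ind_comp_closed[OF l b Zi Yi Wi]] by simp
  next
    assume p0: "component p Star = hzero C V W"
    have ZZ: "zero_object (Ind C) ?Z" by (rule zero_object_const_ind[OF Z])
    then have "\<exists>!a. a \<in> ind_Hom C ?V ?Z" "\<exists>!b. b \<in> ind_Hom C ?Z ?W"
      using Vi Wi unfolding zero_object_def by simp_all
    then obtain a b where a: "a \<in> ind_Hom C ?V ?Z" and b: "b \<in> ind_Hom C ?Z ?W" by blast
    have "p = ind_comp C b a"
      by (rule component_eqI[OF p ind_comp_closed[OF a b Vi Zi Wi] Vi W])
        (use p0 through[OF a b] in simp)
    then show "zero_mor (Ind C) ?V ?W p"
      unfolding zero_mor_def using ZZ a b by auto
  qed
qed

end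

lemma (in ind_coproduct) projection_eq_proj:
  assumes x: "x \<in> I"
  shows "projection (Ind C) I (\<lambda>y. const_ind C (E y)) A \<iota> x = proj x"
proof -
  let ?P = "\<lambda>p. p \<in> ind_Hom C A (const_ind C (E x)) \<and>
     (\<forall>y\<in>I. component (ind_comp C p (\<iota> y)) Star = (if x = y then Idn C (E x) else hzero C (E y) (E
         x)))"
  let ?Q = "\<lambda>p. p \<in> Hom (Ind C) A (const_ind C (E x)) \<and>
     p \<cdot>\<^bsub>Ind C\<^esub> \<iota> x = Idn (Ind C) (const_ind C (E x)) \<and>
     (\<forall>j\<in>I - {x}. zero_mor (Ind C) (const_ind C (E j)) (const_ind C (E x)) (p \<cdot>\<^bsub>Ind C\<^esub> \<iota> j))"
  note Ex = const_obj[OF E_Ob[OF x]]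
  have "?Q p \<longleftrightarrow> ?P p" for p
  proof (cases "p \<in> ind_Hom C A (const_ind C (E x))")
    case p: True
    have pi: "ind_comp C p (\<iota> y) \<in> ind_Hom C (const_ind C (E y)) (const_ind C (E x))" if "y \<in> I"
        for y
      by (rule ind_comp_closed[OF iota_Hom[OF that] p const_obj[OF E_Ob[OF that]] A_obj Ex])
    let ?id = "ind_map C (const_ind C (E x)) (const_ind C (E x)) (\<lambda>i. (i, Idn C (E x))) ::
        ('u, 'o, 'm) ind_mor"
    have id: "?id \<in> ind_Hom C (const_ind C (E x)) (const_ind C (E x))"
        "(Star, Idn C (E x)) \<in> cls ?id Star"
      using ind_Idn(1)[OF Ex] ind_Idn(2)[OF Ex, of Star] by simp_all
    have id_comp: "component ?id Star = Idn C (E x)"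
      using component(1)[OF id(1) Ex E_Ob[OF x], of Star] id(2) by simp
    have "ind_comp C p (\<iota> x) = ?id \<longleftrightarrow> component (ind_comp C p (\<iota> x)) Star = Idn C (E x)"
    proof
      assume c: "component (ind_comp C p (\<iota> x)) Star = Idn C (E x)"
      show "ind_comp C p (\<iota> x) = ?id"
        by (rule component_eqI[OF pi[OF x] id(1) Ex E_Ob[OF x]]) (use c id_comp in simp)
    qed (simp add: id_comp)
    moreover have "zero_mor (Ind C) (const_ind C (E y)) (const_ind C (E x)) (ind_comp C p (\<iota> y)) \<longleftrightarrow>
        component (ind_comp C p (\<iota> y)) Star = hzero C (E y) (E x)" if "y \<in> I" for y
      by (rule zero_mor_const_ind_iff[OF E_Ob[OF that] E_Ob[OF x] pi[OF that]])
    ultimately show ?thesis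
      using p x by auto
  qed simp
  then have "projection (Ind C) I (\<lambda>y. const_ind C (E y)) A \<iota> x = (THE p. ?P p)"
    unfolding projection_def by presburger
  also have "\<dots> = proj x"
    by (rule the1_equality[OF ex1_proj[OF x]]) (use proj[OF x] in blast)
  finally show ?thesis .
qed

section \<open>Simple current algebras\<close>

text \<open>
  Every class contains an element of a small set of representatives of all objects.
\<close>

lemma (in tensor_category) ex_encoding_Inv:
  assumes \<Gamma>: "\<Gamma> \<subseteq> carrier (Inv C)"
  shows "\<exists>e :: 'o set \<Rightarrow> 'u index. inj_on e \<Gamma>"
proof -
  obtain S and e :: "'o \<Rightarrow> 'u index" where e: "inj_on e S" and S: "S \<subseteq> Ob C" "\<And>X. X \<in> Ob C \<Longrightarrow>
      \<exists>Y\<in>S. isomorphic C X Y"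
    using essentially_small unfolding essentially_small_def by blast
  have "\<exists>Y. Y \<in> S \<and> Y \<in> g" if g: "g \<in> \<Gamma>" for g
  proof -
    obtain X where X: "g = iso_class C X" "X \<in> Ob C"
      using Inv_carrier_obtain g \<Gamma> by (metis subsetD)
    obtain Y where "Y \<in> S" "isomorphic C X Y" using S(2)[OF X(2)] by blast
    then show ?thesis
      using X(1) S(1) isomorphic_sym by (auto simp: iso_class_def)
  qed
  then obtain r where r: "\<And>g. g \<in> \<Gamma> \<Longrightarrow> r g \<in> S \<and> r g \<in> g" by metis
  have "inj_on (e \<circ> r) \<Gamma>"
  proof (rule inj_onI)
    fix g h assume g: "g \<in> \<Gamma>" and h: "h \<in> \<Gamma>" and "(e \<circ> r) g = (e \<circ> r) h"
    then have "r g = r h"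
      using inj_onD[OF e] r by simp
    then show "g = h"
      using Inv_carrier_iso_class(1)[of g "r g"] Inv_carrier_iso_class(1)[of h
          "r h"] r[OF g] r[OF h] g h \<Gamma> by auto
  qed
  then show ?thesis by blast
qed

text \<open>
  By associativity in the ind-completion, \<open>\<beta>\<close> restricted to \<open>E x \<otimes> E y\<close> is the isomorphism onto
  \<open>E (xy)\<close> followed by the restriction of \<open>\<lambda>\<close>, which is the identity if \<open>xy = 1\<close> and zero
  otherwise. This provides the data of \<open>dual_summands\<close>.
\<close>

lemma (in tensor_category) simple_current_algebra_frobenius:
  fixes E :: "'o set \<Rightarrow> 'o" and A :: "('u, 'o, 'm) ind_obj"
  assumes "subgroup \<Gamma> (Inv C)" "\<And>g. g \<in> \<Gamma> \<Longrightarrow> E g \<in> g" "E \<one>\<^bsub>Inv C\<^esub> = Unit C"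
    "simple_current_algebra C \<Gamma> E A \<iota> \<mu> \<eta>"
  shows "frobenius_algebra (Ind C) A \<mu> \<eta>
           (projection (Ind C) \<Gamma> (\<lambda>g. const_ind C (E g)) A \<iota> \<one>\<^bsub>Inv C\<^esub>)"
proof -
  let ?G = "Inv C"
  let ?I = "\<lambda>g. const_ind C (E g) :: ('u, 'o, 'm) ind_obj"
  note subgroup = \<open>subgroup \<Gamma> ?G\<close> and E_mem = \<open>\<And>g. g \<in> \<Gamma> \<Longrightarrow> E g \<in> g\<close>
  have \<Gamma>: "\<Gamma> \<subseteq> carrier ?G" and one: "\<one>\<^bsub>?G\<^esub> \<in> \<Gamma>"
    and mult: "\<And>x y. \<lbrakk>x \<in> \<Gamma>; y \<in> \<Gamma>\<rbrakk> \<Longrightarrow> x \<otimes>\<^bsub>?G\<^esub> y \<in> \<Gamma>"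
    using subgroup unfolding subgroup_def by blast+
  have E_class: "g = iso_class C (E g)" and E_Ob: "E g \<in> Ob C" if "g \<in> \<Gamma>" for g
    using Inv_carrier_iso_class[OF subsetD[OF \<Gamma> that] E_mem[OF that]] .
  note sca = \<open>simple_current_algebra C \<Gamma> E A \<iota> \<mu> \<eta>\<close>[unfolded simple_current_algebra_def]
  have alg: "algebra_in (Ind C) A \<mu> \<eta>"
    by (rule conjunct1[OF sca])
  have cop: "is_coproduct (Ind C) \<Gamma> ?I A \<iota>"
    and ex_m: "\<And>x y. \<lbrakk>x \<in> \<Gamma>; y \<in> \<Gamma>\<rbrakk> \<Longrightarrow> \<exists>m. is_iso (Ind C) (ind_tensor C (?I x) (?I y)) (?I (x \<otimes>\<^bsub>?G\<^esub>
        y)) m \<and>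
        ind_comp C \<mu> (ind_tensor_mor C (\<iota> x) (\<iota> y)) = ind_comp C (\<iota> (x \<otimes>\<^bsub>?G\<^esub> y)) m"
    using sca by simp_all
  interpret ind_coproduct U K C \<Gamma> E A \<iota>
    by unfold_locales (use E_Ob cop ex_encoding_Inv[OF \<Gamma>] in auto)
  have \<mu>: "\<mu> \<in> ind_Hom C (ind_tensor C A A) A"
    using alg unfolding algebra_in_def by simp
  define M where "M x y = (SOME m. is_iso (Ind C) (ind_tensor C (?I x) (?I y)) (?I (x \<otimes>\<^bsub>?G\<^esub> y)) m \<and>
        ind_comp C \<mu> (ind_tensor_mor C (\<iota> x) (\<iota> y)) = ind_comp C (\<iota> (x \<otimes>\<^bsub>?G\<^esub> y)) m)" for x y
  have M: "is_iso (Ind C) (ind_tensor C (?I x) (?I y)) (?I (x \<otimes>\<^bsub>?G\<^esub> y)) (M x y) \<and>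
        ind_comp C \<mu> (ind_tensor_mor C (\<iota> x) (\<iota> y)) = ind_comp C (\<iota> (x \<otimes>\<^bsub>?G\<^esub> y)) (M x y)"
    if "x \<in> \<Gamma>" "y \<in> \<Gamma>" for x y
    unfolding M_def by (rule someI_ex) (rule ex_m[OF that])
  define M0 where "M0 x y = component (M x y) (Pair Star Star)" for x y
  have M0: "is_iso C (E x \<boxtimes> E y) (E (x \<otimes>\<^bsub>?G\<^esub> y)) (M0 x y)" if "x \<in> \<Gamma>" "y \<in> \<Gamma>" for x y
    unfolding M0_def
    by (rule const_tensor_iso_component[OF conjunct1[OF M[OF that]] E_Ob[OF that(1)]
        E_Ob[OF that(2)] E_Ob[OF mult[OF that]]])
  let ?l = "proj \<one>\<^bsub>?G\<^esub>"
  have E1: "E \<one>\<^bsub>?G\<^esub> = Unit C" by fact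
  have l: "?l \<in> ind_Hom C A (const_ind C (Unit C))"
    using proj(1)[OF one] E1 by simp
  define \<beta> where "\<beta> = ind_comp C ?l \<mu>"
  have AA: "ind_object C (ind_tensor C A A)" by (rule ind_tensor_object[OF A_obj A_obj])
  have \<beta>: "\<beta> \<in> ind_Hom C (ind_tensor C A A) (const_ind C (Unit C))"
    unfolding \<beta>_def by (rule ind_comp_closed[OF \<mu> l AA A_obj const_obj[OF Unit_closed]])
  have ex_dual: "\<exists>y'. y' \<in> \<Gamma> \<and> y' \<otimes>\<^bsub>?G\<^esub> y = \<one>\<^bsub>?G\<^esub> \<and> y \<otimes>\<^bsub>?G\<^esub> y' = \<one>\<^bsub>?G\<^esub>" if "y \<in> \<Gamma>" for y
    by (rule subgroup_Inv_inverse[OF subgroup that]) blast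
  then obtain dual where dual: "\<And>y. y \<in> \<Gamma> \<Longrightarrow> dual y \<in> \<Gamma> \<and> dual y \<otimes>\<^bsub>?G\<^esub> y = \<one>\<^bsub>?G\<^esub> \<and> y \<otimes>\<^bsub>?G\<^esub> dual y
      = \<one>\<^bsub>?G\<^esub>"
    by metis
  have dual_unique: "x = dual y" if "x \<in> \<Gamma>" "y \<in> \<Gamma>" "x \<otimes>\<^bsub>?G\<^esub> y = \<one>\<^bsub>?G\<^esub>" for x y
    using Inv_inverse_unique[of x y "dual y"] that dual[OF that(2)] \<Gamma> by blast
  have pairing_iota: "component \<beta> (Pair j k) \<cdot> (c \<star> d)
      = (if x = dual y then M0 (dual y) y else hzero C (E x \<boxtimes> E y) (Unit C))"
    if x: "x \<in> \<Gamma>" and y: "y \<in> \<Gamma>" and c: "(j, c) \<in> cls (\<iota> x) Star" and d: "(k, d) \<in> cls (\<iota> y) Star"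
        for x y j c k d
  proof -
    note Ex = const_obj[OF E_Ob[OF x]] and Ey = const_obj[OF E_Ob[OF y]] and xy = mult[OF x y]
    let ?T = "ind_tensor C (?I x) (?I y)"
    have T: "ind_object C ?T" by (rule ind_tensor_object[OF Ex Ey])
    note tt = ind_tensor_mor_closed[OF iota_Hom[OF x] iota_Hom[OF y] Ex A_obj Ey A_obj]
    note tc = ind_tensor_mor_cls(3)[OF iota_Hom[OF x] iota_Hom[OF y] Ex A_obj Ey A_obj c d]
    have Mh: "M x y \<in> ind_Hom C ?T (?I (x \<otimes>\<^bsub>?G\<^esub> y))"
      using M[OF x y] unfolding is_iso_def inverse_mor_def by simp
    have p: "Pair Star Star \<in> Ob (ix ?T)" by simp
    note CM = component[OF Mh T E_Ob[OF xy] p]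
    have "component \<beta> (Pair j k) \<cdot> (c \<star> d) = component (ind_comp C \<beta> (ind_tensor_mor C (\<iota> x) (\<iota> y)))
        (Pair Star Star)"
      by (rule component_comp[OF tt \<beta> T AA Unit_closed tc, symmetric])
    also have "ind_comp C \<beta> (ind_tensor_mor C (\<iota> x) (\<iota> y)) = ind_comp C ?l (ind_comp C (\<iota> (x \<otimes>\<^bsub>?G\<^esub>
        y)) (M x y))"
      unfolding \<beta>_def ind_comp_assoc[OF tt \<mu> l T AA A_obj const_obj[OF Unit_closed]]
          conjunct2[OF M[OF x y]] ..
    also have "\<dots> = ind_comp C (ind_comp C ?l (\<iota> (x \<otimes>\<^bsub>?G\<^esub> y))) (M x y)"
      by (rule ind_comp_assoc[OF Mh iota_Hom[OF xy] l T const_obj[OF E_Ob[OF xy]] A_obj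
          const_obj[OF Unit_closed], symmetric])
    also have "component \<dots> (Pair Star Star) = component (ind_comp C ?l (\<iota> (x \<otimes>\<^bsub>?G\<^esub> y))) Star \<cdot> M0 x
        y"
      unfolding M0_def
      by (rule component_comp[OF Mh ind_comp_closed[OF iota_Hom[OF xy] l const_obj[OF E_Ob[OF xy]]
          A_obj const_obj[OF Unit_closed]]
            T const_obj[OF E_Ob[OF xy]] Unit_closed]) (simp add: CM(1))
    also have "\<dots> = (if \<one>\<^bsub>?G\<^esub> = x \<otimes>\<^bsub>?G\<^esub> y then Idn C (Unit C) else hzero C (E (x \<otimes>\<^bsub>?G\<^esub> y)) (Unit C))
        \<cdot> M0 x y"
      by (simp only: proj(2)[OF one xy] E1)
    also have "\<dots> = (if x = dual y then M0 (dual y) y else hzero C (E x \<boxtimes> E y) (Unit C))"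
    proof (cases "x = dual y")
      case True
      then have "x \<otimes>\<^bsub>?G\<^esub> y = \<one>\<^bsub>?G\<^esub>" using dual[OF y] by simp
      then show ?thesis
        using True CM(2-4) E1 by (simp add: M0_def)
    next
      case False
      then have "x \<otimes>\<^bsub>?G\<^esub> y \<noteq> \<one>\<^bsub>?G\<^esub>" using dual_unique[OF x y] by blast
      then show ?thesis
        using False CM(2-4) by (simp add: M0_def)
    qed
    finally show ?thesis .
  qed
  have m_iso: "is_iso C (E (dual y) \<boxtimes> E y) (Unit C) (M0 (dual y) y)" if y: "y \<in> \<Gamma>" for y
    using M0[of "dual y" y] dual[OF y] y E1 by simp
  have dual_dual: "dual (dual y) = y" if y: "y \<in> \<Gamma>" for y
    using dual_unique[of y "dual y"] dual[OF y] y by simp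
  have simple: "simple_object C (E y)" if y: "y \<in> \<Gamma>" for y
    using invertible_simple[OF _ m_iso[OF y] E_Ob[OF y] E_Ob, of "M0 (dual (dual y)) (dual y)"]
      m_iso[of "dual y"] dual[OF y] dual_dual[OF y] by simp
  have distinct: "x = y" if "x \<in> \<Gamma>" "y \<in> \<Gamma>" "isomorphic C (E x) (E y)" for x y
    using that E_class iso_class_eq_iff[OF E_Ob[OF that(1)] E_Ob[OF that(2)]] by metis
  interpret dual_summands U K C \<Gamma> E A \<iota> \<beta> dual "\<lambda>y. M0 (dual y) y"
  proof unfold_locales
    show "dual y \<in> \<Gamma>" "dual (dual y) = y" if "y \<in> \<Gamma>" for y
      using dual[OF that] dual_dual[OF that] by simp_all
    show "finite {x \<in> \<Gamma>. \<exists>f\<in>Hom C W (E x). f \<noteq> hzero C W (E x)}" if "W \<in> Ob C" for W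
      by (rule finite_nonzero_Hom[OF simple distinct that])
  qed (rule \<beta> m_iso pairing_iota; assumption)+
  note hom = internal_hom_A
  have "is_iso (Ind C) A H \<phi>" if H: "internal_hom (Ind C) A (Unit (Ind C)) H ev"
      and \<phi>: "\<phi> \<in> Hom (Ind C) A H"
    and eq: "ev \<cdot>\<^bsub>Ind C\<^esub> (\<phi> \<star>\<^bsub>Ind C\<^esub> Idn (Ind C) A) = ?l \<cdot>\<^bsub>Ind C\<^esub> \<mu>" for H ev \<phi>
    by (rule internal_hom_comparison_iso[OF A_obj const_obj[OF Unit_closed] hom])
      (use H \<phi> eq in \<open>simp_all add: \<beta>_def\<close>)
  then have "frobenius_algebra (Ind C) A \<mu> \<eta> ?l"
    unfolding frobenius_algebra_def using alg l hom by auto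
  then show ?thesis
    using projection_eq_proj[OF one] by simp
qed

theorem theorem4p15:
  fixes K :: "('k, 'r) ring_scheme"
    and C :: "('k, 'o, 'm, 'z) lin_moncat_scheme"
    and \<Gamma> :: "'o set set"
    and E :: "'o set \<Rightarrow> 'o"
    and A :: "('u, 'o, 'm) ind_obj"
    and \<iota> :: "'o set \<Rightarrow> ('u, 'o, 'm) ind_mor"
    and \<mu> \<eta> :: "('u, 'o, 'm) ind_mor"
  assumes "algebraically_closed K"
    and "tensor_category TYPE('u) K C"
    and "subgroup \<Gamma> (Inv C)"
    and "\<And>g. g \<in> \<Gamma> \<Longrightarrow> E g \<in> g"
    and "E \<one>\<^bsub>Inv C\<^esub> = Unit C"
    and "simple_current_algebra C \<Gamma> E A \<iota> \<mu> \<eta>"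
  shows "frobenius_algebra (Ind C) A \<mu> \<eta>
           (projection (Ind C) \<Gamma> (\<lambda>g. const_ind C (E g)) A \<iota> \<one>\<^bsub>Inv C\<^esub>)"
  by (rule tensor_category.simple_current_algebra_frobenius) fact+

end
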